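(* The following three families of relations hold. (1) Let $n\in\frac12\mathbb{Z}$ with $n\ge 0$. For $a,b\in\mathbb{Z}$ with $8n+1=ab$ set $N:=\frac1{12}(3a-b-2)$ and $\tilde N:=\frac1{12}(3a+b-4)$. Then $$\sum_{\substack{m\in\mathbb{Z}\\ 3m^2+2m\le 2n}}\left(m+\tfrac13\right)c\!\left(f;\,n-\tfrac32m^2-m\right) = -2\sum_{\substack{a,b\in\mathbb{Z}\\ 8n+1=ab}}\mathrm{sgn}^+(N)\,\mathrm{sgn}^+(\tilde N)\Big(\left|N+\tfrac16\right|-\left|\tilde N+\tfrac13\right|\Big),$$ where the sum on the right runs over those $a,b$ for which $N,\tilde N\in\mathbb{Z}$. (2) Let $h\in\{0,1\}$ and $n\in\mathbb{Z}+\frac h2$ with $n\ge 0$. For $a,b\in\mathbb{Z}$ with $8n+3=ab$ set $N:=\frac1{12}(3a-b-4)$ and $\tilde N:=\frac1{12}(3a+b-2)$. Then $$\sum_{\substack{m\in\mathbb{Z}\\ 3m^2+m\le 2n}}\left(m+\tfrac16\right)c_h\!\left(\omega;\,2n-3m^2-m\right) = (-1)^{1+h}\sum_{\substack{a,b\in\mathbb{Z}\\ 8n+3=ab}}\mathrm{sgn}^+(N)\,\mathrm{sgn}^+(\tilde N)\Big(\left|N+\tfrac13\right|-\left|\tilde N+\tfrac16\right|\Big),$$ where the sum on the right runs over those $a,b$ for which $N,\tilde N\in\mathbb{Z}$. (3) Let $h\in\{0,1\}$ and $n\in\frac12\mathbb{Z}$ with $n>0$. For $a,b\in\mathbb{Z}$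 with $2n=ab$ set $N:=\frac16(a-3b-2)$ and $\tilde N:=\frac16(a+3b-2)$. Define $$R_n:=\begin{cases}\tfrac23\left(\sigma(\tfrac n2)-\sigma(n)\right), & n\in\mathbb{Z},\\[2pt] \tfrac13\left(\sigma(2n)-2\sigma(n)\right), & n\in\mathbb{Z}+\tfrac12.\end{cases}$$ Then $$\sum_{\substack{m\in\mathbb{Z}\\ 3m^2+2m+1\le 2n}}\left(m+\tfrac13\right)c_h\!\left(\omega;\,2n-3m^2-2m-1\right) = (-1)^hR_n+(-1)^{1+h}\sum_{\substack{a,b\in\mathbb{Z}\\ 2n=ab}}\mathrm{sgn}^+(N)\,\mathrm{sgn}^+(\tilde N)\Big(\left|N+\tfrac13\right|-\left|\tilde N+\tfrac13\right|\Big),$$ where the sum on the right runs over those $a,b$ for which $\tilde N\in\mathbb{Z}$, and $N\in 2\mathbb{Z}+1$ if $h=0$, respectively $N\in2\mathbb{Z}$ if $h=1$.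
   Context: The coefficients $c(f;n)$ and $c(\omega;n)$ ($n\ge0$ an integer) are those of Ramanujan's mock theta functions $$f(q)=\sum_{n=0}^\infty c(f;n)q^n := 1+\sum_{n=1}^\infty \frac{q^{n^2}}{(1+q)^2(1+q^2)^2\cdots(1+q^n)^2},$$ $$\omega(q)=\sum_{n=0}^\infty c(\omega;n)q^n := \sum_{n=0}^\infty\frac{q^{2n^2+2n}}{(1-q)^2(1-q^3)^2\cdots(1-q^{2n+1})^2}.$$ Conventions: $c(f;n)=0$ if $n\notin\mathbb{Z}$. For $h\in\{0,1\}$ and an integer $n\ge 0$, $c_h(\omega;n):=c(\omega;n)$ if $n\equiv h\pmod 2$ and $c_h(\omega;n):=0$ otherwise. $\sigma(n):=\sum_{0<d\mid n}d$ for positive integers $n$ and $\sigma(n):=0$ if $n\notin\mathbb{Z}$. For an integer $n$, $\mathrm{sgn}^+(n):=\mathrm{sgn}(n)$ if $n\ne0$ and $\mathrm{sgn}^+(0):=1$. All sums over $a,b$ include negative integers. *)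

theory Defs
  imports "HOL-Computational_Algebra.Formal_Power_Series"
begin

text \<open>
  Ramanujan's mock theta functions \<open>f\<close> and \<open>\<omega>\<close> as formal power series in
  \<open>q = fps_X\<close>. The infinite sums are \<^const>\<open>suminf\<close> for the \<open>q\<close>-adic
  topology of formal power series; they converge by
  \<open>summable_mock_f\<close> and \<open>summable_mock_omega\<close> below.
\<close>

definition mock_f_term :: "nat \<Rightarrow> real fps" where
  "mock_f_term n = fps_X ^ (n ^ 2) / (\<Prod>k = 1..n. (1 + fps_X ^ k) ^ 2)"

definition mock_f :: "real fps" where
  "mock_f = 1 + (\<Sum>n. mock_f_term (Suc n))"

definition mock_omega_term :: "nat \<Rightarrow> real fps" where
  "mock_omega_term n =
     fps_X ^ (2 * n ^ 2 + 2 * n) / (\<Prod>k = 0..n. (1 - fps_X ^ (2 * k + 1)) ^ 2)"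

definition mock_omega :: "real fps" where
  "mock_omega = (\<Sum>n. mock_omega_term n)"

text \<open>
  Coefficients, extended by \<open>0\<close> to real arguments that are not nonnegative integers.
\<close>

definition coeff_f :: "real \<Rightarrow> real" where
  "coeff_f x = (if x \<in> \<int> \<and> x \<ge> 0 then fps_nth mock_f (nat \<lfloor>x\<rfloor>) else 0)"

definition coeff_omega :: "real \<Rightarrow> real" where
  "coeff_omega x = (if x \<in> \<int> \<and> x \<ge> 0 then fps_nth mock_omega (nat \<lfloor>x\<rfloor>) else 0)"

definition coeff_omega_h :: "nat \<Rightarrow> real \<Rightarrow> real" where
  "coeff_omega_h h x =
     (if x \<in> \<int> \<and> \<lfloor>x\<rfloor> mod 2 = int h mod 2 then coeff_omega x else 0)"

definition sigma :: "real \<Rightarrow> real" where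
  "sigma x = (if x \<in> \<int> \<and> x > 0 then real (\<Sum>d | d dvd nat \<lfloor>x\<rfloor>. d) else 0)"

definition sgn_plus :: "real \<Rightarrow> real" where
  "sgn_plus x = (if x = 0 then 1 else sgn x)"

text \<open>The second branch is only meant for \<open>x \<in> \<int> + 1/2\<close>.\<close>

definition R_term :: "real \<Rightarrow> real" where
  "R_term x =
     (if x \<in> \<int> then 2 / 3 * (sigma (x / 2) - sigma x)
      else 1 / 3 * (sigma (2 * x) - 2 * sigma x))"

lemma summable_fps_if_low_coeffs_zero:
  fixes g :: "nat \<Rightarrow> real fps"
  assumes low: "\<And>n i. i < n \<Longrightarrow> fps_nth (g n) i = 0"
  shows "summable g"
proof -
  define L where "L = Abs_fps (\<lambda>i. \<Sum>n\<le>i. fps_nth (g n) i)"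
  have "(\<lambda>N. \<Sum>n<N. g n) \<longlonglongrightarrow> L"
  proof (rule tendsto_fpsI)
    fix i
    have "fps_nth (\<Sum>n<N. g n) i = fps_nth L i" if "N > i" for N
    proof -
      have "fps_nth (\<Sum>n<N. g n) i = (\<Sum>n<N. fps_nth (g n) i)"
        by (simp add: fps_sum_nth)
      also have "\<dots> = (\<Sum>n\<le>i. fps_nth (g n) i)"
        by (rule sum.mono_neutral_right) (use that low in auto)
      finally show ?thesis
        by (simp add: L_def)
    qed
    then show "\<forall>\<^sub>F N in sequentially. fps_nth (\<Sum>n<N. g n) i = fps_nth L i"
      by (rule eventually_mono[OF eventually_gt_at_top[of i]])
  qed
  then show ?thesis
    unfolding summable_def sums_def by blast
qed

lemma fps_X_power_divide_nth_eq_0: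
  fixes D :: "real fps"
  assumes "fps_nth D 0 \<noteq> 0" "i < m"
  shows "fps_nth (fps_X ^ m / D) i = 0"
  using assms by (simp add: fps_divide_unit fps_X_power_mult_nth)

lemma summable_mock_f: "summable (\<lambda>n. mock_f_term (Suc n))"
proof (rule summable_fps_if_low_coeffs_zero)
  fix n i :: nat
  assume "i < n"
  have "fps_nth (\<Prod>k = 1..Suc n. (1 + fps_X ^ k) ^ 2 :: real fps) 0 = 1"
    by (auto simp: fps_prod_nth' fps_nth_power_0 power_0_left simp del: prod.cl_ivl_Suc
             intro!: prod.neutral)
  moreover have "n \<le> (Suc n) ^ 2"
    by (simp add: power2_eq_square)
  ultimately show "fps_nth (mock_f_term (Suc n)) i = 0"
    unfolding mock_f_term_def using \<open>i < n\<close>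
    by (intro fps_X_power_divide_nth_eq_0) auto
qed

lemma summable_mock_omega: "summable mock_omega_term"
proof (rule summable_fps_if_low_coeffs_zero)
  fix n i :: nat
  assume "i < n"
  have "fps_nth (\<Prod>k = 0..n. (1 - fps_X ^ (2 * k + 1)) ^ 2 :: real fps) 0 = 1"
    by (simp add: fps_prod_nth' fps_nth_power_0)
  then show "fps_nth (mock_omega_term n) i = 0"
    unfolding mock_omega_term_def using \<open>i < n\<close>
    by (intro fps_X_power_divide_nth_eq_0) auto
qed

end

theory Submission
  imports Defs
begin

text \<open>
  The left-hand sides are coefficients of a mock theta function times a theta series of weight
  \<open>3/2\<close>. By Bailey's lemma, the product of the mock theta function with Euler's product
  \<open>(q\<^sup>2; q\<^sup>2)\<close> is an indefinite double sum, and by the pentagonal number theorem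
  \<open>(q\<^sup>2; q\<^sup>2)\<close> is itself a theta series. Multiplying the claim by
  \<open>(q\<^sup>2; q\<^sup>2)\<close> therefore turns it into an identity between two weighted sums over integral
  binary quadratic forms \<open>Ax\<^sup>2 + 2txy + Cy\<^sup>2\<close> with a fixed value of \<open>t\<^sup>2 - AC\<close>.

  For such forms, consider the signed crossing of the geodesic of the form with the path
  from the cusp \<open>\<infinity>\<close> to \<open>i\<close>, weighted by a sign character and by a linear form.
  Cutting paths at the cusps \<open>\<infinity>, 0, 1, -1\<close> and using the symmetries
  \<open>t \<mapsto> -t\<close> and \<open>A \<leftrightarrow> C\<close> rewrites this sum in terms of the other cusps.
  Three choices of the character give the three families of relations.
\<close>

section \<open>Crossing sums over binary quadratic forms\<close>

text \<open>At a point \<open>z\<close> of the upper half plane a form has the sign of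
  \<open>A|z|^2 + 2t Re z + C\<close>; so \<open>A\<close>, \<open>C\<close>,
  \<open>A + 2 * t + C\<close>, \<open>A - 2 * t + C\<close> and \<open>A + C\<close> are its values
  at infinity, 0, 1, -1 and \<open>i\<close>. The double sums run over \<open>A > 0\<close>,
  \<open>A + C \<le> 0\<close>, which is why the paths end at \<open>i\<close>; geodesics through
  \<open>i\<close> count one half. The obstacle is that \<open>i\<close> is no cusp, so crossings
  there are not governed by divisors. It is removed modulo 3: the relation between the signs at the
  four points of the projective line trades paths that start at infinity and 0 for paths that start
  at 1 and -1. As \<open>A + C\<close> is the mean of the values at 1 and -1, the latter two paths
  together no longer see \<open>i\<close> and leave the smaller of the two absolute values. If the
  values are \<open>3 * x\<close> and \<open>- y\<close>, then
  \<open>(A - C)^2 + 3 * x * y = 4 * \<mu>\<close>: the variable \<open>A - C\<close> separates,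
  becomes the summation variable of the pentagonal series, and cancelling that series leaves a
  divisor sum. Two corrections remain: forms with \<open>A = 0\<close> account for the constant term
  1 in the series for \<open>f\<close>, and the path from infinity to 1 produces the divisor sums in
  \<open>R_term\<close>.\<close>

definition chi3 :: "int \<Rightarrow> real" where
  "chi3 x = (if x mod 3 = 1 then 1 else if x mod 3 = 2 then -1 else 0)"

definition chi4 :: "int \<Rightarrow> real" where
  "chi4 x = (if x mod 4 = 1 then 1 else if x mod 4 = 3 then -1 else 0)"

text \<open>The smaller of two positive numbers, with the sign of \<open>y - x\<close>. Up to a
  constant factor this is the summand on the right-hand sides, see
  \<open>sgn_plus_term\<close>.\<close>

definition mn :: "int \<Rightarrow> int \<Rightarrow> real" where
  "mn x y = (if x < y then of_int x else if y < x then - of_int y else 0)"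

text \<open>
  The signed crossing number of a path whose end points are cusps at which a form takes the values
  \<open>x\<close> and \<open>y\<close>; an end point on the geodesic of the form counts one half.
\<close>
definition cr :: "int \<Rightarrow> int \<Rightarrow> real" where
  "cr x y = (of_int (sgn x) - of_int (sgn y)) / 2"

text \<open>The cut-off is stable under \<open>t -> - t\<close>, \<open>A <-> C\<close> and
  negation, so sums can be rearranged without any discussion of convergence. For
  \<open>K \<ge> 10 * \<mu>\<close> it contains every form that occurs in the sums over
  \<open>reps\<close> below.\<close>

definition box :: "int \<Rightarrow> int \<Rightarrow> (int \<times> int \<times> int) set" where
  "box \<mu> K = {(A, t, C). t\<^sup>2 - A * C = \<mu> \<and> \<bar>A\<bar> \<le> K \<and> \<bar>t\<bar> \<le> K \<and> \<bar>C\<bar> \<le> K}"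

lemma finite_box [simp]: "finite (box \<mu> K)"
proof (rule finite_subset)
  show "box \<mu> K \<subseteq> {-K..K} \<times> {-K..K} \<times> {-K..K}"
    by (auto simp: box_def)
qed auto

lemma chi3_minus: "chi3 (- x) = - chi3 x"
  unfolding chi3_def by (simp split: if_splits) presburger

lemma chi4_minus: "chi4 (- x) = - chi4 x"
  unfolding chi4_def by (simp split: if_splits) presburger

lemma chi3_cong: "x mod 3 = y mod 3 \<Longrightarrow> chi3 x = chi3 y"
  by (simp add: chi3_def)

lemma chi4_cong: "x mod 4 = y mod 4 \<Longrightarrow> chi4 x = chi4 y"
  by (simp add: chi4_def)

text \<open>At a zero \<open>v\<close> of the form modulo 3 the sign is \<open>chi3\<close> of the
  bilinear form at \<open>v\<close>, \<open>w\<close> with \<open>det (v, w) = 1\<close>. For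
  \<open>v = (1, 0)\<close> this is \<open>chi3 t\<close>; the points \<open>(0, 1)\<close>,
  \<open>(1, 1)\<close> and \<open>(1, -1)\<close> give \<open>- t\<close>, \<open>t + C\<close> and
  \<open>t - C\<close> in place of \<open>t\<close>.\<close>

definition root_char :: "int \<Rightarrow> int \<Rightarrow> real" where
  "root_char x y = (if 3 dvd x then chi3 y else 0)"

lemma root_char_minus: "root_char x (- y) = - root_char x y"
  and root_char_minus_left: "root_char (- x) y = root_char x y"
  by (simp_all add: root_char_def chi3_minus)

text \<open>
  Modulo \<open>3\<close>, a form with \<open>t\<^sup>2 - AC \<equiv> 1\<close> has exactly two zeros on the projective line,
  and they carry opposite signs. The four terms are the signs at the four points of that line.
\<close>
lemma root_char_sum:
  assumes "t\<^sup>2 - A * C = \<mu>" "\<mu> mod 3 = (1 :: int)"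
  shows "root_char A t - root_char C t + root_char (A + 2 * t + C) (t + C)
           + root_char (A - 2 * t + C) (t - C) = 0"
proof -
  have *: "((t mod 3)\<^sup>2 - (A mod 3) * (C mod 3)) mod 3 = 1"
    using assms by (metis mod_diff_eq mod_mult_eq power_mod)
  have A: "A mod 3 = 0 \<or> A mod 3 = 1 \<or> A mod 3 = 2"
   and t: "t mod 3 = 0 \<or> t mod 3 = 1 \<or> t mod 3 = 2"
   and C: "C mod 3 = 0 \<or> C mod 3 = 1 \<or> C mod 3 = 2" by presburger+
  have e1: "(A + 2 * t + C) mod 3 = (A mod 3 + 2 * (t mod 3) + C mod 3) mod 3"
    by (intro mod_add_cong mod_mult_cong) simp_all
  have e2: "(A - 2 * t + C) mod 3 = (A mod 3 - 2 * (t mod 3) + C mod 3) mod 3"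
    by (intro mod_add_cong mod_diff_cong mod_mult_cong) simp_all
  have e3: "(t + C) mod 3 = (t mod 3 + C mod 3) mod 3" and e4: "(t - C) mod 3 = (t mod 3 - C mod 3) mod 3"
    by (simp_all add: mod_simps)
  show ?thesis
    using A t C * unfolding root_char_def chi3_def dvd_eq_mod_eq_0 e1 e2 e3 e4
    by (elim disjE) simp_all
qed

text \<open>If \<open>N1\<close> and \<open>N2\<close> have the same sign, so has their mean
  \<open>E\<close>, and nothing is crossed. For opposite signs \<open>E\<close> sides with the
  larger absolute value, so only the path from the smaller one is crossed; this is where minima come
  from.\<close>

lemma cr_difference:
  fixes N1 N2 E :: int
  assumes "2 * E = N1 + N2"
  shows "of_int N1 * cr N1 E - of_int N2 * cr N2 E
    = (if N1 * N2 < 0 then mn \<bar>N1\<bar> \<bar>N2\<bar> else 0)"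
proof -
  consider "N1 = 0" | "N2 = 0" | "N1 > 0" "N2 > 0" | "N1 < 0" "N2 < 0" | "N1 > 0" "N2 < 0" | "N1 < 0" "N2 > 0"
    by linarith
  then show ?thesis
    using assms
    by cases (auto simp: cr_def mn_def sgn_if mult_less_0_iff abs_if)
qed

text \<open>Oddness under \<open>A <-> C\<close> matches the sign of \<open>root_char C t\<close> in
  \<open>root_char_sum\<close>; oddness under negation makes the weighted summands agree on a form
  and its negative.\<close>

locale form_char =
  fixes \<epsilon> :: "int \<Rightarrow> int \<Rightarrow> int \<Rightarrow> real"
  assumes eps_refl: "\<epsilon> A (- t) C = \<epsilon> A t C"
    and eps_swap: "\<epsilon> C t A = - \<epsilon> A t C"
    and eps_minus: "\<epsilon> (- A) (- t) (- C) = - \<epsilon> A t C"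
begin

lemma sum_box_refl:
  "(\<Sum>(A, t, C)\<in>box \<mu> K. h A t C) = (\<Sum>(A, t, C)\<in>box \<mu> K. h A (- t) C)"
  by (rule sum.reindex_bij_witness[of _ "\<lambda>(A, t, C). (A, - t, C)" "\<lambda>(A, t, C). (A, - t, C)"])
     (auto simp: box_def)

lemma sum_box_swap:
  "(\<Sum>(A, t, C)\<in>box \<mu> K. h A t C) = (\<Sum>(A, t, C)\<in>box \<mu> K. h C t A)"
  by (rule sum.reindex_bij_witness[of _ "\<lambda>(A, t, C). (C, t, A)" "\<lambda>(A, t, C). (C, t, A)"])
     (auto simp: box_def mult.commute)

text \<open>The path is cut at the cusp 1, and the weight is changed to the value
  \<open>A + 2 * t + C\<close> at that cusp, so that forms vanishing there contribute nothing. The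
  forms with \<open>A = 0\<close> are split off because the exchange of \<open>A\<close> and
  \<open>C\<close> needs the sum over all forms.\<close>

lemma crossing_identity:
  assumes mu: "\<mu> mod 3 = 1"
  shows "4 * (\<Sum>(A, t, C)\<in>box \<mu> K. if A \<noteq> 0 then \<epsilon> A t C * root_char A t * t * cr A (A + C) else 0)
    = 2 * (\<Sum>(A, t, C)\<in>box \<mu> K.
            if A \<noteq> 0 then \<epsilon> A t C * root_char A t * (A + 2 * t + C) * cr A (A + 2 * t + C) else 0)
      - 2 * (\<Sum>(A, t, C)\<in>box \<mu> K.
            if A = 0 then \<epsilon> A t C * root_char A t * (A + 2 * t + C) * cr (A + 2 * t + C) (A + C) else 0)
      - (\<Sum>(A, t, C)\<in>box \<mu> K.
            if (A + 2 * t + C) * (A - 2 * t + C) < 0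
            then \<epsilon> A t C * root_char (A + 2 * t + C) (t + C) * mn \<bar>A + 2 * t + C\<bar> \<bar>A - 2 * t + C\<bar> else 0)"
    (is "4 * ?b = 2 * ?L - 2 * ?Wz - ?V")
proof -
  let ?D = "box \<mu> K"
  \<comment> \<open>The weight \<open>A + C\<close> is even in \<open>t\<close> and
    \<open>root_char\<close> is odd, so this sum vanishes; hence the weight \<open>2 * t\<close> may
    be replaced by \<open>A + 2 * t + C\<close>.\<close>
  let ?SE = "\<Sum>(A, t, C)\<in>?D. if A \<noteq> 0 then \<epsilon> A t C * root_char A t * (A + C) * cr A (A + C) else 0"
  have "?SE = (\<Sum>(A, t, C)\<in>?D. if A \<noteq> 0 then \<epsilon> A (- t) C * root_char A (- t) * (A + C) * cr A (A + C) else 0)"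
    by (rule sum_box_refl)
  also have "\<dots> = - ?SE"
    unfolding sum_negf[symmetric] by (rule sum.cong) (auto simp: eps_refl root_char_minus)
  finally have SE: "?SE = 0" by simp
  let ?Wn = "\<Sum>(A, t, C)\<in>?D. if A \<noteq> 0 then \<epsilon> A t C * root_char A t * (A + 2 * t + C) * cr (A + 2 * t + C) (A + C) else 0"
  let ?Wa = "\<Sum>(A, t, C)\<in>?D. \<epsilon> A t C * root_char A t * (A + 2 * t + C) * cr (A + 2 * t + C) (A + C)"
  have W: "?Wa = ?Wz + ?Wn"
    unfolding sum.distrib[symmetric]
  proof (rule sum.cong, simp, clarify)
    fix A t C :: int
    show "\<epsilon> A t C * root_char A t * (A + 2 * t + C) * cr (A + 2 * t + C) (A + C)
      = (if A = 0 then \<epsilon> A t C * root_char A t * (A + 2 * t + C) * cr (A + 2 * t + C) (A + C) else 0)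
      + (if A \<noteq> 0 then \<epsilon> A t C * root_char A t * (A + 2 * t + C) * cr (A + 2 * t + C) (A + C) else 0)"
      by simp
  qed
  have "2 * ?b + ?SE = (\<Sum>(A, t, C)\<in>?D. if A \<noteq> 0 then \<epsilon> A t C * root_char A t * (A + 2 * t + C) * cr A (A + C) else 0)"
    unfolding sum_distrib_left sum.distrib[symmetric] by (rule sum.cong) (auto simp: algebra_simps)
  \<comment> \<open>Additivity of crossing numbers along infinity, 1, \<open>i\<close>.\<close>
  also have "\<dots> = ?L + ?Wn"
    unfolding sum.distrib[symmetric] by (rule sum.cong) (auto simp: cr_def field_simps)
  finally have b: "2 * ?b = ?L + ?Wn" using SE by simp
  have W': "?Wa = (\<Sum>(A, t, C)\<in>?D. \<epsilon> C t A * root_char C t * (C + 2 * t + A) * cr (C + 2 * t + A) (C + A))"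
    by (rule sum_box_swap)
  have "2 * ?Wa = (\<Sum>(A, t, C)\<in>?D. \<epsilon> A t C * (root_char A t - root_char C t) * (A + 2 * t + C) * cr (A + 2 * t + C) (A + C))"
    (is "_ = ?R")
  proof -
    have "2 * ?Wa = ?Wa + (\<Sum>(A, t, C)\<in>?D. \<epsilon> C t A * root_char C t * (C + 2 * t + A) * cr (C + 2 * t + A) (C + A))"
      using W' by linarith
    also have "\<dots> = ?R"
  proof (unfold sum.distrib[symmetric], rule sum.cong, simp, clarify)
    fix A t C :: int
    have *: "C + 2 * t + A = A + 2 * t + C" "C + A = A + C" by simp_all
    show "\<epsilon> A t C * root_char A t * (A + 2 * t + C) * cr (A + 2 * t + C) (A + C)
      + \<epsilon> C t A * root_char C t * (C + 2 * t + A) * cr (C + 2 * t + A) (C + A)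
      = \<epsilon> A t C * (root_char A t - root_char C t) * (A + 2 * t + C) * cr (A + 2 * t + C) (A + C)"
      unfolding * eps_swap[of C t A] by (simp add: algebra_simps)
  qed
    finally show ?thesis .
  qed
  \<comment> \<open>The signs at infinity and 0 are exchanged for those at 1 and -1.\<close>
  also have "\<dots> = (\<Sum>(A, t, C)\<in>?D. - (\<epsilon> A t C * root_char (A + 2 * t + C) (t + C) * (A + 2 * t + C) * cr (A + 2 * t + C) (A + C)))
     + (\<Sum>(A, t, C)\<in>?D. - (\<epsilon> A t C * root_char (A - 2 * t + C) (t - C) * (A + 2 * t + C) * cr (A + 2 * t + C) (A + C)))"
  proof (unfold sum.distrib[symmetric], rule sum.cong, simp, clarify)
    fix A t C assume "(A, t, C) \<in> ?D"
    then have "t\<^sup>2 - A * C = \<mu>" by (simp add: box_def)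
    from root_char_sum[OF this mu]
    have *: "root_char A t - root_char C t = - root_char (A + 2 * t + C) (t + C) - root_char (A - 2 * t + C) (t - C)"
      by linarith
    show "\<epsilon> A t C * (root_char A t - root_char C t) * (A + 2 * t + C) * cr (A + 2 * t + C) (A + C)
      = - (\<epsilon> A t C * root_char (A + 2 * t + C) (t + C) * (A + 2 * t + C) * cr (A + 2 * t + C) (A + C))
      + - (\<epsilon> A t C * root_char (A - 2 * t + C) (t - C) * (A + 2 * t + C) * cr (A + 2 * t + C) (A + C))"
      unfolding * by (simp add: algebra_simps)
  qed
  \<comment> \<open>The reflection \<open>t -> - t\<close> exchanges the cusps 1 and -1, so both
    parts carry the sign at 1 and differ only in the path; then \<open>cr_difference\<close> applies
    with mean \<open>A + C\<close>.\<close>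
  also have "(\<Sum>(A, t, C)\<in>?D. - (\<epsilon> A t C * root_char (A - 2 * t + C) (t - C) * (A + 2 * t + C) * cr (A + 2 * t + C) (A + C)))
     = (\<Sum>(A, t, C)\<in>?D. \<epsilon> A t C * root_char (A + 2 * t + C) (t + C) * (A - 2 * t + C) * cr (A - 2 * t + C) (A + C))"
  proof (subst sum_box_refl, rule sum.cong, simp, clarify)
    fix A t C :: int
    have *: "A - 2 * (- t) + C = A + 2 * t + C" "A + 2 * (- t) + C = A - 2 * t + C" "- t - C = - (t + C)"
      by simp_all
    show "- (\<epsilon> A (- t) C * root_char (A - 2 * (- t) + C) (- t - C) * (A + 2 * (- t) + C) * cr (A + 2 * (- t) + C) (A + C))
      = \<epsilon> A t C * root_char (A + 2 * t + C) (t + C) * (A - 2 * t + C) * cr (A - 2 * t + C) (A + C)"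
      unfolding * eps_refl root_char_minus by simp
  qed
  also have "(\<Sum>(A, t, C)\<in>?D. - (\<epsilon> A t C * root_char (A + 2 * t + C) (t + C) * (A + 2 * t + C) * cr (A + 2 * t + C) (A + C)))
    + \<dots> = - ?V"
  proof (unfold sum.distrib[symmetric] sum_negf[symmetric], rule sum.cong, simp, clarify)
    fix A t C :: int
    have "2 * (A + C) = (A + 2 * t + C) + (A - 2 * t + C)" by simp
    note * = cr_difference[OF this]
    have **: "- (e * r * x * c) + e * r * y * d = - (e * r * (x * c - y * d))" for e r x c y d :: real
      by (simp add: algebra_simps)
    show "- (\<epsilon> A t C * root_char (A + 2 * t + C) (t + C) * (A + 2 * t + C) * cr (A + 2 * t + C) (A + C))
      + \<epsilon> A t C * root_char (A + 2 * t + C) (t + C) * (A - 2 * t + C) * cr (A - 2 * t + C) (A + C)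
      = - (if (A + 2 * t + C) * (A - 2 * t + C) < 0
            then \<epsilon> A t C * root_char (A + 2 * t + C) (t + C) * mn \<bar>A + 2 * t + C\<bar> \<bar>A - 2 * t + C\<bar> else 0)"
      unfolding ** * by simp
  qed
  finally have "2 * ?Wa = - ?V" .
  with b W show ?thesis by simp
qed


lemma sum_box_half:
  assumes even: "\<And>A t C. h (- A) (- t) (- C) = h A t C"
    and pos: "\<And>A t C. h A t C \<noteq> 0 \<Longrightarrow> pos A t C \<noteq> pos (- A) (- t) (- C)"
  shows "(\<Sum>(A, t, C)\<in>box \<mu> K. h A t C) = 2 * (\<Sum>(A, t, C)\<in>{(A, t, C)\<in>box \<mu> K. pos A t C}. h A t C :: real)"
proof -
  let ?p = "\<Sum>(A, t, C)\<in>box \<mu> K. if pos A t C then h A t C else 0"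
  have "(\<Sum>(A, t, C)\<in>box \<mu> K. h A t C)
     = ?p + (\<Sum>(A, t, C)\<in>box \<mu> K. if pos (- A) (- t) (- C) then h (- A) (- t) (- C) else 0)"
    unfolding sum.distrib[symmetric]
  proof (intro sum.cong refl, clarify)
    fix A t C
    show "h A t C = (if pos A t C then h A t C else 0) + (if pos (- A) (- t) (- C) then h (- A) (- t) (- C) else 0)"
      using pos[of A t C] by (cases "h A t C = 0") (auto simp: even)
  qed
  also have "(\<Sum>(A, t, C)\<in>box \<mu> K. if pos (- A) (- t) (- C) then h (- A) (- t) (- C) else 0) = ?p"
    by (rule sum.reindex_bij_witness[of _ "\<lambda>(A, t, C). (- A, - t, - C)" "\<lambda>(A, t, C). (- A, - t, - C)"])
       (auto simp: box_def)
  also have "?p = (\<Sum>(A, t, C)\<in>{(A, t, C)\<in>box \<mu> K. pos A t C}. h A t C)"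
    by (rule sum.mono_neutral_cong_right) (auto intro: finite_subset[OF _ finite_box] split: if_splits)
  finally show ?thesis by simp
qed

end

section \<open>Crossing sums as sums over the solutions of t^2 + 3nm = \<mu>\<close>

definition reps :: "int \<Rightarrow> (int \<times> int \<times> int) set" where
  "reps \<mu> = {(t, n, m). n > 0 \<and> m > 0 \<and> t\<^sup>2 + 3 * n * m = \<mu>}"

lemma repsD:
  assumes "(t, n, m) \<in> reps \<mu>"
  shows "n > 0" "m > 0" "t\<^sup>2 + 3 * n * m = \<mu>" "3 * n \<le> \<mu>" "m \<le> \<mu>" "\<bar>t\<bar> \<le> \<mu>"
proof -
  show *: "n > 0" "m > 0" "t\<^sup>2 + 3 * n * m = \<mu>" using assms by (auto simp: reps_def)
  have "n * 1 \<le> n * m" "1 * m \<le> n * m" using * by (intro mult_mono; simp)+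
  moreover have "\<bar>t\<bar> * 1 \<le> \<bar>t\<bar> * \<bar>t\<bar>" by (cases "t = 0", simp, rule mult_left_mono) linarith+
  then have "\<bar>t\<bar> \<le> t\<^sup>2" by (simp add: power2_eq_square flip: abs_mult)
  moreover have "t\<^sup>2 \<ge> 0" by simp
  ultimately show "3 * n \<le> \<mu>" "m \<le> \<mu>" "\<bar>t\<bar> \<le> \<mu>" using * by linarith+
qed

lemma finite_reps [simp]: "finite (reps \<mu>)"
proof (rule finite_subset)
  show "reps \<mu> \<subseteq> {-\<mu>..\<mu>} \<times> {0..\<mu>} \<times> {0..\<mu>}"
  proof
    fix F assume "F \<in> reps \<mu>"
    then obtain t n m where F: "F = (t, n, m)" "(t, n, m) \<in> reps \<mu>" by (cases F) auto
    from repsD[OF F(2)] show "F \<in> {-\<mu>..\<mu>} \<times> {0..\<mu>} \<times> {0..\<mu>}" by (auto simp: F)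
  qed
qed auto

lemma sum_reps_half:
  assumes "\<And>t n m. h (- t) n m = h t n m" and "\<And>t n m. 3 dvd t \<Longrightarrow> h t n m = 0"
  shows "(\<Sum>(t, n, m)\<in>reps \<mu>. h t n m) = 2 * (\<Sum>(t, n, m)\<in>{(t, n, m)\<in>reps \<mu>. t mod 3 = 1}. h t n m :: real)"
proof -
  let ?p = "\<Sum>(t, n, m)\<in>reps \<mu>. if t mod 3 = 1 then h t n m else 0"
  have "(\<Sum>(t, n, m)\<in>reps \<mu>. h t n m) = ?p + (\<Sum>(t, n, m)\<in>reps \<mu>. if (- t) mod 3 = 1 then h (- t) n m else 0)"
    unfolding sum.distrib[symmetric]
  proof (intro sum.cong refl, clarify)
    fix t n m :: int
    have "3 dvd t \<or> (t mod 3 = 1 \<and> (- t) mod 3 \<noteq> 1) \<or> (t mod 3 \<noteq> 1 \<and> (- t) mod 3 = 1)" by presburger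
    then consider "3 dvd t" | "t mod 3 = 1" "(- t) mod 3 \<noteq> 1" | "t mod 3 \<noteq> 1" "(- t) mod 3 = 1" by blast
    then show "h t n m = (if t mod 3 = 1 then h t n m else 0) + (if (- t) mod 3 = 1 then h (- t) n m else 0)"
      using assms by cases auto
  qed
  also have "(\<Sum>(t, n, m)\<in>reps \<mu>. if (- t) mod 3 = 1 then h (- t) n m else 0) = ?p"
    by (rule sum.reindex_bij_witness[of _ "\<lambda>(A, t, C). (- A, t, C)" "\<lambda>(A, t, C). (- A, t, C)"])
       (auto simp: reps_def)
  also have "?p = (\<Sum>(t, n, m)\<in>{(t, n, m)\<in>reps \<mu>. t mod 3 = 1}. h t n m)"
    by (rule sum.mono_neutral_cong_right) (auto intro: finite_subset[OF _ finite_reps] split: if_splits)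
  finally show ?thesis by simp
qed

lemma chi3_add_multiple: "chi3 (x + 3 * y) = chi3 x" "chi3 (x - 3 * y) = chi3 x"
  by (rule chi3_cong, presburger)+

context form_char
begin

text \<open>For \<open>A > 0\<close> a crossing needs \<open>A + C \<le> 0\<close>, hence
  \<open>C < 0\<close>; with \<open>3 dvd A\<close> the form is \<open>(3 * n, t, - m)\<close>. The
  factor 4 comes from the two signs of the form and the two signs of \<open>t\<close>.\<close>

lemma crossing_sum_reps:
  assumes K: "10 * \<mu> \<le> K"
  shows "(\<Sum>(A, t, C)\<in>box \<mu> K. if A \<noteq> 0 then \<epsilon> A t C * root_char A t * t * cr A (A + C) else 0)
    = 4 * (\<Sum>(t, n, m)\<in>{(t, n, m)\<in>reps \<mu>. t mod 3 = 1}. \<epsilon> (3 * n) t (- m) * t * cr (3 * n) (3 * n - m))"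
    (is "?l = 4 * ?r")
proof -
  have cr_minus: "cr (- x) (- y) = - cr x y" for x y
    by (simp add: cr_def field_simps sgn_minus)
  have "?l = 2 * (\<Sum>(A, t, C)\<in>{(A, t, C)\<in>box \<mu> K. A > 0}.
      if A \<noteq> 0 then \<epsilon> A t C * root_char A t * t * cr A (A + C) else 0)"
  proof (rule sum_box_half, goal_cases)
    case (1 A t C)
    have "- A + - C = - (A + C)" by simp
    then show ?case by (simp only: cr_minus) (simp add: eps_minus root_char_def chi3_minus)
  qed (auto split: if_splits)
  also have "(\<Sum>(A, t, C)\<in>{(A, t, C)\<in>box \<mu> K. A > 0}.
      if A \<noteq> 0 then \<epsilon> A t C * root_char A t * t * cr A (A + C) else 0)
     = (\<Sum>(A, t, C)\<in>{(A, t, C)\<in>box \<mu> K. A > 0 \<and> C < 0 \<and> 3 dvd A}. \<epsilon> A t C * chi3 t * t * cr A (A + C))"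
    by (rule sum.mono_neutral_cong_right)
       (auto simp: root_char_def cr_def sgn_if intro: finite_subset[OF _ finite_box] split: if_splits)
  also have "\<dots> = (\<Sum>(t, n, m)\<in>reps \<mu>. \<epsilon> (3 * n) t (- m) * chi3 t * t * cr (3 * n) (3 * n - m))"
  proof (rule sum.reindex_bij_witness[of _ "\<lambda>(t, n, m). (3 * n, t, - m)" "\<lambda>(A, t, C). (t, A div 3, - C)"], goal_cases)
    case (4 F)
    obtain t n m where F: "F = (t, n, m)" by (cases F)
    note * = repsD[OF 4[unfolded F]]
    have "\<mu> \<le> K" using * K by linarith
    with * show ?case unfolding F by (auto simp: box_def)
  qed (auto simp: box_def reps_def elim!: dvdE)
  also have "\<dots> = 2 * (\<Sum>(t, n, m)\<in>{(t, n, m)\<in>reps \<mu>. t mod 3 = 1}. \<epsilon> (3 * n) t (- m) * chi3 t * t * cr (3 * n) (3 * n - m))"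
  proof (rule sum_reps_half, goal_cases)
    case (1 t n m)
    show ?case by (simp add: eps_refl chi3_minus)
  qed (auto simp: chi3_def)
  also have "(\<Sum>(t, n, m)\<in>{(t, n, m)\<in>reps \<mu>. t mod 3 = 1}. \<epsilon> (3 * n) t (- m) * chi3 t * t * cr (3 * n) (3 * n - m)) = ?r"
    by (rule sum.cong) (auto simp: chi3_def)
  finally show ?thesis by simp
qed

text \<open>Moving the cusp 1 to 0 replaces \<open>t\<close> by \<open>s = t + A\<close> and
  \<open>C\<close> by \<open>- d = A + 2 * t + C\<close>, and \<open>s^2 + A * d = \<mu>\<close>.
  Since \<open>3 dvd A\<close>, \<open>chi3\<close> does not see the shift.\<close>

lemma cusp_sum_reps:
  assumes K: "10 * \<mu> \<le> K"
  shows "(\<Sum>(A, t, C)\<in>box \<mu> K.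
            if A \<noteq> 0 then \<epsilon> A t C * root_char A t * (A + 2 * t + C) * cr A (A + 2 * t + C) else 0)
    = - 2 * (\<Sum>(s, n, d)\<in>reps \<mu>. \<epsilon> (3 * n) (s - 3 * n) (3 * n - d - 2 * s) * chi3 s * d)"
    (is "?l = - 2 * ?r")
proof -
  have cr_minus: "cr (- x) (- y) = - cr x y" for x y
    by (simp add: cr_def field_simps sgn_minus)
  have "?l = 2 * (\<Sum>(A, t, C)\<in>{(A, t, C)\<in>box \<mu> K. A > 0}.
      if A \<noteq> 0 then \<epsilon> A t C * root_char A t * (A + 2 * t + C) * cr A (A + 2 * t + C) else 0)"
  proof (rule sum_box_half, goal_cases)
    case (1 A t C)
    have *: "- A + 2 * - t + - C = - (A + 2 * t + C)" by simp
    show ?case unfolding * cr_minus eps_minus of_int_minus root_char_minus root_char_minus_left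
      by (simp only: mult_minus_left mult_minus_right minus_minus neg_equal_0_iff_equal)
  qed (auto split: if_splits)
  also have "(\<Sum>(A, t, C)\<in>{(A, t, C)\<in>box \<mu> K. A > 0}.
      if A \<noteq> 0 then \<epsilon> A t C * root_char A t * (A + 2 * t + C) * cr A (A + 2 * t + C) else 0)
     = (\<Sum>(A, t, C)\<in>{(A, t, C)\<in>box \<mu> K. A > 0 \<and> A + 2 * t + C < 0 \<and> 3 dvd A}.
          \<epsilon> A t C * chi3 t * (A + 2 * t + C))"
  proof (rule sum.mono_neutral_cong_right, goal_cases)
    case 1
    show ?case by (rule finite_subset[OF _ finite_box]) auto
  next
    case 3
    show ?case
    proof
      fix F
      assume "F \<in> {(A, t, C)\<in>box \<mu> K. A > 0} - {(A, t, C)\<in>box \<mu> K. A > 0 \<and> A + 2 * t + C < 0 \<and> 3 dvd A}"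
      moreover obtain A t C where F: "F = (A, t, C)" by (cases F)
      ultimately have "A > 0" "\<not> (A > 0 \<and> A + 2 * t + C < 0 \<and> 3 dvd A)" by auto
      then consider "\<not> 3 dvd A" | "A + 2 * t + C = 0" | "A + 2 * t + C > 0" by linarith
      then show "(case F of (A, t, C) \<Rightarrow>
          if A \<noteq> 0 then \<epsilon> A t C * root_char A t * (A + 2 * t + C) * cr A (A + 2 * t + C) else 0) = 0"
        using \<open>A > 0\<close> unfolding F by cases (auto simp: root_char_def cr_def)
    qed
  next
    case (4 x)
    then show ?case by (auto simp: root_char_def cr_def)
  qed auto
  also have "\<dots> = (\<Sum>(s, n, d)\<in>reps \<mu>. - (\<epsilon> (3 * n) (s - 3 * n) (3 * n - d - 2 * s) * chi3 s * d))"
  proof (rule sum.reindex_bij_witness[of _ "\<lambda>(s, n, d). (3 * n, s - 3 * n, 3 * n - d - 2 * s)"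
      "\<lambda>(A, t, C). (t + A, A div 3, - (A + 2 * t + C))"], goal_cases)
    case (1 F)
    then show ?case by (auto elim!: dvdE)
  next
    case (2 F)
    then show ?case by (auto simp: box_def reps_def algebra_simps power2_eq_square elim!: dvdE)
  next
    case (3 F)
    then show ?case by (cases F) auto
  next
    case (4 F)
    obtain s n d where F: "F = (s, n, d)" by (cases F)
    note * = repsD[OF 4[unfolded F]]
    have "(s - 3 * n)\<^sup>2 - 3 * n * (3 * n - d - 2 * s) = \<mu>"
      using *(3) by (simp add: power2_eq_square algebra_simps)
    moreover have "\<mu> \<ge> 0" using * by linarith
    ultimately show ?case
      using * K unfolding F by (auto simp: box_def)
  next
    case (5 F)
    obtain A t C where F: "F = (A, t, C)" by (cases F)
    from 5 obtain n where n: "A = 3 * n" unfolding F by auto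
    show ?case unfolding F n by (simp add: chi3_add_multiple) (simp add: algebra_simps)
  qed
  also have "\<dots> = - ?r" by (simp add: sum_negf split_beta)
  finally show ?thesis by simp
qed

text \<open>Let \<open>3 * x\<close> and \<open>- y\<close> be the values at 1 and -1, and
  \<open>s = A - C\<close>. Then \<open>s^2 + 3 * x * y = (A - C)^2 + 4 * t^2 - (A + C)^2 = 4 *
  \<mu>\<close>. The congruences say that \<open>t = (3 * x + y) / 4\<close>, \<open>A\<close> and
  \<open>C\<close> are integers.\<close>

lemma midpoint_sum_reps:
  assumes K: "10 * \<mu> \<le> K"
  shows "(\<Sum>(A, t, C)\<in>box \<mu> K.
            if (A + 2 * t + C) * (A - 2 * t + C) < 0
            then \<epsilon> A t C * root_char (A + 2 * t + C) (t + C) * mn \<bar>A + 2 * t + C\<bar> \<bar>A - 2 * t + C\<bar> else 0)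
    = 4 * (\<Sum>(s, x, y)\<in>{(s, x, y)\<in>reps (4 * \<mu>). s mod 3 = 1 \<and> 4 dvd 3 * x + y \<and> even (x + s)}.
        \<epsilon> ((3 * x + s) div 2 - (3 * x + y) div 4) ((3 * x + y) div 4) ((3 * x - s) div 2 - (3 * x + y) div 4)
          * mn (3 * x) y)"
    (is "?l = 4 * ?r")
proof -
  let ?e = "\<lambda>s x y. \<epsilon> ((3 * x + s) div 2 - (3 * x + y) div 4) ((3 * x + y) div 4) ((3 * x - s) div 2 - (3 * x + y) div 4)"
  have "?l = 2 * (\<Sum>(A, t, C)\<in>{(A, t, C)\<in>box \<mu> K. A + 2 * t + C > 0}.
      if (A + 2 * t + C) * (A - 2 * t + C) < 0
            then \<epsilon> A t C * root_char (A + 2 * t + C) (t + C) * mn \<bar>A + 2 * t + C\<bar> \<bar>A - 2 * t + C\<bar> else 0)"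
  proof (rule sum_box_half, goal_cases)
    case (1 A t C)
    have *: "- A + 2 * - t + - C = - (A + 2 * t + C)" "- A - 2 * - t + - C = - (A - 2 * t + C)" "- t + - C = - (t + C)" by simp_all
    show ?case unfolding * root_char_minus root_char_minus_left eps_minus minus_mult_minus abs_minus_cancel by simp
  next
    case (2 A t C)
    then have "A + 2 * t + C \<noteq> 0" by auto
    then show ?case by linarith
  qed
  also have "(\<Sum>(A, t, C)\<in>{(A, t, C)\<in>box \<mu> K. A + 2 * t + C > 0}.
      if (A + 2 * t + C) * (A - 2 * t + C) < 0
            then \<epsilon> A t C * root_char (A + 2 * t + C) (t + C) * mn \<bar>A + 2 * t + C\<bar> \<bar>A - 2 * t + C\<bar> else 0)
     = (\<Sum>(A, t, C)\<in>{(A, t, C)\<in>box \<mu> K. A + 2 * t + C > 0 \<and> A - 2 * t + C < 0 \<and> 3 dvd A + 2 * t + C}.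
          \<epsilon> A t C * chi3 (A - C) * mn (A + 2 * t + C) (- (A - 2 * t + C)))"
  proof (rule sum.mono_neutral_cong_right, goal_cases)
    case 1
    show ?case by (rule finite_subset[OF _ finite_box]) auto
  next
    case 3
    show ?case by (auto simp: root_char_def mult_less_0_iff split: if_splits)
  next
    case (4 F)
    obtain A t C where F: "F = (A, t, C)" by (cases F)
    have "3 dvd A + 2 * t + C" using 4 unfolding F by simp
    \<comment> \<open>The difference of the two arguments is congruent to
      \<open>A + 2 * t + C\<close> modulo 3.\<close>
    then have "chi3 (t + C) = chi3 (A - C)" by (intro chi3_cong) presburger
    then show ?case using 4 unfolding F by (auto simp: root_char_def mult_less_0_iff)
  qed auto
  also have "\<dots> = (\<Sum>(s, x, y)\<in>reps (4 * \<mu>). if 4 dvd 3 * x + y \<and> even (x + s)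
      then ?e s x y * chi3 s * mn (3 * x) y else 0)"
    (is "_ = ?q")
  proof -
    have "?q = (\<Sum>(s, x, y)\<in>{(s, x, y)\<in>reps (4 * \<mu>). 4 dvd 3 * x + y \<and> even (x + s)}. ?e s x y * chi3 s * mn (3 * x) y)"
      by (rule sum.mono_neutral_cong_right) (auto intro: finite_subset[OF _ finite_reps] split: if_splits)
    also have "\<dots> = (\<Sum>(A, t, C)\<in>{(A, t, C)\<in>box \<mu> K. A + 2 * t + C > 0 \<and> A - 2 * t + C < 0 \<and> 3 dvd A + 2 * t + C}.
          \<epsilon> A t C * chi3 (A - C) * mn (A + 2 * t + C) (- (A - 2 * t + C)))"
    proof (rule sum.reindex_bij_witness[of _ "\<lambda>(A, t, C). (A - C, (A + 2 * t + C) div 3, - (A - 2 * t + C))"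
      "\<lambda>(s, x, y). ((3 * x + s) div 2 - (3 * x + y) div 4, (3 * x + y) div 4, (3 * x - s) div 2 - (3 * x + y) div 4)"], goal_cases)
      case (1 F)
      obtain s x y where F: "F = (s, x, y)" by (cases F)
      from 1 have d: "4 dvd 3 * x + y" "even (x + s)" unfolding F by auto
      from d(1) obtain t where t: "3 * x + y = 4 * t" by blast
      have "even (3 * x + s)" using d(2) by presburger
      then obtain p where p: "3 * x + s = 2 * p" by blast
      have s: "3 * x - s = 2 * (3 * x - p)" using p by simp
      have y: "y = 4 * t - 3 * x" and s': "s = 2 * p - 3 * x" using t p by simp_all
      show ?case unfolding F by (simp add: t p s) (simp add: y s')
    next
      case (2 F)
      obtain s x y where F: "F = (s, x, y)" by (cases F)
      from 2 have r: "(s, x, y) \<in> reps (4 * \<mu>)" and d: "4 dvd 3 * x + y" "even (x + s)" unfolding F by auto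
      from d(1) obtain t where t: "3 * x + y = 4 * t" by blast
      have "even (3 * x + s)" using d(2) by presburger
      then obtain p where p: "3 * x + s = 2 * p" by blast
      have s: "3 * x - s = 2 * (3 * x - p)" using p by simp
      have y: "y = 4 * t - 3 * x" and s': "s = 2 * p - 3 * x" using t p by simp_all
      note * = repsD[OF r]
      have "t\<^sup>2 - (p - t) * (3 * x - p - t) = \<mu>"
        using *(3) unfolding y s' by (simp add: power2_eq_square algebra_simps)
      moreover have "\<bar>t\<bar> \<le> K" "\<bar>p - t\<bar> \<le> K" "\<bar>3 * x - p - t\<bar> \<le> K"
        using * K y s' by linarith+
      ultimately have "(p - t, t, 3 * x - p - t) \<in> box \<mu> K" by (simp add: box_def)
      moreover have "(p - t) + 2 * t + (3 * x - p - t) = 3 * x" "(p - t) - 2 * t + (3 * x - p - t) = - y" using y by simp_all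
      ultimately show ?case using *(1,2) unfolding F by (simp add: t p s)
    next
      case (3 F)
      then show ?case by (auto elim!: dvdE)
    next
      case (4 F)
      obtain A t C where F: "F = (A, t, C)" by (cases F)
      from 4 obtain x where x: "A + 2 * t + C = 3 * x" unfolding F by auto
      have A: "A = 3 * x - 2 * t - C" using x by simp
      have eq: "t\<^sup>2 - A * C = \<mu>" and pos: "A + 2 * t + C > 0" "A - 2 * t + C < 0" using 4 unfolding F by (auto simp: box_def)
      define y where "y = - (A - 2 * t + C)"
      have "(A - C)\<^sup>2 + 3 * x * y = 4 * \<mu>"
        unfolding eq[symmetric] y_def A by (simp add: power2_eq_square algebra_simps)
      moreover have "3 * x + y = 4 * t" unfolding y_def A by simp
      then have "4 dvd 3 * x + y" by simp
      moreover have "x + (A - C) = 2 * (2 * x - t - C)" unfolding A by simp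
      then have "even (x + (A - C))" by (metis dvd_triv_left)
      moreover have "x > 0" "y > 0" using pos x by (simp_all add: y_def)
      ultimately show ?case unfolding F prod.case x y_def[symmetric] by (simp add: reps_def)
    next
      case (5 F)
      obtain s x y where F: "F = (s, x, y)" by (cases F)
      from 5 have d: "4 dvd 3 * x + y" "even (x + s)" unfolding F by auto
      from d(1) obtain t where t: "3 * x + y = 4 * t" by blast
      have "even (3 * x + s)" using d(2) by presburger
      then obtain p where p: "3 * x + s = 2 * p" by blast
      have s: "3 * x - s = 2 * (3 * x - p)" using p by simp
      have y: "y = 4 * t - 3 * x" and s': "s = 2 * p - 3 * x" using t p by simp_all
      show ?case unfolding F by (simp add: t p s) (simp add: y s')
    qed
    finally show ?thesis by simp
  qed
  also have "?q = 2 * (\<Sum>(s, x, y)\<in>{(s, x, y)\<in>reps (4 * \<mu>). s mod 3 = 1}. if 4 dvd 3 * x + y \<and> even (x + s)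
      then ?e s x y * chi3 s * mn (3 * x) y else 0)"
  proof (rule sum_reps_half, goal_cases)
    \<comment> \<open>Changing the sign of \<open>s\<close> exchanges \<open>A\<close> and
      \<open>C\<close>; the sign from \<open>eps_swap\<close> cancels the one from
      \<open>chi3\<close>.\<close>
    case (1 s x y)
    have *: "3 * x + - s = 3 * x - s" "3 * x - - s = 3 * x + s" by simp_all
    have **: "even (x + - s) = even (x + s)" by simp
    show ?case
      unfolding * ** chi3_minus
        eps_swap[of "(3 * x - s) div 2 - (3 * x + y) div 4" "(3 * x + y) div 4" "(3 * x + s) div 2 - (3 * x + y) div 4"]
      by simp
  qed (auto simp: chi3_def)
  also have "(\<Sum>(s, x, y)\<in>{(s, x, y)\<in>reps (4 * \<mu>). s mod 3 = 1}. if 4 dvd 3 * x + y \<and> even (x + s)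
      then ?e s x y * chi3 s * mn (3 * x) y else 0) = ?r"
    by (rule sum.mono_neutral_cong_right) (auto simp: chi3_def intro: finite_subset[OF _ finite_reps] split: if_splits)
  finally show ?thesis by simp
qed

lemma crossing_reps:
  assumes mu: "\<mu> mod 3 = 1" and K: "10 * \<mu> \<le> K"
  shows "8 * (\<Sum>(t, n, m)\<in>{(t, n, m)\<in>reps \<mu>. t mod 3 = 1}. \<epsilon> (3 * n) t (- m) * t * cr (3 * n) (3 * n - m))
    = - 2 * (\<Sum>(s, n, d)\<in>reps \<mu>. \<epsilon> (3 * n) (s - 3 * n) (3 * n - d - 2 * s) * chi3 s * d)
      - (\<Sum>(A, t, C)\<in>box \<mu> K.
            if A = 0 then \<epsilon> A t C * root_char A t * (A + 2 * t + C) * cr (A + 2 * t + C) (A + C) else 0)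
      - 2 * (\<Sum>(s, x, y)\<in>{(s, x, y)\<in>reps (4 * \<mu>). s mod 3 = 1 \<and> 4 dvd 3 * x + y \<and> even (x + s)}.
        \<epsilon> ((3 * x + s) div 2 - (3 * x + y) div 4) ((3 * x + y) div 4) ((3 * x - s) div 2 - (3 * x + y) div 4)
          * mn (3 * x) y)"
  using crossing_identity[OF mu, of K] crossing_sum_reps[OF K] cusp_sum_reps[OF K] midpoint_sum_reps[OF K]
  by linarith

text \<open>The hypothesis is invariance under the reflection in the vertical geodesic from the cusp
  infinity to the cusp 1. In the coordinates of \<open>cusp_sum_reps\<close> it is
  \<open>s -> - s\<close> with \<open>n\<close> and \<open>d\<close> fixed, and
  \<open>chi3 s\<close> is odd.\<close>

lemma cusp_sum_eq_0:
  assumes "\<And>A t C. \<epsilon> A (- t - 2 * A) (C + 4 * t + 4 * A) = \<epsilon> A t C"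
  shows "(\<Sum>(s, n, d)\<in>reps \<mu>. \<epsilon> (3 * n) (s - 3 * n) (3 * n - d - 2 * s) * chi3 s * d) = 0"
    (is "?l = 0")
proof -
  have *: "\<epsilon> (3 * n) (- s - 3 * n) (3 * n - d - 2 * - s) = \<epsilon> (3 * n) (s - 3 * n) (3 * n - d - 2 * s)" for s n d
    using assms[of "3 * n" "s - 3 * n" "3 * n - d - 2 * s"] by (simp add: algebra_simps)
  have "?l = (\<Sum>(s, n, d)\<in>reps \<mu>. \<epsilon> (3 * n) (- s - 3 * n) (3 * n - d - 2 * - s) * chi3 (- s) * d)"
    by (rule sum.reindex_bij_witness[of _ "\<lambda>(A, t, C). (- A, t, C)" "\<lambda>(A, t, C). (- A, t, C)"])
       (auto simp: reps_def)
  also have "\<dots> = - ?l"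
    unfolding * chi3_minus by (simp add: sum_negf split_beta)
  finally show ?thesis by simp
qed

end

section \<open>Three choices of the sign character\<close>

lemma mn_swap: "mn x y = - mn y x"
  by (simp add: mn_def)

lemma mn_scale: "k > 0 \<Longrightarrow> mn (k * x) (k * y) = of_int k * mn x y"
  by (simp add: mn_def)

lemma mod_6_eq_1_iff: "(s :: int) mod 6 = 1 \<longleftrightarrow> s mod 3 = 1 \<and> odd s"
  by presburger

lemma int_div_eqI: "x = k * y \<Longrightarrow> k > 0 \<Longrightarrow> x div k = (y :: int)"
  by simp

lemma odd_square_mod_8: "odd x \<Longrightarrow> x * x mod 8 = (1 :: int)"
proof -
  assume "odd x"
  then obtain k where k: "x = 2 * k + 1" by (elim oddE)
  have "even (k * (k + 1))" by simp
  then obtain j where "k * (k + 1) = 2 * j" by blast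
  then have "x * x = 8 * j + 1" unfolding k by (simp add: algebra_simps)
  then show ?thesis by simp
qed

lemma odd_square_mod_4: "odd x \<Longrightarrow> x\<^sup>2 mod 4 = (1 :: int)"
  using odd_square_mod_8[of x] unfolding power2_eq_square by presburger

lemma product_mod_4:
  fixes a b :: int
  shows "a * b mod 4 = 1 \<Longrightarrow> (a mod 4 = 1 \<and> b mod 4 = 1) \<or> (a mod 4 = 3 \<and> b mod 4 = 3)"
    and "a * b mod 4 = 3 \<Longrightarrow> (a mod 4 = 1 \<and> b mod 4 = 3) \<or> (a mod 4 = 3 \<and> b mod 4 = 1)"
proof -
  have "a mod 4 \<in> {0, 1, 2, 3}" "b mod 4 \<in> {0, 1, 2, 3}" by auto
  moreover have "a * b mod 4 = (a mod 4) * (b mod 4) mod 4" by (simp add: mod_mult_eq)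
  ultimately show "a * b mod 4 = 1 \<Longrightarrow> (a mod 4 = 1 \<and> b mod 4 = 1) \<or> (a mod 4 = 3 \<and> b mod 4 = 3)"
    "a * b mod 4 = 3 \<Longrightarrow> (a mod 4 = 1 \<and> b mod 4 = 3) \<or> (a mod 4 = 3 \<and> b mod 4 = 1)"
    by auto
qed

lemma cofactor_mod_4:
  fixes x y z :: int
  shows "x + 3 * y = 4 * z \<Longrightarrow> x mod 4 = 1 \<Longrightarrow> y mod 4 = 1"
    and "x + 3 * y = z \<Longrightarrow> x mod 4 = 1 \<Longrightarrow> z mod 4 = 2 \<Longrightarrow> y mod 4 = 3"
  by presburger+

text \<open>Applied to \<open>x = a * b\<close> and the odd square \<open>y = a * a\<close>, where
  \<open>b = 3 * a - 4 * j\<close>: the parity of \<open>j\<close> becomes a condition on the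
  product \<open>a * b\<close> alone.\<close>

lemma mod_8_eq_3_iff:
  fixes x y z j :: int
  assumes "x = 3 * y - 8 * z - 4 * j" "y mod 8 = 1"
  shows "x mod 8 = 3 \<longleftrightarrow> even j"
proof -
  have y: "8 * (y div 8) + 1 = y" using mult_div_mod_eq[of 8 y] assms(2) by simp
  have red: "(8 * u + v) mod 8 = v mod 8" for u v :: int by simp
  show ?thesis
  proof (cases "even j")
    case True
    then obtain l where "j = 2 * l" by blast
    then have "x = 8 * (3 * (y div 8) - z - l) + 3" using assms(1) y by simp
    then have "x mod 8 = 3 mod 8" by (simp only: red)
    then show ?thesis using True by simp
  next
    case False
    then obtain l where "j = 2 * l + 1" by (elim oddE)
    then have "x = 8 * (3 * (y div 8) - z - l - 1) + 7" using assms(1) y by simp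
    then have "x mod 8 = 7 mod 8" by (simp only: red)
    then show ?thesis using False by simp
  qed
qed

lemma chi4_shift: "odd x \<Longrightarrow> chi4 (2 * k + x) = (if even k then chi4 x else - chi4 x)"
proof -
  assume "odd x"
  then have "even k \<Longrightarrow> (2 * k + x) mod 4 = x mod 4" "odd k \<Longrightarrow> (2 * k + x) mod 4 = (- x) mod 4"
    by presburger+
  then show ?thesis using chi4_cong chi4_minus by metis
qed

text \<open>Joint induction: raising \<open>u\<close> by 1 adds twice the first sum to the
  second.\<close>

lemma sum_chi4_triangle:
  "(\<Sum>j<2 * u. chi4 (int j)) = (if even u then 0 else 1)"
  "(\<Sum>j<2 * u. chi4 (int j) * (2 * real u - real j)) = real u"
proof (induction u)
  case (Suc u)
  have "(2 * int u) mod 4 \<noteq> 1" "(2 * int u) mod 4 \<noteq> 3" by presburger+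
  moreover have "even u \<Longrightarrow> (1 + 2 * int u) mod 4 = 1" "odd u \<Longrightarrow> (1 + 2 * int u) mod 4 = 3" by presburger+
  ultimately have chi: "chi4 (2 * int u) = 0" "chi4 (1 + 2 * int u) = (if even u then 1 else -1)"
    unfolding chi4_def by auto
  case 1
  then show ?case using Suc by (simp add: chi)
  case 2
  have "(\<Sum>j<2 * u. chi4 (int j) * (2 * real (Suc u) - real j))
    = (\<Sum>j<2 * u. chi4 (int j) * (2 * real u - real j)) + 2 * (\<Sum>j<2 * u. chi4 (int j))"
    by (simp add: sum_distrib_left algebra_simps flip: sum.distrib)
  then show ?case using Suc by (simp add: chi)
qed simp_all

text \<open>With \<open>A = 0\<close> a crossing confines \<open>C\<close> to the interval between
  \<open>- 2 * t\<close> and 0. The ends, counted one half, do not matter: the weight vanishes at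
  \<open>C = - 2 * t\<close>, the character at \<open>C = 0\<close>.\<close>

lemma boundary_inner:
  fixes t K :: int
  assumes "t \<noteq> 0" "2 * \<bar>t\<bar> \<le> K"
  shows "(\<Sum>C\<in>{-K..K}. chi4 (- C) * chi3 t * (2 * t + C) * cr (2 * t + C) C) = real_of_int \<bar>t\<bar> * chi3 \<bar>t\<bar>"
proof -
  have pos: "(\<Sum>C\<in>{-K..K}. chi4 (- C) * chi3 t * (2 * t + C) * cr (2 * t + C) C) = t * chi3 t"
    if t: "t > 0" "2 * t \<le> K" for t :: int
  proof -
    have "(\<Sum>C\<in>{-K..K}. chi4 (- C) * chi3 t * (2 * t + C) * cr (2 * t + C) C)
      = (\<Sum>C\<in>{-2 * t<..0}. chi4 (- C) * chi3 t * (2 * t + C))"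
      using t by (intro sum.mono_neutral_cong_right) (auto simp: cr_def sgn_if chi4_def)
    also have "\<dots> = (\<Sum>j<2 * nat t. chi4 (int j) * (2 * real (nat t) - real j) * chi3 t)"
      by (rule sum.reindex_bij_witness[of _ "\<lambda>j. - int j" "\<lambda>C. nat (- C)"]) (use t in \<open>auto simp: algebra_simps\<close>)
    also have "\<dots> = t * chi3 t"
      unfolding sum_distrib_right[symmetric] sum_chi4_triangle(2) using t by simp
    finally show ?thesis .
  qed
  show ?thesis
  proof (cases "t > 0")
    case False
    have cr_minus: "cr (- x) (- y) = - cr x y" for x y
      by (simp add: cr_def field_simps sgn_minus)
    have "(\<Sum>C\<in>{-K..K}. chi4 (- C) * chi3 t * (2 * t + C) * cr (2 * t + C) C)
      = (\<Sum>C\<in>{-K..K}. chi4 (- C) * chi3 (- t) * (2 * (- t) + C) * cr (2 * (- t) + C) C)"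
    proof (rule sum.reindex_bij_witness[of _ uminus uminus])
      fix C :: int
      have *: "2 * - t + - C = - (2 * t + C)" by simp
      show "chi4 (- (- C)) * chi3 (- t) * (2 * - t + - C) * cr (2 * - t + - C) (- C) =
         chi4 (- C) * chi3 t * (2 * t + C) * cr (2 * t + C) C"
        unfolding * of_int_minus cr_minus chi4_minus chi3_minus by (simp only: mult_minus_left mult_minus_right minus_minus)
    qed auto
    also have "\<dots> = (- t) * chi3 (- t)"
      using False assms by (subst pos) auto
    finally show ?thesis using False by simp
  qed (use pos assms in auto)
qed

section \<open>The character for the series f\<close>

interpretation fchar: form_char "\<lambda>A t C. chi4 (A - C)"
proof
  fix A C :: int
  show "chi4 (C - A) = - chi4 (A - C)" using chi4_minus[of "A - C"] by simp
  show "chi4 (- A - - C) = - chi4 (A - C)" using chi4_minus[of "A - C"] by simp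
qed simp

text \<open>Forms with \<open>A = 0\<close> exist only if \<mu> is a square. Their total is twice a
  coefficient of \<open>theta3\<close>, which is the contribution of the constant term 1 of the
  double series for \<open>f\<close>.\<close>

lemma square_boundary:
  assumes "\<mu> mod 3 = 1" "\<mu> > 0"
  shows "(\<Sum>(A, t, C)\<in>box \<mu> (10 * \<mu>). if A = 0 then chi4 (A - C) * root_char A t * (A + 2 * t + C)
            * cr (A + 2 * t + C) (A + C) else 0)
     = 2 * (\<Sum>t\<in>{t. t\<^sup>2 = \<mu> \<and> t mod 3 = 1}. real_of_int t)"
proof -
  let ?K = "10 * \<mu>"
  have sq: "\<bar>t\<bar> \<le> \<mu>" if "t\<^sup>2 = \<mu>" for t
  proof -
    have "\<bar>t\<bar> * 1 \<le> \<bar>t\<bar> * \<bar>t\<bar>" by (cases "t = 0", simp, rule mult_left_mono) linarith+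
    with that show ?thesis by (simp add: power2_eq_square flip: abs_mult)
  qed
  have fin: "finite {t. t\<^sup>2 = \<mu>}"
    by (rule finite_subset[of _ "{-\<mu>..\<mu>}"]) (use sq in force, simp)
  have "(\<Sum>(A, t, C)\<in>box \<mu> ?K. if A = 0 then chi4 (A - C) * root_char A t * (A + 2 * t + C)
            * cr (A + 2 * t + C) (A + C) else 0)
     = (\<Sum>(A, t, C)\<in>{0 :: int} \<times> {t. t\<^sup>2 = \<mu>} \<times> {-?K..?K}. chi4 (- C) * chi3 t * (2 * t + C) * cr (2 * t + C) C)"
  proof (rule sum.mono_neutral_cong_right, goal_cases)
    case 1
    show ?case by simp
  next
    case 2
    show ?case using sq assms by (force simp: box_def)
  next
    case (4 x)
    then show ?case by (auto simp: root_char_def)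
  qed (auto simp: box_def split: if_splits)
  also have "\<dots> = (\<Sum>t\<in>{t. t\<^sup>2 = \<mu>}. \<Sum>C\<in>{-?K..?K}. chi4 (- C) * chi3 t * (2 * t + C) * cr (2 * t + C) C)"
    by (simp add: sum.Sigma[symmetric] fin)
  also have "\<dots> = (\<Sum>t\<in>{t. t\<^sup>2 = \<mu>}. real_of_int \<bar>t\<bar> * chi3 \<bar>t\<bar>)"
  proof (rule sum.cong)
    fix t assume "t \<in> {t. t\<^sup>2 = \<mu>}"
    then have "t\<^sup>2 = \<mu>" by simp
    have "t \<noteq> 0" "2 * \<bar>t\<bar> \<le> ?K" using sq[OF \<open>t\<^sup>2 = \<mu>\<close>] assms(2) \<open>t\<^sup>2 = \<mu>\<close> by auto
    then show "(\<Sum>C\<in>{-?K..?K}. chi4 (- C) * chi3 t * (2 * t + C) * cr (2 * t + C) C) = real_of_int \<bar>t\<bar> * chi3 \<bar>t\<bar>"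
      by (rule boundary_inner)
  qed simp
  also have "\<dots> = (\<Sum>t\<in>{t. t\<^sup>2 = \<mu>}. if t mod 3 = 1 then real_of_int t else 0)
      + (\<Sum>t\<in>{t. t\<^sup>2 = \<mu>}. if (- t) mod 3 = 1 then real_of_int (- t) else 0)"
    unfolding sum.distrib[symmetric]
  proof (rule sum.cong)
    fix t :: int assume "t \<in> {t. t\<^sup>2 = \<mu>}"
    then have sq: "t * t = \<mu>" by (simp add: power2_eq_square)
    have "\<not> 3 dvd t"
    proof
      assume "3 dvd t"
      then have "3 dvd \<mu>" unfolding sq[symmetric] by (rule dvd_mult)
      then show False using assms(1) by simp
    qed
    then have "(t mod 3 = 1 \<and> (- t) mod 3 = 2) \<or> (t mod 3 = 2 \<and> (- t) mod 3 = 1)" by presburger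
    then show "real_of_int \<bar>t\<bar> * chi3 \<bar>t\<bar> = (if t mod 3 = 1 then real_of_int t else 0) + (if (- t) mod 3 = 1 then real_of_int (- t) else 0)"
      by (auto simp: chi3_def abs_if)
  qed simp
  also have "(\<Sum>t\<in>{t. t\<^sup>2 = \<mu>}. if (- t) mod 3 = 1 then real_of_int (- t) else 0)
     = (\<Sum>t\<in>{t. t\<^sup>2 = \<mu>}. if t mod 3 = 1 then real_of_int t else 0)"
    by (rule sum.reindex_bij_witness[of _ uminus uminus]) auto
  also have "(\<Sum>t\<in>{t. t\<^sup>2 = \<mu>}. if t mod 3 = 1 then real_of_int t else 0)
     = (\<Sum>t\<in>{t. t\<^sup>2 = \<mu> \<and> t mod 3 = 1}. real_of_int t)"
    using fin by (intro sum.mono_neutral_cong_right) auto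
  finally show ?thesis by simp
qed

text \<open>On the forms \<open>(3 * n, t, - m)\<close> the character is the sign in the double
  series for \<open>f\<close>. Between the cusps 1 and -1 it is \<open>chi4 s\<close>, the sign of
  the pentagonal series, free of \<open>a\<close> and \<open>b\<close>. It vanishes for even
  \<open>s\<close>, and for odd \<open>s\<close> the congruences of \<open>midpoint_sum_reps\<close>
  follow from \<open>s^2 + 3 * x * y = 4 * \<mu>\<close> modulo 4.\<close>

theorem f_reps_identity:
  assumes "\<mu> mod 3 = 1" "\<mu> > 0"
  shows "(\<Sum>t\<in>{t. t\<^sup>2 = \<mu> \<and> t mod 3 = 1}. real_of_int t)
     + 4 * (\<Sum>(t, n, m)\<in>{(t, n, m)\<in>reps \<mu>. t mod 3 = 1}. chi4 (3 * n + m) * real_of_int t * cr (3 * n) (3 * n - m))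
   = (\<Sum>(s, a, b)\<in>{(s, a, b)\<in>reps (4 * \<mu>). s mod 6 = 1}. chi4 s * mn b (3 * a))"
proof -
  let ?V = "\<Sum>(s, x, y)\<in>{(s, x, y)\<in>reps (4 * \<mu>). s mod 3 = 1 \<and> 4 dvd 3 * x + y \<and> even (x + s)}.
        chi4 ((3 * x + s) div 2 - (3 * x + y) div 4 - ((3 * x - s) div 2 - (3 * x + y) div 4)) * mn (3 * x) y"
  have "?V = (\<Sum>(s, a, b)\<in>{(s, a, b)\<in>reps (4 * \<mu>). s mod 6 = 1}. chi4 s * mn (3 * a) b)"
  proof (rule sum.mono_neutral_cong, goal_cases)
    case (3 F)
    obtain s x y where F: "F = (s, x, y)" by (cases F)
    from 3 have "(s, x, y) \<in> reps (4 * \<mu>) \<and> s mod 6 = 1 \<and> \<not> (s mod 3 = 1 \<and> 4 dvd 3 * x + y \<and> even (x + s))"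
      unfolding F by simp
    moreover from this have "s mod 3 = 1" by (simp add: mod_6_eq_1_iff)
    ultimately have *: "(s, x, y) \<in> reps (4 * \<mu>)" "s mod 6 = 1" "\<not> (4 dvd 3 * x + y \<and> even (x + s))"
      by simp_all
    have eq: "s\<^sup>2 + 3 * (x * y) = 4 * \<mu>" using repsD[OF *(1)] by (simp add: mult.assoc)
    have "odd s" using *(2) by presburger
    then have "s\<^sup>2 mod 4 = 1" by (rule odd_square_mod_4)
    then have "(x mod 4 = 1 \<and> y mod 4 = 1) \<or> (x mod 4 = 3 \<and> y mod 4 = 3)"
      by (intro product_mod_4 cofactor_mod_4(1)[OF eq])
    then have "4 dvd 3 * x + y" "odd x" by presburger+
    then have "4 dvd 3 * x + y \<and> even (x + s)" using \<open>odd s\<close> by simp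
    then show ?case using *(3) by simp
  next
    case (4 F)
    obtain s x y where F: "F = (s, x, y)" by (cases F)
    have *: "s mod 3 = 1" "s mod 6 \<noteq> 1" "even (x + s)" using 4 unfolding F by auto
    then have "even (3 * x + s)" by simp
    then obtain p where p: "3 * x + s = 2 * p" by blast
    then have "3 * x - s = 2 * (3 * x - p)" by simp
    then have "(3 * x + s) div 2 - (3 * x + y) div 4 - ((3 * x - s) div 2 - (3 * x + y) div 4) = s"
      using p by simp
    moreover have "even s" using *(1,2) by (simp add: mod_6_eq_1_iff)
    then have "s mod 4 \<noteq> 1" "s mod 4 \<noteq> 3" by presburger+
    then have "chi4 s = 0" by (simp add: chi4_def)
    ultimately show ?case unfolding F by simp
  next
    case (5 F)
    obtain s x y where F: "F = (s, x, y)" by (cases F)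
    have *: "even (x + s)" using 5 unfolding F by auto
    then have "even (3 * x + s)" by simp
    then obtain p where p: "3 * x + s = 2 * p" by blast
    then have "3 * x - s = 2 * (3 * x - p)" by simp
    then have "(3 * x + s) div 2 - (3 * x + y) div 4 - ((3 * x - s) div 2 - (3 * x + y) div 4) = s"
      using p by simp
    then show ?case unfolding F by simp
  qed (auto intro: finite_subset[OF _ finite_reps])
  also have "\<dots> = - (\<Sum>(s, a, b)\<in>{(s, a, b)\<in>reps (4 * \<mu>). s mod 6 = 1}. chi4 s * mn b (3 * a))"
    unfolding sum_negf[symmetric]
  proof (rule sum.cong, simp, clarify)
    fix s a b
    show "chi4 s * mn (3 * a) b = - (chi4 s * mn b (3 * a))" by (subst mn_swap) simp
  qed
  finally have V: "?V = - (\<Sum>(s, a, b)\<in>{(s, a, b)\<in>reps (4 * \<mu>). s mod 6 = 1}. chi4 s * mn b (3 * a))" .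
  \<comment> \<open>The reflection changes \<open>A - C\<close> by a multiple of 4, so the cusp sum
    vanishes.\<close>
  have "A - (C + 4 * t + 4 * A) - (A - C) = 4 * (- t - A)" for A t C :: int by simp
  then have "chi4 (A - (C + 4 * t + 4 * A)) = chi4 (A - C)" for A t C
    by (intro chi4_cong) (metis mod_eq_dvd_iff dvd_triv_left)
  note L = fchar.cusp_sum_eq_0[OF this, of \<mu>]
  have "10 * \<mu> \<le> 10 * \<mu>" by simp
  from fchar.crossing_reps[OF assms(1) this] show ?thesis
    unfolding V L square_boundary[OF assms] by simp
qed


section \<open>The character for \<omega> times the theta series over s mod 6 = 1\<close>

text \<open>Made for the forms \<open>(3 * n, t, - m)\<close> with \<open>n = 2 * r + 1\<close> and
  \<open>m = 3 * n + 4 * j\<close> that index the double series of \<omega>: there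
  \<open>4 dvd A + C\<close>, and \<open>- chi4 (3 * n) = chi4 n = (-1) ^ r\<close>.\<close>

definition omega_char :: "int \<Rightarrow> int \<Rightarrow> int \<Rightarrow> real" where
  "omega_char A t C = (if odd A \<and> odd t \<and> odd C \<and> 4 dvd A + C then - chi4 A else 0)"

interpretation omega_char: form_char omega_char
proof
  fix A t C :: int
  show "omega_char C t A = - omega_char A t C"
  proof (cases "4 dvd A + C")
    case True
    then have "C mod 4 = (- A) mod 4" by presburger
    then have "chi4 C = - chi4 A" using chi4_cong chi4_minus by metis
    then show ?thesis by (simp add: omega_char_def add.commute)
  qed (simp add: omega_char_def add.commute)
  have "4 dvd - A + - C \<longleftrightarrow> 4 dvd A + C" using dvd_minus_iff[of 4 "A + C"] by simp
  then show "omega_char (- A) (- t) (- C) = - omega_char A t C"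
    by (simp add: omega_char_def chi4_minus)
qed (simp add: omega_char_def)

lemma omega_char_shift: "omega_char A (- t - 2 * A) (C + 4 * t + 4 * A) = omega_char A t C"
proof -
  have "4 dvd A + (C + 4 * t + 4 * A) \<longleftrightarrow> 4 dvd A + C" by presburger
  then show ?thesis by (simp add: omega_char_def)
qed

text \<open>As \<open>4 dvd A + C\<close>, all of \<open>s\<close>, \<open>x\<close>,
  \<open>y\<close> are even in the midpoint sum, and halving them brings \<open>4 * \<mu>\<close>
  down to \<mu>. With \<open>3 * a - b = 4 * j\<close> the form then has
  \<open>A = 2 * j - s\<close>, so \<open>chi4 A\<close> is \<open>chi4 s\<close> up to a sign given
  by the parity of \<open>j\<close>, which is visible in \<open>a * b\<close> modulo 8.\<close>

theorem omega_reps_identity: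
  assumes "\<mu> mod 12 = 10"
  shows "2 * (\<Sum>(t, n, m)\<in>{(t, n, m)\<in>reps \<mu>. t mod 6 = 1 \<and> odd n \<and> 4 dvd 3 * n - m}.
             chi4 n * real_of_int t * cr (3 * n) (3 * n - m))
   = (\<Sum>(s, a, b)\<in>{(s, a, b)\<in>reps \<mu>. s mod 6 = 1}. chi4 s * (if a * b mod 8 = 3 then 1 else -1) * mn b (3 * a))"
proof -
  have mu: "\<mu> mod 3 = 1" using assms by presburger
  let ?B = "\<Sum>(t, n, m)\<in>{(t, n, m)\<in>reps \<mu>. t mod 3 = 1}. omega_char (3 * n) t (- m) * real_of_int t * cr (3 * n) (3 * n - m)"
  let ?e = "\<lambda>s x y. omega_char ((3 * x + s) div 2 - (3 * x + y) div 4) ((3 * x + y) div 4) ((3 * x - s) div 2 - (3 * x + y) div 4)"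
  let ?S = "{(s, x, y)\<in>reps (4 * \<mu>). s mod 3 = 1 \<and> 4 dvd 3 * x + y \<and> even (x + s)}"
  let ?V = "\<Sum>(s, x, y)\<in>?S. ?e s x y * mn (3 * x) y"
  let ?R = "\<Sum>(s, a, b)\<in>{(s, a, b)\<in>reps \<mu>. s mod 6 = 1}. chi4 s * (if a * b mod 8 = 3 then 1 else -1) * mn b (3 * a)"
  have B: "?B = (\<Sum>(t, n, m)\<in>{(t, n, m)\<in>reps \<mu>. t mod 6 = 1 \<and> odd n \<and> 4 dvd 3 * n - m}.
             chi4 n * real_of_int t * cr (3 * n) (3 * n - m))"
  proof (rule sum.mono_neutral_cong_right, goal_cases)
    case 1
    show ?case by (rule finite_subset[OF _ finite_reps]) auto
  next
    case 2
    show ?case by (auto simp: mod_6_eq_1_iff)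
  next
    case 3
    show ?case
    proof
      fix F assume F: "F \<in> {(t, n, m)\<in>reps \<mu>. t mod 3 = 1} - {(t, n, m)\<in>reps \<mu>. t mod 6 = 1 \<and> odd n \<and> 4 dvd 3 * n - m}"
      obtain t n m where [simp]: "F = (t, n, m)" by (cases F)
      have "t mod 3 = 1" "\<not> (t mod 6 = 1 \<and> odd n \<and> 4 dvd 3 * n - m)" using F by auto
      then have "\<not> (odd (3 * n) \<and> odd t \<and> odd (- m) \<and> 4 dvd 3 * n + - m)" by (auto simp: mod_6_eq_1_iff)
      then show "(case F of (t, n, m) \<Rightarrow> omega_char (3 * n) t (- m) * real_of_int t * cr (3 * n) (3 * n - m)) = 0"
        by (auto simp: omega_char_def)
    qed
  next
    case (4 F)
    obtain t n m where [simp]: "F = (t, n, m)" by (cases F)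
    have *: "t mod 6 = 1" "odd n" "4 dvd 3 * n - m" using 4 by auto
    then have "odd t" "odd m" by presburger+
    moreover have "chi4 (3 * n) = chi4 (- n)" by (rule chi4_cong) presburger
    ultimately show ?case using * by (simp add: omega_char_def chi4_minus)
  qed
  have "- 2 * ?R = ?V"
  proof -
    have "- 2 * ?R = (\<Sum>(s, a, b)\<in>{(s, a, b)\<in>reps \<mu>. s mod 6 = 1}. - 2 * (chi4 s * (if a * b mod 8 = 3 then 1 else -1) * mn b (3 * a)))"
      by (simp add: sum_distrib_left split_beta)
    also have "\<dots> = (\<Sum>(s, x, y)\<in>{(s, x, y)\<in>?S. ?e s x y \<noteq> 0}. ?e s x y * mn (3 * x) y)"
    \<comment> \<open>The factor is -2 and not 2 because multiplication by -2 preserves residues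
      modulo 3.\<close>
    proof (rule sum.reindex_bij_witness[of _ "\<lambda>(s, x, y). (- (s div 2), x div 2, y div 2)" "\<lambda>(s, a, b). (- 2 * s, 2 * a, 2 * b)"], goal_cases)
      case (2 F)
      obtain s a b where F [simp]: "F = (s, a, b)" by (cases F)
      have r: "(s, a, b) \<in> reps \<mu>" and s: "s mod 6 = 1" using 2 by auto
      have eq: "s\<^sup>2 + 3 * (a * b) = \<mu>" using repsD[OF r] by (simp add: mult.assoc)
      have "odd s" using s by presburger
      then have "s\<^sup>2 mod 4 = 1" by (rule odd_square_mod_4)
      moreover have "\<mu> mod 4 = 2" using assms by presburger
      ultimately have ab: "(a mod 4 = 1 \<and> b mod 4 = 3) \<or> (a mod 4 = 3 \<and> b mod 4 = 1)"
        by (intro product_mod_4 cofactor_mod_4(2)[OF eq])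
      then have "4 dvd 3 * a - b" by presburger
      then obtain j where j: "3 * a - b = 4 * j" by blast
      have b: "b = 3 * a - 4 * j" using j by simp
      have d1: "(3 * (2 * a) + - 2 * s) div 2 = 3 * a - s" "(3 * (2 * a) - - 2 * s) div 2 = 3 * a + s"
        "(3 * (2 * a) + 2 * b) div 4 = 3 * a - 2 * j"
        unfolding b by (rule int_div_eqI; simp)+
      have "odd a" using ab by presburger
      moreover have "odd s" using s by (simp add: mod_6_eq_1_iff)
      ultimately have odd: "odd a" "odd s" .
      have "?e (- 2 * s) (2 * a) (2 * b) = - chi4 (2 * j - s)"
        unfolding d1 using odd by (simp add: omega_char_def)
      moreover have "chi4 x \<noteq> 0" if "odd x" for x
      proof -
        have "x mod 4 = 1 \<or> x mod 4 = 3" using that by presburger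
        then show ?thesis by (auto simp: chi4_def)
      qed
      then have "chi4 (2 * j - s) \<noteq> 0" using odd by simp
      ultimately have "?e (- 2 * s) (2 * a) (2 * b) \<noteq> 0" by simp
      moreover have "3 * (2 * a) + 2 * b = 4 * (3 * a - 2 * j)" unfolding b by simp
      then have "4 dvd 3 * (2 * a) + 2 * b" by (metis dvd_triv_left)
      moreover have "(- 2 * s) mod 3 = 1" using s by presburger
      moreover have "even (2 * a + - 2 * s)" by simp
      moreover have "(- 2 * s, 2 * a, 2 * b) \<in> reps (4 * \<mu>)" using r by (auto simp: reps_def power2_eq_square algebra_simps)
      ultimately show ?case unfolding F prod.case mem_Collect_eq by blast
    next
      case (3 F)
      obtain s x y where F [simp]: "F = (s, x, y)" by (cases F)
      have *: "4 dvd 3 * x + y" "even (x + s)" "?e s x y \<noteq> 0" using 3 by auto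
      from *(1) obtain t where t: "3 * x + y = 4 * t" by blast
      have "even (3 * x + s)" using *(2) by simp
      then obtain p where p: "3 * x + s = 2 * p" by blast
      have s: "3 * x - s = 2 * (3 * x - p)" using p by simp
      have o: "odd (p - t)" "odd t" "odd (3 * x - p - t)" "4 dvd (p - t) + (3 * x - p - t)"
        using *(3) by (auto simp: omega_char_def t p s split: if_splits)
      from o(4) obtain k where "(p - t) + (3 * x - p - t) = 4 * k" by blast
      then have "3 * x = 2 * (2 * k + t)" by simp
      then have "even x" by presburger
      moreover have "y = 4 * t - 3 * x" "s = 2 * p - 3 * x" using t p by simp_all
      ultimately have "even x" "even y" "even s" by simp_all
      then show ?case by simp
    next
      case (4 F)
      obtain s x y where F [simp]: "F = (s, x, y)" by (cases F)
      have *: "4 dvd 3 * x + y" "even (x + s)" "?e s x y \<noteq> 0" "(s, x, y) \<in> reps (4 * \<mu>)" "s mod 3 = 1" using 4 by auto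
      from *(1) obtain t where t: "3 * x + y = 4 * t" by blast
      have "even (3 * x + s)" using *(2) by simp
      then obtain p where p: "3 * x + s = 2 * p" by blast
      have s: "3 * x - s = 2 * (3 * x - p)" using p by simp
      have o: "odd (p - t)" "odd t" "odd (3 * x - p - t)" "4 dvd (p - t) + (3 * x - p - t)"
        using *(3) by (auto simp: omega_char_def t p s split: if_splits)
      from o(4) obtain k where "(p - t) + (3 * x - p - t) = 4 * k" by blast
      then have "3 * x = 2 * (2 * k + t)" by simp
      then have "even x" by presburger
      moreover have "y = 4 * t - 3 * x" "s = 2 * p - 3 * x" using t p by simp_all
      ultimately have "even x" "even y" "even s" by simp_all
      then obtain s' a b where [simp]: "x = 2 * a" "y = 2 * b" "s = 2 * s'" by (elim evenE)
      have "(2 * s') mod 3 = 1" using *(5) by simp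
      then have "(- s') mod 3 = 1" by presburger
      moreover have "3 * a = 2 * k + t" using \<open>3 * x = 2 * (2 * k + t)\<close> by simp
      then have "odd (3 * a)" using o(2) by simp
      moreover have "s' = p - 3 * a" using p by simp
      ultimately have "(- s') mod 6 = 1" using o(1,2) by (simp add: mod_6_eq_1_iff)
      moreover have "(- s', a, b) \<in> reps \<mu>" using *(4) by (auto simp: reps_def power2_eq_square)
      ultimately show ?case by simp
    next
      case (5 F)
      obtain s a b where F [simp]: "F = (s, a, b)" by (cases F)
      have r: "(s, a, b) \<in> reps \<mu>" and s: "s mod 6 = 1" using 5 by auto
      have eq: "s\<^sup>2 + 3 * (a * b) = \<mu>" using repsD[OF r] by (simp add: mult.assoc)
      have "odd s" using s by presburger
      then have "s\<^sup>2 mod 4 = 1" by (rule odd_square_mod_4)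
      moreover have "\<mu> mod 4 = 2" using assms by presburger
      ultimately have ab: "(a mod 4 = 1 \<and> b mod 4 = 3) \<or> (a mod 4 = 3 \<and> b mod 4 = 1)"
        by (intro product_mod_4 cofactor_mod_4(2)[OF eq])
      then have "4 dvd 3 * a - b" by presburger
      then obtain j where j: "3 * a - b = 4 * j" by blast
      have b: "b = 3 * a - 4 * j" using j by simp
      have d1: "(3 * (2 * a) + - 2 * s) div 2 = 3 * a - s" "(3 * (2 * a) - - 2 * s) div 2 = 3 * a + s"
        "(3 * (2 * a) + 2 * b) div 4 = 3 * a - 2 * j"
        unfolding b by (rule int_div_eqI; simp)+
      have "odd a" using ab by presburger
      moreover have "odd s" using s by (simp add: mod_6_eq_1_iff)
      ultimately have odd: "odd a" "odd s" .
      have e: "?e (- 2 * s) (2 * a) (2 * b) = - chi4 (2 * j - s)"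
        unfolding d1 using odd by (simp add: omega_char_def)
      have aa: "(a * a) mod 8 = 1" using odd(1) by (rule odd_square_mod_8)
      obtain i where i: "a = 2 * i + 1" using odd by (elim oddE)
      have "a * b = 3 * (a * a) - 8 * (i * j) - 4 * j" unfolding b i by (simp add: algebra_simps)
      note j8 = mod_8_eq_3_iff[OF this aa]
      have "odd (- s)" using odd(2) by simp
      from chi4_shift[OF this, of j]
      have c: "chi4 (2 * j - s) = (if even j then - chi4 s else chi4 s)" by (simp add: chi4_minus)
      have m: "mn (3 * (2 * a)) (2 * b) = 2 * mn (3 * a) b" using mn_scale[of 2 "3 * a" b] by simp
      have alg: "- (if P then - u else u) * (2 * v) = - 2 * (u * (if P then 1 else - 1) * - v)" for P and u v :: real
        by (cases P) simp_all
      have "mn b (3 * a) = - mn (3 * a) b" by (rule mn_swap)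
      then have "?e (- 2 * s) (2 * a) (2 * b) * mn (3 * (2 * a)) (2 * b)
        = - 2 * (chi4 s * (if a * b mod 8 = 3 then 1 else - 1) * mn b (3 * a))"
        using e c m j8 alg[of "even j" "chi4 s" "mn (3 * a) b"] by (simp only:)
      then show ?case by (simp only: F prod.case)
    qed auto
    also have "\<dots> = ?V"
      by (rule sum.mono_neutral_left) (auto intro: finite_subset[OF _ finite_reps])
    finally show ?thesis .
  qed
  then have V: "?V = - 2 * ?R" by (rule sym)
  have 1: "(\<Sum>(A, t, C)\<in>box \<mu> (10 * \<mu>). if A = 0 then omega_char A t C * root_char A t * (A + 2 * t + C)
            * cr (A + 2 * t + C) (A + C) else 0) = 0"
    by (rule sum.neutral) (auto simp: omega_char_def)
  have gen: "2 * x = y" if "8 * x = - 2 * 0 - 0 - 2 * (- 2 * y)" for x y :: real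
    using that by simp
  show ?thesis
    using omega_char.crossing_reps[OF mu order.refl]
    unfolding omega_char.cusp_sum_eq_0[OF omega_char_shift] 1 V B by (rule gen)
qed


section \<open>The characters for \<omega> times the theta series over t mod 3 = 1\<close>

text \<open>On \<open>(3 * n, t, - m)\<close> with \<open>m = 3 * n + 4 * j\<close> the parity of
  \<open>(A + C) div 4\<close> is that of \<open>j\<close>, hence of the exponent in the double
  series for \<omega>. So \<delta> = -1 corresponds to the substitution of \<open>- q\<close> for
  \<open>q\<close>, and both values together separate the two residue classes of
  \<open>c_h\<close>.\<close>

definition parity_char :: "real \<Rightarrow> int \<Rightarrow> int \<Rightarrow> int \<Rightarrow> real" where
  "parity_char \<delta> A t C = (if odd A \<and> even t \<and> odd C \<and> 4 dvd A + C
     then chi4 A * (if even ((A + C) div 4) then 1 else \<delta>) else 0)"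

interpretation parity_char: form_char "parity_char \<delta>" for \<delta>
proof
  fix A t C :: int
  show "parity_char \<delta> C t A = - parity_char \<delta> A t C"
  proof (cases "4 dvd A + C")
    case True
    then have "C mod 4 = (- A) mod 4" by presburger
    then have "chi4 C = - chi4 A" using chi4_cong chi4_minus by metis
    then show ?thesis by (simp add: parity_char_def add.commute)
  qed (simp add: parity_char_def add.commute)
  have *: "- A + - C = - (A + C)" by simp
  show "parity_char \<delta> (- A) (- t) (- C) = - parity_char \<delta> A t C"
  proof (cases "4 dvd A + C")
    case True
    then obtain k where k: "A + C = 4 * k" by blast
    have "- (4 * k) div 4 = - k" by (rule int_div_eqI) simp_all
    then show ?thesis unfolding parity_char_def * k by (simp add: chi4_minus)
  next
    case False
    then show ?thesis unfolding parity_char_def * dvd_minus_iff by simp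
  qed
qed (simp add: parity_char_def)

text \<open>Restricted to \<delta> = 1: the reflection changes \<open>(A + C) / 4\<close> by
  \<open>t + A\<close>, which is odd on the support, so for \<delta> = -1 the character changes sign
  and the cusp sum does not cancel.\<close>

lemma parity_char_shift: "parity_char 1 A (- t - 2 * A) (C + 4 * t + 4 * A) = parity_char 1 A t C"
proof -
  have "4 dvd A + (C + 4 * t + 4 * A) \<longleftrightarrow> 4 dvd A + C" by presburger
  then show ?thesis by (simp add: parity_char_def)
qed

definition reps12 :: "int \<Rightarrow> (int \<times> int \<times> int) set" where
  "reps12 \<mu> = {(s, a, b). a > 0 \<and> b > 0 \<and> s mod 6 = 1 \<and> s\<^sup>2 + 12 * a * b = \<mu>}"

definition reps4 :: "int \<Rightarrow> (int \<times> int \<times> int) set" where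
  "reps4 \<mu> = {(t, n, m). n > 0 \<and> m > 0 \<and> t mod 3 = 1 \<and> odd n \<and> 4 dvd 3 * n - m \<and> 4 * t\<^sup>2 + 3 * n * m = \<mu>}"

lemma finite_reps12 [simp]: "finite (reps12 \<mu>)"
proof (rule finite_surj[OF finite_reps[of \<mu>]])
  show "reps12 \<mu> \<subseteq> (\<lambda>(s, a, b). (s, a, b div 4)) ` reps \<mu>"
  proof
    fix F assume "F \<in> reps12 \<mu>"
    moreover obtain s a b where F: "F = (s, a, b)" by (cases F)
    ultimately have "(s, a, 4 * b) \<in> reps \<mu>" by (auto simp: reps12_def reps_def)
    then show "F \<in> (\<lambda>(s, a, b). (s, a, b div 4)) ` reps \<mu>" unfolding F by force
  qed
qed

text \<open>The even variable \<open>t\<close> is written as -2 times a new one, which keeps its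
  residue modulo 3; the minus sign is absorbed by \<open>chi4 (3 * n) = - chi4 n\<close>.\<close>

lemma crossing_sum_parity:
  "(\<Sum>(t, n, m)\<in>{(t, n, m)\<in>reps \<mu>. t mod 3 = 1}. parity_char \<delta> (3 * n) t (- m) * real_of_int t * cr (3 * n) (3 * n - m))
   = 2 * (\<Sum>(t, n, m)\<in>reps4 \<mu>. chi4 n * (if even ((3 * n - m) div 4) then 1 else \<delta>) * real_of_int t * cr (3 * n) (3 * n - m))"
proof -
  let ?c = "\<lambda>t n m. even t \<and> odd n \<and> 4 dvd 3 * n - m"
  have "(\<Sum>(t, n, m)\<in>{(t, n, m)\<in>reps \<mu>. t mod 3 = 1}. parity_char \<delta> (3 * n) t (- m) * real_of_int t * cr (3 * n) (3 * n - m))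
    = (\<Sum>(t, n, m)\<in>{(t, n, m)\<in>reps \<mu>. t mod 3 = 1 \<and> ?c t n m}. parity_char \<delta> (3 * n) t (- m) * real_of_int t * cr (3 * n) (3 * n - m))"
    by (rule sum.mono_neutral_right) (auto simp: parity_char_def intro: finite_subset[OF _ finite_reps] split: if_splits)
  also have "\<dots> = (\<Sum>(t, n, m)\<in>reps4 \<mu>. 2 * (chi4 n * (if even ((3 * n - m) div 4) then 1 else \<delta>) * real_of_int t * cr (3 * n) (3 * n - m)))"
  proof (rule sum.reindex_bij_witness[of _ "\<lambda>(t, n, m). (- 2 * t, n, m)" "\<lambda>(t, n, m). (- (t div 2), n, m)"], goal_cases)
    case (2 F)
    obtain t n m where F: "F = (t, n, m)" by (cases F)
    have *: "(t, n, m) \<in> reps \<mu>" "t mod 3 = 1" "even t" "odd n" "4 dvd 3 * n - m" using 2 unfolding F by auto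
    from *(3) obtain u where t: "t = 2 * u" by blast
    have "(- u) mod 3 = 1" using *(2) t by presburger
    then show ?case using * unfolding F t by (auto simp: reps4_def reps_def power2_eq_square)
  next
    case (4 F)
    obtain t n m where F: "F = (t, n, m)" by (cases F)
    have *: "(t, n, m) \<in> reps4 \<mu>" using 4 unfolding F by auto
    then have "(- 2 * t) mod 3 = 1" unfolding reps4_def by (simp, presburger)
    then show ?case using * unfolding F by (auto simp: reps4_def reps_def power2_eq_square)
  next
    case (5 F)
    obtain t n m where F: "F = (t, n, m)" by (cases F)
    have *: "even t" "odd n" "4 dvd 3 * n - m" using 5 unfolding F by auto
    from *(3) obtain k where "3 * n - m = 4 * k" by blast
    then have "m = 3 * n - 4 * k" by simp
    then have m: "odd m" using *(2) by simp
    have c: "chi4 (3 * n) = - chi4 n" using chi4_shift[of "n" n] *(2) by simp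
    from *(1) obtain u where t: "t = 2 * u" by blast
    show ?case using * m unfolding F t by (simp add: parity_char_def c)
  qed auto
  finally show ?thesis by (simp add: sum_distrib_left split_beta)
qed

text \<open>With \<open>A + C = 4 * k\<close> and even \<open>t\<close>, the numbers
  \<open>3 * x = A + C + 2 * t\<close> and \<open>y = 2 * t - (A + C)\<close> are divisible by 4 and
  \<open>s\<close> is even. Substituting \<open>(- 2 * s, 4 * b, 4 * a)\<close> for
  \<open>(s, x, y)\<close> yields \<open>s^2 + 12 * a * b = \<mu>\<close>. Then
  \<open>3 * b - a = 2 * k\<close> and \<open>A = 2 * k - s\<close>, so the character is a product
  of \<open>chi4 s\<close> and a function of the parity of \<open>k\<close>.\<close>

lemma midpoint_sum_parity:
  "(\<Sum>(s, x, y)\<in>{(s, x, y)\<in>reps (4 * \<mu>). s mod 3 = 1 \<and> 4 dvd 3 * x + y \<and> even (x + s)}.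
      parity_char \<delta> ((3 * x + s) div 2 - (3 * x + y) div 4) ((3 * x + y) div 4) ((3 * x - s) div 2 - (3 * x + y) div 4)
          * mn (3 * x) y)
   = - 4 * (\<Sum>(s, a, b)\<in>{(s, a, b)\<in>reps12 \<mu>. even (a + b)}. chi4 s * (if 4 dvd 3 * b - a then 1 else - \<delta>) * mn (3 * b) a)"
proof -
  let ?e = "\<lambda>s x y. parity_char \<delta> ((3 * x + s) div 2 - (3 * x + y) div 4) ((3 * x + y) div 4) ((3 * x - s) div 2 - (3 * x + y) div 4)"
  let ?S = "{(s, x, y)\<in>reps (4 * \<mu>). s mod 3 = 1 \<and> 4 dvd 3 * x + y \<and> even (x + s)}"
  let ?c = "\<lambda>s x y. odd ((3 * x + s) div 2 - (3 * x + y) div 4) \<and> even ((3 * x + y) div 4)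
     \<and> 4 dvd ((3 * x + s) div 2 - (3 * x + y) div 4) + ((3 * x - s) div 2 - (3 * x + y) div 4)"
  have "(\<Sum>(s, x, y)\<in>?S. ?e s x y * mn (3 * x) y) = (\<Sum>(s, x, y)\<in>{(s, x, y)\<in>?S. ?c s x y}. ?e s x y * mn (3 * x) y)"
  proof (rule sum.mono_neutral_right, goal_cases)
    case 1
    show ?case by (rule finite_subset[OF _ finite_reps]) auto
  next
    case 2
    show ?case by blast
  next
    case 3
    show ?case
    proof
      fix F assume "F \<in> ?S - {(s, x, y)\<in>?S. ?c s x y}"
      moreover obtain s x y where F: "F = (s, x, y)" by (cases F)
      ultimately have "\<not> ?c s x y" unfolding F by blast
      then have "?e s x y = 0" unfolding parity_char_def by (intro if_not_P) blast
      then show "(case F of (s, x, y) \<Rightarrow> ?e s x y * mn (3 * x) y) = 0" unfolding F by simp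
    qed
  qed
  also have "\<dots> = (\<Sum>(s, a, b)\<in>{(s, a, b)\<in>reps12 \<mu>. even (a + b)}.
      - 4 * (chi4 s * (if 4 dvd 3 * b - a then 1 else - \<delta>) * mn (3 * b) a))"
  proof (rule sum.reindex_bij_witness[of _ "\<lambda>(s, a, b). (- 2 * s, 4 * b, 4 * a)" "\<lambda>(s, x, y). (- (s div 2), y div 4, x div 4)"], goal_cases)
    case (1 F)
    obtain s x y where F: "F = (s, x, y)" by (cases F)
    have *: "4 dvd 3 * x + y" "even (x + s)" "?c s x y" using 1 unfolding F by auto
    from *(1) obtain t where t: "3 * x + y = 4 * t" by blast
    have "even (3 * x + s)" using *(2) by simp
    then obtain p where p: "3 * x + s = 2 * p" by blast
    have s: "3 * x - s = 2 * (3 * x - p)" using p by simp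
    have o: "odd (p - t)" "even t" "4 dvd (p - t) + (3 * x - p - t)" using *(3) by (auto simp: t p s)
    from o(2) obtain t' where t': "t = 2 * t'" by blast
    from o(3) obtain k where "(p - t) + (3 * x - p - t) = 4 * k" by blast
    then have "3 * x = 4 * (k + t')" using t' by simp
    then have "4 dvd x" by presburger
    moreover have "y = 4 * t - 3 * x" "s = 2 * p - 3 * x" using t p by simp_all
    ultimately have "4 dvd x" "4 dvd y" "even s" by (auto elim!: dvdE)
    then show ?case unfolding F by (auto elim!: dvdE)
  next
    case (2 F)
    obtain s x y where F: "F = (s, x, y)" by (cases F)
    have *: "4 dvd 3 * x + y" "even (x + s)" "?c s x y" "(s, x, y) \<in> reps (4 * \<mu>)" "s mod 3 = 1" using 2 unfolding F by auto
    from *(1) obtain t where t: "3 * x + y = 4 * t" by blast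
    have "even (3 * x + s)" using *(2) by simp
    then obtain p where p: "3 * x + s = 2 * p" by blast
    have s: "3 * x - s = 2 * (3 * x - p)" using p by simp
    have o: "odd (p - t)" "even t" "4 dvd (p - t) + (3 * x - p - t)" using *(3) by (auto simp: t p s)
    from o(2) obtain t' where t': "t = 2 * t'" by blast
    from o(3) obtain k where "(p - t) + (3 * x - p - t) = 4 * k" by blast
    then have "3 * x = 4 * (k + t')" using t' by simp
    then have "4 dvd x" by presburger
    then obtain b where x: "x = 4 * b" by blast
    define a where "a = t - 3 * b"
    have ys: "y = 4 * t - 3 * x" "s = 2 * p - 3 * x" using t p by simp_all
    have y: "y = 4 * a" unfolding ys a_def x by simp
    have s': "s = 2 * (p - 6 * b)" using ys x by simp
    have "odd (p - 6 * b)" using o by simp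
    moreover have "(- (p - 6 * b)) mod 3 = 1" using *(5) s' by presburger
    moreover have "t = 3 * b + a" using t x y by simp
    then have "even (a + b)" using o(2) by simp
    ultimately show ?case using *(4) unfolding F x y s'
      by (auto simp: reps_def reps12_def mod_6_eq_1_iff power2_eq_square algebra_simps)
  next
    case (3 F)
    then show ?case by (cases F) auto
  next
    case (4 F)
    obtain s a b where F: "F = (s, a, b)" by (cases F)
    have *: "(s, a, b) \<in> reps12 \<mu>" "even (a + b)" using 4 unfolding F by auto
    have s: "s mod 3 = 1" "odd s" using *(1) by (auto simp: reps12_def mod_6_eq_1_iff)
    have d: "(3 * (4 * b) + - 2 * s) div 2 = 6 * b - s" "(3 * (4 * b) - - 2 * s) div 2 = 6 * b + s"
        "(3 * (4 * b) + 4 * a) div 4 = 3 * b + a" by (rule int_div_eqI; simp)+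
    have "(- 2 * s) mod 3 = 1" using s(1) by presburger
    moreover have "even (4 * b + - 2 * s)" by simp
    moreover have "3 * (4 * b) + 4 * a = 4 * (3 * b + a)" by simp
    then have "4 dvd 3 * (4 * b) + 4 * a" by (metis dvd_triv_left)
    moreover have "(- 2 * s, 4 * b, 4 * a) \<in> reps (4 * \<mu>)" using *(1) by (auto simp: reps12_def reps_def power2_eq_square algebra_simps)
    moreover have "?c (- 2 * s) (4 * b) (4 * a)"
    proof -
      have "even (3 * b - a)" using *(2) by simp
      then obtain k where "3 * b - a = 2 * k" by blast
      then have "6 * b - s - (3 * b + a) + (6 * b + s - (3 * b + a)) = 4 * k" by simp
      then have "4 dvd 6 * b - s - (3 * b + a) + (6 * b + s - (3 * b + a))" by (metis dvd_triv_left)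
      then show ?thesis unfolding d using *(2) s(2) by simp
    qed
    ultimately show ?case unfolding F prod.case mem_Collect_eq by blast
  next
    case (5 F)
    obtain s x y where F: "F = (s, x, y)" by (cases F)
    have *: "4 dvd 3 * x + y" "even (x + s)" "?c s x y" using 5 unfolding F by auto
    from *(1) obtain t where t: "3 * x + y = 4 * t" by blast
    have "even (3 * x + s)" using *(2) by simp
    then obtain p where p: "3 * x + s = 2 * p" by blast
    have s: "3 * x - s = 2 * (3 * x - p)" using p by simp
    have o: "odd (p - t)" "even t" "4 dvd (p - t) + (3 * x - p - t)" using *(3) by (auto simp: t p s)
    from o(2) obtain t' where t': "t = 2 * t'" by blast
    from o(3) obtain k where k: "(p - t) + (3 * x - p - t) = 4 * k" by blast
    then have "3 * x = 4 * (k + t')" using t' by simp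
    then have "4 dvd x" by presburger
    then obtain b where x: "x = 4 * b" by blast
    define a where "a = t - 3 * b"
    have ys: "y = 4 * t - 3 * x" "s = 2 * p - 3 * x" using t p by simp_all
    have y: "y = 4 * a" unfolding ys a_def x by simp
    have s': "s = 2 * (p - 6 * b)" using ys x by simp
    have tt: "t = 3 * b + a" using t x y by simp
    have kk: "3 * b - a = 2 * k" using k x tt by simp
    have od: "odd (p - t)" "odd (3 * x - p - t)" using o x by simp_all
    have e: "?e s x y = chi4 (p - t) * (if even k then 1 else \<delta>)"
      unfolding t p s using o od by (simp add: parity_char_def k)
    have pt: "p - t = 2 * k + (p - 6 * b)" using kk tt by simp
    have "odd (p - 6 * b)" using o by simp
    from chi4_shift[OF this, of k] have c: "chi4 (p - t) = (if even k then 1 else - 1) * chi4 (p - 6 * b)"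
      unfolding pt by simp
    have "4 dvd 3 * b - a \<longleftrightarrow> even k" unfolding kk by presburger
    moreover have "mn (3 * x) y = 4 * mn (3 * b) a" using mn_scale[of 4 "3 * b" a] x y by simp
    moreover have "s div 2 = p - 6 * b" "x div 4 = b" "y div 4 = a" using s' x y by simp_all
    ultimately show ?case unfolding F prod.case e c chi4_minus by simp
  qed
  finally show ?thesis by (simp add: sum_distrib_left split_beta)
qed

text \<open>Here \<open>A = 3 * n = 2 * k + s\<close> and \<open>d = 4 * b\<close>, so
  \<open>chi4 A\<close> contributes the parity of \<open>k\<close> and
  \<open>(A + C) / 4 = k - b\<close> that of \<open>k - b\<close>. Only the parity of
  \<open>b\<close> survives, with weight \<open>b\<close>: these are the divisor sums behind
  \<open>R_term\<close>. The factor 8 is 2 for the sign of \<open>s\<close> times 4 from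
  \<open>d\<close>.\<close>

lemma cusp_sum_parity:
  "(\<Sum>(s, n, d)\<in>reps \<mu>. parity_char (-1) (3 * n) (s - 3 * n) (3 * n - d - 2 * s) * chi3 s * d)
   = 8 * (\<Sum>(s, a, b)\<in>{(s, a, b)\<in>reps12 \<mu>. odd a}. chi4 s * (if even b then 1 else -1) * real_of_int b)"
proof -
  let ?h = "\<lambda>s n d. if odd n \<and> odd s \<and> 4 dvd d then chi4 s * (if even (d div 4) then 1 else -1) * chi3 s * real_of_int d else 0"
  have *: "parity_char (-1) (3 * n) (s - 3 * n) (3 * n - d - 2 * s)
     = (if odd n \<and> odd s \<and> 4 dvd d then chi4 s * (if even (d div 4) then 1 else -1) else 0)" for s n d
  proof (cases "odd n \<and> odd s")
    case True
    then have "even (3 * n - s)" by simp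
    then obtain k where k: "3 * n - s = 2 * k" by blast
    have eq: "3 * n + (3 * n - d - 2 * s) = 4 * k - d" using k by simp
    have dv: "4 dvd 4 * k - d \<longleftrightarrow> 4 dvd d" by presburger
    show ?thesis
    proof (cases "4 dvd d")
      case True': True
      then obtain b where b: "d = 4 * b" by blast
      have "3 * n = 2 * k + s" using k by simp
      then have "chi4 (3 * n) = (if even k then 1 else -1) * chi4 s" using chi4_shift[of s k] True by simp
      moreover have "(4 * k - d) div 4 = k - b" unfolding b by (rule int_div_eqI) simp_all
      ultimately show ?thesis using True True' unfolding parity_char_def eq dv by (simp add: b)
    qed (use True in \<open>simp add: parity_char_def eq dv\<close>)
  qed (auto simp: parity_char_def)
  have "(\<Sum>(s, n, d)\<in>reps \<mu>. parity_char (-1) (3 * n) (s - 3 * n) (3 * n - d - 2 * s) * chi3 s * d)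
     = (\<Sum>(s, n, d)\<in>reps \<mu>. ?h s n d)"
    unfolding * by (rule sum.cong) auto
  also have "\<dots> = 2 * (\<Sum>(s, n, d)\<in>{(s, n, d)\<in>reps \<mu>. s mod 3 = 1}. ?h s n d)"
    by (rule sum_reps_half) (auto simp: chi4_minus chi3_minus, simp add: chi3_def)
  also have "(\<Sum>(s, n, d)\<in>{(s, n, d)\<in>reps \<mu>. s mod 3 = 1}. ?h s n d)
     = (\<Sum>(s, n, d)\<in>{(s, n, d)\<in>reps \<mu>. s mod 6 = 1 \<and> odd n \<and> 4 dvd d}. chi4 s * (if even (d div 4) then 1 else -1) * real_of_int d)"
    by (rule sum.mono_neutral_cong_right)
       (auto simp: mod_6_eq_1_iff chi3_def intro: finite_subset[OF _ finite_reps] split: if_splits)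
  also have "\<dots> = (\<Sum>(s, a, b)\<in>{(s, a, b)\<in>reps12 \<mu>. odd a}. 4 * (chi4 s * (if even b then 1 else -1) * real_of_int b))"
    by (rule sum.reindex_bij_witness[of _ "\<lambda>(s, a, b). (s, a, 4 * b)" "\<lambda>(s, a, b). (s, a, b div 4)"])
       (auto simp: reps_def reps12_def)
  finally show ?thesis by (simp add: sum_distrib_left split_beta)
qed

text \<open>The factor \<open>1 - \<delta>\<close> covers both cases at once: the cusp sum is 0 for
  \<delta> = 1 and given by \<open>cusp_sum_parity\<close> for \<delta> = -1.\<close>

theorem parity_reps_identity:
  assumes "\<mu> mod 12 = 1" "\<delta> = 1 \<or> \<delta> = -1"
  shows "2 * (\<Sum>(t, n, m)\<in>reps4 \<mu>. chi4 n * (if even ((3 * n - m) div 4) then 1 else \<delta>) * real_of_int t * cr (3 * n) (3 * n - m))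
   = (\<Sum>(s, a, b)\<in>{(s, a, b)\<in>reps12 \<mu>. even (a + b)}. chi4 s * (if 4 dvd 3 * b - a then 1 else - \<delta>) * mn (3 * b) a)
     - (1 - \<delta>) * (\<Sum>(s, a, b)\<in>{(s, a, b)\<in>reps12 \<mu>. odd a}. chi4 s * (if even b then 1 else -1) * real_of_int b)"
proof -
  have mu: "\<mu> mod 3 = 1" using assms(1) by presburger
  have 1: "(\<Sum>(A, t, C)\<in>box \<mu> (10 * \<mu>). if A = 0 then parity_char \<delta> A t C * root_char A t * (A + 2 * t + C)
            * cr (A + 2 * t + C) (A + C) else 0) = 0"
    by (rule sum.neutral) (auto simp: parity_char_def)
  have 2: "(\<Sum>(s, n, d)\<in>reps \<mu>. parity_char \<delta> (3 * n) (s - 3 * n) (3 * n - d - 2 * s) * chi3 s * d)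
    = 4 * (1 - \<delta>) * (\<Sum>(s, a, b)\<in>{(s, a, b)\<in>reps12 \<mu>. odd a}. chi4 s * (if even b then 1 else -1) * real_of_int b)"
    using assms(2) cusp_sum_parity[of \<mu>] parity_char.cusp_sum_eq_0[OF parity_char_shift, of \<mu>] by auto
  have gen: "2 * x = y - (1 - \<delta>) * z" if "8 * (2 * x) = - 2 * (4 * (1 - \<delta>) * z) - 0 - 2 * (- 4 * y)" for x y z
    using that by (simp add: algebra_simps)
  show ?thesis
    using parity_char.crossing_reps[OF mu order.refl, of \<delta>]
    unfolding 1 2 crossing_sum_parity midpoint_sum_parity by (rule gen)
qed

section \<open>Bailey's lemma and the pentagonal number theorem\<close>

text \<open>Congruence modulo \<open>q^(N+1)\<close>. It replaces limits: every infinite product or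
  series below is handled through finite ones that agree with it up to a given order.\<close>

definition fps_agree :: "nat \<Rightarrow> real fps \<Rightarrow> real fps \<Rightarrow> bool" where
  "fps_agree N a b \<longleftrightarrow> (\<forall>i\<le>N. fps_nth a i = fps_nth b i)"

lemma fps_agree_refl [simp]: "fps_agree N a a"
  by (simp add: fps_agree_def)

lemma fps_agree_sym: "fps_agree N a b \<Longrightarrow> fps_agree N b a"
  by (simp add: fps_agree_def)

lemma fps_agree_trans [trans]: "fps_agree N a b \<Longrightarrow> fps_agree N b c \<Longrightarrow> fps_agree N a c"
  by (simp add: fps_agree_def)

lemma fps_agree_add: "fps_agree N a b \<Longrightarrow> fps_agree N c d \<Longrightarrow> fps_agree N (a + c) (b + d)"
  by (simp add: fps_agree_def)

lemma fps_agree_mult: "fps_agree N a b \<Longrightarrow> fps_agree N c d \<Longrightarrow> fps_agree N (a * c) (b * d)"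
  by (auto simp: fps_agree_def fps_mult_nth intro!: sum.cong)

lemma fps_agree_sum: "(\<And>x. x \<in> A \<Longrightarrow> fps_agree N (f x) (g x)) \<Longrightarrow> fps_agree N (sum f A) (sum g A)"
  by (auto simp: fps_agree_def fps_sum_nth intro!: sum.cong)

lemma fps_agree_power_0: "n > N \<Longrightarrow> fps_agree N (fps_X ^ n * a) 0"
  by (simp add: fps_agree_def fps_X_power_mult_nth)

lemma fps_agree_inverse:
  assumes "fps_agree N a b" "a * a' = 1" "b * b' = 1"
  shows "fps_agree N a' b'"
proof -
  have "fps_agree N (a' * b' * b) (a' * b' * a)"
    by (rule fps_agree_mult[OF fps_agree_refl fps_agree_sym[OF assms(1)]])
  moreover have "a' * b' * b = a' * (b * b')" by (simp only: mult_ac)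
  then have "a' * b' * b = a'" unfolding assms(3) by simp
  moreover have "a' * b' * a = (a * a') * b'" by (simp only: mult_ac)
  then have "a' * b' * a = b'" unfolding assms(2) by simp
  ultimately show ?thesis by (simp only:)
qed

lemma fps_agree_geometric:
  fixes y :: "real fps"
  assumes "y = fps_const x * fps_X ^ r" "r > 0" "(1 - y) * z = 1"
  shows "fps_agree N z (\<Sum>j\<le>N. y ^ j)"
proof -
  let ?S = "\<Sum>j\<le>N. y ^ j"
  have geo: "(1 - y) * ?S = 1 - y ^ Suc N"
    unfolding lessThan_Suc_atMost[symmetric] by (rule one_diff_power_eq[symmetric])
  have "?S = ((1 - y) * z) * ?S" unfolding assms(3) by simp
  also have "\<dots> = z * ((1 - y) * ?S)" by (simp only: mult_ac)
  also have "\<dots> = z - z * y ^ Suc N" unfolding geo by (simp only: right_diff_distrib mult_1_right)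
  finally have eq: "?S = z - z * y ^ Suc N" .
  have "z * y ^ Suc N = fps_X ^ (r * Suc N) * (fps_const x ^ Suc N * z)"
    unfolding assms(1) power_mult_distrib power_mult[symmetric] by (simp only: mult_ac)
  moreover have "r * Suc N > N" using assms(2) by (cases r) auto
  ultimately have "fps_agree N (z * y ^ Suc N) 0"
    by (simp only: fps_agree_power_0)
  then show ?thesis unfolding eq fps_agree_def fps_sub_nth by simp
qed

section \<open>q-factorials and Bailey's lemma\<close>

locale euler_product =
  fixes d :: nat and q :: "real fps"
  assumes d_pos: "d > 0" and q_def: "q = fps_X ^ d"
begin

definition poch :: "nat \<Rightarrow> real fps" where
  "poch n = (\<Prod>k = 1..n. 1 - q ^ k)"

definition ipoch :: "nat \<Rightarrow> real fps" where
  "ipoch n = inverse (poch n)"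

lemma q_power_nth_0: "k > 0 \<Longrightarrow> fps_nth (q ^ k) 0 = 0"
  using d_pos unfolding q_def power_mult[symmetric] by (simp add: fps_X_power_nth)

lemma poch_nth_0: "fps_nth (poch n) 0 = 1"
  unfolding poch_def by (auto simp: fps_prod_nth' q_power_nth_0 intro!: prod.neutral)

lemma poch_ipoch: "poch n * ipoch n = 1"
  unfolding ipoch_def by (rule inverse_mult_eq_1') (simp add: poch_nth_0)

lemma poch_Suc: "poch (Suc n) = poch n * (1 - q ^ Suc n)"
  by (simp add: poch_def)

lemma poch_0 [simp]: "poch 0 = 1" and ipoch_0 [simp]: "ipoch 0 = 1"
  by (simp_all add: poch_def ipoch_def)

lemma ipoch_Suc: "ipoch n = (1 - q ^ Suc n) * ipoch (Suc n)"
proof -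
  have "ipoch n = ipoch n * (poch (Suc n) * ipoch (Suc n))" by (simp add: poch_ipoch)
  also have "\<dots> = (poch n * ipoch n) * ((1 - q ^ Suc n) * ipoch (Suc n))"
    unfolding poch_Suc by (simp only: mult_ac)
  finally show ?thesis by (simp add: poch_ipoch)
qed

lemma one_minus_q_nonzero: "k > 0 \<Longrightarrow> 1 - q ^ k \<noteq> 0"
proof
  assume k: "k > 0" and "1 - q ^ k = 0"
  then have "fps_nth (1 - q ^ k) 0 = 0" by simp
  then show False using q_power_nth_0[OF k] by simp
qed

lemma agree_q_power_0: "n > N \<Longrightarrow> fps_agree N (q ^ n * a) 0"
proof -
  assume "n > N"
  moreover have "1 * n \<le> d * n" using d_pos by (intro mult_right_mono) auto
  ultimately have "d * n > N" by linarith
  then show ?thesis unfolding q_def power_mult[symmetric] by (rule fps_agree_power_0)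
qed

text \<open>A form of the q-Chu-Vandermonde sum; for large \<open>M\<close> it counts partitions by
  their Durfee rectangle. The recursion in \<open>M\<close> comes from
  \<open>1 - q^(M+1) = (1 - q^(M+1-m)) + q^(M+1-m) (1 - q^m)\<close>, each part of which cancels a
  factor of a denominator. The second part shifts \<open>m\<close> and thereby \<open>c\<close>, so
  \<open>c\<close> has to vary in the induction.\<close>

lemma durfee_sum: "(\<Sum>m\<le>M. q ^ (m * (m + c)) * ipoch (M - m) * ipoch m * ipoch (m + c)) = ipoch M * ipoch (M + c)"
proof (induction M arbitrary: c)
  case (Suc M)
  let ?V = "\<lambda>M c. \<Sum>m\<le>M. q ^ (m * (m + c)) * ipoch (M - m) * ipoch m * ipoch (m + c)"
  \<comment> \<open>In this part the top term \<open>m = Suc M\<close> drops out, in the next one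
    the bottom term \<open>m = 0\<close>.\<close>
  have A: "(\<Sum>m\<le>Suc M. q ^ (m * (m + c)) * ((1 - q ^ (Suc M - m)) * ipoch (Suc M - m)) * ipoch m * ipoch (m + c)) = ?V M c"
  proof -
    have "(\<Sum>m\<le>Suc M. q ^ (m * (m + c)) * ((1 - q ^ (Suc M - m)) * ipoch (Suc M - m)) * ipoch m * ipoch (m + c))
      = (\<Sum>m\<le>M. q ^ (m * (m + c)) * ((1 - q ^ (Suc M - m)) * ipoch (Suc M - m)) * ipoch m * ipoch (m + c))"
      by (simp only: sum.atMost_Suc diff_self_eq_0 power_0 diff_self mult_zero_left mult_zero_right add_0_right)
    also have "\<dots> = ?V M c"
    proof (rule sum.cong, simp)
      fix m assume "m \<in> {..M}"
      then have "Suc M - m = Suc (M - m)" by (simp add: Suc_diff_le)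
      then show "q ^ (m * (m + c)) * ((1 - q ^ (Suc M - m)) * ipoch (Suc M - m)) * ipoch m * ipoch (m + c)
        = q ^ (m * (m + c)) * ipoch (M - m) * ipoch m * ipoch (m + c)"
        by (simp only: ipoch_Suc[symmetric])
    qed
    finally show ?thesis .
  qed
  have B: "(\<Sum>m\<le>Suc M. q ^ (m * (m + c)) * q ^ (Suc M - m) * ipoch (Suc M - m) * ((1 - q ^ m) * ipoch m) * ipoch (m + c))
     = q ^ (M + c + 1) * ?V M (c + 1)"
  proof -
    have "(\<Sum>m\<le>Suc M. q ^ (m * (m + c)) * q ^ (Suc M - m) * ipoch (Suc M - m) * ((1 - q ^ m) * ipoch m) * ipoch (m + c))
      = (\<Sum>m\<le>M. q ^ (Suc m * (Suc m + c)) * q ^ (M - m) * ipoch (M - m) * ((1 - q ^ Suc m) * ipoch (Suc m)) * ipoch (Suc m + c))"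
      unfolding sum.atMost_Suc_shift
      by (simp only: power_0 diff_self mult_zero_left mult_zero_right add_0_left diff_Suc_Suc)
    also have "\<dots> = (\<Sum>m\<le>M. q ^ (M + c + 1) * (q ^ (m * (m + (c + 1))) * ipoch (M - m) * ipoch m * ipoch (m + (c + 1))))"
    proof (rule sum.cong, simp)
      fix m assume "m \<in> {..M}"
      then have "Suc m * (Suc m + c) + (M - m) = (M + c + 1) + m * (m + (c + 1))"
        by (auto simp: algebra_simps)
      then have eq: "q ^ (Suc m * (Suc m + c)) * q ^ (M - m) = q ^ (M + c + 1) * q ^ (m * (m + (c + 1)))"
        unfolding power_add[symmetric] by (rule arg_cong)
      have idx: "Suc m + c = m + (c + 1)" by simp
      show "q ^ (Suc m * (Suc m + c)) * q ^ (M - m) * ipoch (M - m) * ((1 - q ^ Suc m) * ipoch (Suc m)) * ipoch (Suc m + c)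
        = q ^ (M + c + 1) * (q ^ (m * (m + (c + 1))) * ipoch (M - m) * ipoch m * ipoch (m + (c + 1)))"
        unfolding eq ipoch_Suc[of m, symmetric] unfolding idx by (simp only: mult_ac)
    qed
    finally show ?thesis by (simp only: sum_distrib_left)
  qed
  have "(1 - q ^ Suc M) * ?V (Suc M) c
    = (\<Sum>m\<le>Suc M. q ^ (m * (m + c)) * ((1 - q ^ (Suc M - m)) * ipoch (Suc M - m)) * ipoch m * ipoch (m + c))
      + (\<Sum>m\<le>Suc M. q ^ (m * (m + c)) * q ^ (Suc M - m) * ipoch (Suc M - m) * ((1 - q ^ m) * ipoch m) * ipoch (m + c))"
    unfolding sum_distrib_left sum.distrib[symmetric]
  proof (rule sum.cong, simp)
    fix m assume "m \<in> {..Suc M}"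
    then have "Suc M - m + m = Suc M" by simp
    then have eq: "q ^ Suc M = q ^ (Suc M - m) * q ^ m" by (simp only: power_add[symmetric])
    have alg: "(1 - a * b) * (x * u * v * w) = x * ((1 - a) * u) * v * w + x * a * u * ((1 - b) * v) * w"
      for a b x u v w :: "real fps" by (simp add: algebra_simps)
    show "(1 - q ^ Suc M) * (q ^ (m * (m + c)) * ipoch (Suc M - m) * ipoch m * ipoch (m + c))
       = q ^ (m * (m + c)) * ((1 - q ^ (Suc M - m)) * ipoch (Suc M - m)) * ipoch m * ipoch (m + c)
       + q ^ (m * (m + c)) * q ^ (Suc M - m) * ipoch (Suc M - m) * ((1 - q ^ m) * ipoch m) * ipoch (m + c)"
      unfolding eq by (rule alg)
  qed
  also have "\<dots> = ?V M c + q ^ (M + c + 1) * ?V M (c + 1)"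
    by (simp only: A B)
  also have "\<dots> = ipoch M * (ipoch (M + c) + q ^ (M + c + 1) * ipoch (M + c + 1))"
    unfolding Suc.IH by (simp only: distrib_left mult.left_commute add.assoc)
  also have "ipoch (M + c) + q ^ (M + c + 1) * ipoch (M + c + 1) = ipoch (M + c + 1)"
    using ipoch_Suc[of "M + c"] by (simp add: left_diff_distrib)
  also have "ipoch M * ipoch (M + c + 1) = (1 - q ^ Suc M) * (ipoch (Suc M) * ipoch (Suc M + c))"
    using ipoch_Suc[of M] by (simp add: mult.assoc)
  finally show ?case using mult_left_cancel[OF one_minus_q_nonzero[of "Suc M"]] by blast
qed simp

text \<open>Interchange the sums; the inner one is \<open>durfee_sum\<close> shifted by
  \<open>r\<close>. The parameter \<open>c\<close> is 0 or 1 for Bailey pairs relative to 1 or to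
  \<open>q\<close>; the usual factor \<open>1 - q\<close> in the second case is absorbed in
  \<alpha>.\<close>

lemma bailey_lemma:
  assumes "\<And>n. \<beta> n = (\<Sum>r\<le>n. \<alpha> r * ipoch (n - r) * ipoch (n + r + c))"
  shows "(\<Sum>n\<le>L. q ^ (n * (n + c)) * \<beta> n * ipoch (L - n))
    = (\<Sum>r\<le>L. q ^ (r * (r + c)) * \<alpha> r * ipoch (L - r) * ipoch (L + r + c))"
proof -
  have "(\<Sum>n\<le>L. q ^ (n * (n + c)) * \<beta> n * ipoch (L - n))
    = (\<Sum>n\<le>L. \<Sum>r\<le>n. q ^ (n * (n + c)) * (\<alpha> r * ipoch (n - r) * ipoch (n + r + c)) * ipoch (L - n))"
    unfolding assms by (simp add: sum_distrib_left sum_distrib_right)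
  also have "\<dots> = (\<Sum>r\<le>L. \<Sum>n\<in>{r..L}. q ^ (n * (n + c)) * (\<alpha> r * ipoch (n - r) * ipoch (n + r + c)) * ipoch (L - n))"
    unfolding sum.Sigma[OF finite_atMost ballI[OF finite_atMost]] sum.Sigma[OF finite_atMost ballI[OF finite_atLeastAtMost]]
    by (rule sum.reindex_bij_witness[of _ "\<lambda>(a, b). (b, a)" "\<lambda>(a, b). (b, a)"]) auto
  also have "\<dots> = (\<Sum>r\<le>L. q ^ (r * (r + c)) * \<alpha> r * ipoch (L - r) * ipoch (L + r + c))"
  proof (rule sum.cong, simp)
    fix r assume "r \<in> {..L}"
    then have r: "r \<le> L" by simp
    have "(\<Sum>n\<in>{r..L}. q ^ (n * (n + c)) * (\<alpha> r * ipoch (n - r) * ipoch (n + r + c)) * ipoch (L - n))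
      = (\<Sum>m\<le>L - r. q ^ (r * (r + c)) * \<alpha> r * (q ^ (m * (m + (2 * r + c))) * ipoch (L - r - m) * ipoch m * ipoch (m + (2 * r + c))))"
    proof (rule sum.reindex_bij_witness[of _ "\<lambda>m. m + r" "\<lambda>n. n - r"], goal_cases)
      case (5 n)
      define m where "m = n - r"
      then have n: "n = r + m" and m: "m \<le> L - r" using 5 by auto
      have e: "n * (n + c) = r * (r + c) + m * (m + (2 * r + c))" unfolding n by (simp add: algebra_simps)
      have "n - r = m" "n + r + c = m + (2 * r + c)" "L - n = L - r - m" using n by simp_all
      then show ?case unfolding e power_add by (simp only: mult_ac)
    qed (use r in auto)
    also have "\<dots> = q ^ (r * (r + c)) * \<alpha> r * (ipoch (L - r) * ipoch (L - r + (2 * r + c)))"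
      by (simp only: sum_distrib_left[symmetric] durfee_sum)
    also have "L - r + (2 * r + c) = L + r + c" using r by simp
    finally show "(\<Sum>n\<in>{r..L}. q ^ (n * (n + c)) * (\<alpha> r * ipoch (n - r) * ipoch (n + r + c)) * ipoch (L - n))
      = q ^ (r * (r + c)) * \<alpha> r * ipoch (L - r) * ipoch (L + r + c)" by (simp add: mult.assoc)
  qed
  finally show ?thesis .
qed


lemma ipoch_agree:
  assumes E: "\<And>n. fps_agree n (poch n) E" and IE: "E * IE = 1" and "N \<le> n"
  shows "fps_agree N (ipoch n) IE"
proof -
  have "fps_agree N (poch n) E" using E[of n] \<open>N \<le> n\<close> by (simp add: fps_agree_def)
  from fps_agree_inverse[OF this poch_ipoch IE] show ?thesis .
qed

text \<open>With \<open>L = 2 * N\<close> both \<open>L - n\<close> and \<open>L + n + c\<close> are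
  at least \<open>N\<close> for \<open>n \<le> N\<close>, so all q-factorials that matter agree with
  the infinite product \<open>E\<close>; terms with \<open>n > N\<close> are killed by
  \<open>q^(n(n+c))\<close>. The left side carries one factor \<open>1 / E\<close> and the right
  side two, so one \<open>E\<close> stays with \<open>g\<close>.\<close>

lemma bailey_limit:
  assumes pair: "\<And>n. \<beta> n = (\<Sum>r\<le>n. \<alpha> r * ipoch (n - r) * ipoch (n + r + c))"
    and g: "\<And>N. fps_agree N g (\<Sum>n\<le>N. q ^ (n * (n + c)) * \<beta> n)"
    and E: "\<And>n. fps_agree n (poch n) E"
  shows "fps_agree N (E * g) (\<Sum>r\<le>N. q ^ (r * (r + c)) * \<alpha> r)"
proof -
  define IE where "IE = inverse E"
  have "fps_nth E 0 = 1" using E[of 0] by (simp add: fps_agree_def)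
  then have IE: "E * IE = 1" unfolding IE_def by (intro inverse_mult_eq_1') simp
  have cut: "fps_agree N (\<Sum>n\<le>2 * N. q ^ (n * (n + c)) * h n * p n) ((\<Sum>n\<le>N. q ^ (n * (n + c)) * h n) * P)"
    if p: "\<And>n. n \<le> N \<Longrightarrow> fps_agree N (p n) P" for h p P
  proof -
    have "fps_agree N (\<Sum>n\<le>2 * N. q ^ (n * (n + c)) * h n * p n) (\<Sum>n\<le>2 * N. if n \<le> N then q ^ (n * (n + c)) * h n * P else 0)"
    proof (rule fps_agree_sum)
      fix n
      show "fps_agree N (q ^ (n * (n + c)) * h n * p n) (if n \<le> N then q ^ (n * (n + c)) * h n * P else 0)"
      proof (cases "n \<le> N")
        case True
        then show ?thesis using fps_agree_mult[OF fps_agree_refl p[OF True]] by simp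
      next
        case False
        then have "n * (n + c) > N" by (metis add_leE le_less_trans mult.commute mult_le_mono2 nat_mult_1 not_le Suc_leI add.commute le0 less_nat_zero_code nat_less_le le_square le_add1)
        then show ?thesis using False agree_q_power_0 by (simp add: mult.assoc)
      qed
    qed
    also have "(\<Sum>n\<le>2 * N. if n \<le> N then q ^ (n * (n + c)) * h n * P else 0) = (\<Sum>n\<le>N. q ^ (n * (n + c)) * h n * P)"
      by (rule sum.mono_neutral_cong_right) auto
    finally show ?thesis by (simp only: sum_distrib_right)
  qed
  have "fps_agree N (\<Sum>n\<le>2 * N. q ^ (n * (n + c)) * \<beta> n * ipoch (2 * N - n)) ((\<Sum>n\<le>N. q ^ (n * (n + c)) * \<beta> n) * IE)"
    by (rule cut, rule ipoch_agree[OF E IE]) simp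
  moreover have "fps_agree N (\<Sum>r\<le>2 * N. q ^ (r * (r + c)) * \<alpha> r * (ipoch (2 * N - r) * ipoch (2 * N + r + c)))
      ((\<Sum>r\<le>N. q ^ (r * (r + c)) * \<alpha> r) * (IE * IE))"
    by (rule cut, intro fps_agree_mult ipoch_agree[OF E IE]) simp_all
  ultimately have "fps_agree N ((\<Sum>n\<le>N. q ^ (n * (n + c)) * \<beta> n) * IE) ((\<Sum>r\<le>N. q ^ (r * (r + c)) * \<alpha> r) * (IE * IE))"
    unfolding bailey_lemma[of \<beta> \<alpha> c "2 * N", OF pair] mult.assoc[symmetric]
    by (rule fps_agree_trans[OF fps_agree_sym])
  moreover have "fps_agree N (g * IE) ((\<Sum>n\<le>N. q ^ (n * (n + c)) * \<beta> n) * IE)"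
    by (rule fps_agree_mult[OF g fps_agree_refl])
  ultimately have "fps_agree N (g * IE) ((\<Sum>r\<le>N. q ^ (r * (r + c)) * \<alpha> r) * (IE * IE))"
    by (rule fps_agree_trans[rotated])
  then have "fps_agree N (E * E * (g * IE)) (E * E * ((\<Sum>r\<le>N. q ^ (r * (r + c)) * \<alpha> r) * (IE * IE)))"
    by (rule fps_agree_mult[OF fps_agree_refl])
  moreover have "E * E * (g * IE) = E * g * (E * IE)" by (simp only: mult_ac)
  moreover have "E * E * ((\<Sum>r\<le>N. q ^ (r * (r + c)) * \<alpha> r) * (IE * IE)) = (\<Sum>r\<le>N. q ^ (r * (r + c)) * \<alpha> r) * (E * IE) * (E * IE)"
    by (simp only: mult_ac)
  ultimately show ?thesis unfolding IE by simp
qed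

end

section \<open>The pentagonal number theorem\<close>

fun tri :: "nat \<Rightarrow> nat" where
  "tri 0 = 0" | "tri (Suc n) = tri n + Suc n"

lemma two_tri: "2 * tri n = n * (n + 1)"
  by (induction n) auto

definition pent :: "int \<Rightarrow> nat" where
  "pent j = nat (j * (3 * j + 1) div 2)"

definition pent_sign :: "int \<Rightarrow> real" where
  "pent_sign j = (if even j then 1 else -1)"

lemma pent_of_nat: "pent (int k) = k * k + tri k"
proof -
  have "2 * int (k * k + tri k) = int k * (3 * int k + 1)"
    using arg_cong[OF two_tri[of k], of int] by (simp add: algebra_simps)
  then have "int k * (3 * int k + 1) div 2 = int (k * k + tri k)" by simp
  then show ?thesis unfolding pent_def by (simp only: nat_int)
qed

lemma pent_minus: "pent (- int (Suc k)) = Suc k * Suc k + tri k"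
proof -
  have "2 * int (Suc k * Suc k + tri k) = - int (Suc k) * (3 * - int (Suc k) + 1)"
    using arg_cong[OF two_tri[of k], of int] by (simp add: algebra_simps)
  then have "- int (Suc k) * (3 * - int (Suc k) + 1) div 2 = int (Suc k * Suc k + tri k)" by simp
  then show ?thesis unfolding pent_def by (simp only: nat_int)
qed

lemma pent_ge: "nat \<bar>j\<bar> \<le> pent j"
proof (cases "j \<ge> 0")
  case True
  then obtain k where j: "j = int k" by (metis nonneg_int_cases)
  have "k \<le> k * k" by (cases k) auto
  then have "k \<le> k * k + tri k" by (rule trans_le_add1)
  then show ?thesis unfolding j pent_of_nat by simp
next
  case False
  then obtain k where j: "j = - int (Suc k)" by (metis not_le int_cases negative_eq_positive neg_int_cases zero_less_Suc Suc_pred')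
  show ?thesis unfolding j pent_minus by simp
qed

context euler_product
begin

text \<open>Shanks's finite sum: it equals the pentagonal series cut at \<open>- n\<close> and
  \<open>n\<close> exactly, and its term \<open>k = 0\<close> is \<open>poch n\<close> while all
  others have order above \<open>n\<close>.\<close>

definition shanks :: "nat \<Rightarrow> real fps" where
  "shanks n = (\<Sum>k\<le>n. (-1) ^ k * (poch n * ipoch k) * q ^ (k * n + tri k))"

text \<open>The last factor is the relative change of the \<open>k\<close>-th summand when
  \<open>n\<close> is raised by 1; summed over \<open>k\<close> these changes telescope.\<close>

lemma shanks_telescope:
  "(\<Sum>k\<le>K. (-1) ^ k * (poch n * ipoch k) * q ^ (k * n + tri k) * ((1 - q ^ Suc n) * q ^ k - 1))
    = - ((-1) ^ K * (poch n * ipoch K) * q ^ (Suc K * Suc n + tri K))"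
proof (induction K)
  case (Suc K)
  let ?k = "Suc K"
  have e1: "q ^ (Suc K * Suc n + tri K) = q ^ (?k * n + tri ?k)" by (rule arg_cong[where f = "\<lambda>n. q ^ n"]) simp
  have "Suc ?k * Suc n + tri ?k = (?k * n + tri ?k) + (Suc n + ?k)" by simp
  then have e2: "q ^ (Suc ?k * Suc n + tri ?k) = q ^ (?k * n + tri ?k) * (q ^ Suc n * q ^ ?k)"
    by (simp only: power_add)
  have alg: "- (s * (P * ((1 - b) * i)) * x) + (- 1 * s) * (P * i) * x * ((1 - a) * b - 1) = - ((- 1 * s) * (P * i) * (x * (a * b)))"
    for s P b i x a :: "real fps" by (simp add: algebra_simps)
  show ?case
    unfolding sum.atMost_Suc Suc.IH e1 e2 ipoch_Suc[of K] power_Suc[of "-1"] by (rule alg)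
qed simp

lemma shanks_Suc:
  "shanks (Suc n) = shanks n + (-1) ^ Suc n * (q ^ (Suc n * Suc n + tri n) + q ^ (Suc n * Suc n + tri (Suc n)))"
proof -
  have "shanks (Suc n) = (\<Sum>k\<le>n. (-1) ^ k * (poch (Suc n) * ipoch k) * q ^ (k * Suc n + tri k))
     + (-1) ^ Suc n * (poch (Suc n) * ipoch (Suc n)) * q ^ (Suc n * Suc n + tri (Suc n))"
    unfolding shanks_def by (rule sum.atMost_Suc)
  also have "(\<Sum>k\<le>n. (-1) ^ k * (poch (Suc n) * ipoch k) * q ^ (k * Suc n + tri k))
     = (\<Sum>k\<le>n. (-1) ^ k * (poch n * ipoch k) * q ^ (k * n + tri k)
         + (-1) ^ k * (poch n * ipoch k) * q ^ (k * n + tri k) * ((1 - q ^ Suc n) * q ^ k - 1))"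
  proof (rule sum.cong, simp)
    fix k
    have "k * Suc n + tri k = (k * n + tri k) + k" by simp
    then have e: "q ^ (k * Suc n + tri k) = q ^ (k * n + tri k) * q ^ k" by (simp only: power_add)
    have alg: "s * (p * a * i) * (x * b) = s * (p * i) * x + s * (p * i) * x * (a * b - 1)"
      for s p a i x b :: "real fps" by (simp add: algebra_simps)
    show "(-1) ^ k * (poch (Suc n) * ipoch k) * q ^ (k * Suc n + tri k)
      = (-1) ^ k * (poch n * ipoch k) * q ^ (k * n + tri k)
         + (-1) ^ k * (poch n * ipoch k) * q ^ (k * n + tri k) * ((1 - q ^ Suc n) * q ^ k - 1)"
      unfolding poch_Suc e by (rule alg)
  qed
  also have "\<dots> = shanks n - (-1) ^ n * (poch n * ipoch n) * q ^ (Suc n * Suc n + tri n)"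
    unfolding sum.distrib shanks_telescope shanks_def[symmetric] by (simp only: diff_conv_add_uminus)
  finally show ?thesis unfolding poch_ipoch by (simp add: algebra_simps)
qed

lemma shanks_pent: "shanks n = (\<Sum>j\<in>{-int n..int n}. fps_const (pent_sign j) * q ^ pent j)"
proof (induction n)
  case 0
  show ?case by (simp add: shanks_def pent_def pent_sign_def)
next
  case (Suc n)
  have set: "{-int (Suc n)..int (Suc n)} = insert (- int (Suc n)) (insert (int (Suc n)) {-int n..int n})" by auto
  have c: "fps_const (pent_sign (int (Suc n))) = (-1) ^ Suc n" "fps_const (pent_sign (- int (Suc n))) = (-1) ^ Suc n"
    by (simp_all add: pent_sign_def flip: fps_const_neg)
  have "(\<Sum>j\<in>{-int (Suc n)..int (Suc n)}. fps_const (pent_sign j) * q ^ pent j)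
    = (-1) ^ Suc n * q ^ pent (- int (Suc n)) + ((-1) ^ Suc n * q ^ pent (int (Suc n)) + shanks n)"
    unfolding set Suc.IH by (subst sum.insert, simp, simp, subst sum.insert, simp, simp) (simp only: c)
  then show ?case unfolding shanks_Suc pent_minus pent_of_nat by (simp add: algebra_simps)
qed

lemma shanks_agree: "fps_agree n (poch n) (shanks n)"
proof -
  have "fps_agree n (\<Sum>k\<le>n. (-1) ^ k * (poch n * ipoch k) * q ^ (k * n + tri k)) (\<Sum>k\<le>n. if k = 0 then poch n else 0)"
  proof (rule fps_agree_sum)
    fix k
    show "fps_agree n ((-1) ^ k * (poch n * ipoch k) * q ^ (k * n + tri k)) (if k = 0 then poch n else 0)"
    proof (cases k)
      case (Suc l)
      have "k * n + tri k > n" unfolding Suc by simp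
      from agree_q_power_0[OF this, of "(-1) ^ k * (poch n * ipoch k)"] show ?thesis
        unfolding Suc by (simp only: mult.commute if_False nat.simps)
    qed simp
  qed
  then have "fps_agree n (shanks n) (poch n)" unfolding shanks_def by simp
  then show ?thesis by (rule fps_agree_sym)
qed

section \<open>The Bailey pair for f\<close>

definition f_alpha :: "nat \<Rightarrow> real fps" where
  "f_alpha r = (if r = 0 then 1 else 4 * (-1) ^ r * q ^ tri r * inverse (1 + q ^ r))"

definition f_beta :: "nat \<Rightarrow> real fps" where
  "f_beta n = inverse (\<Prod>k = 1..n. (1 + q ^ k)\<^sup>2)"

lemma one_plus_inverse: "r > 0 \<Longrightarrow> (1 + q ^ r) * inverse (1 + q ^ r) = 1"
  by (rule inverse_mult_eq_1') (simp add: q_power_nth_0)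

text \<open>Summands of the unit Bailey pair relative to 1.\<close>

definition f_unit :: "nat \<Rightarrow> nat \<Rightarrow> real fps" where
  "f_unit n r = (if r = 0 then 1 else (-1) ^ r * q ^ tri (r - 1) * (1 + q ^ r)) * ipoch (n - r) * ipoch (n + r)"

text \<open>The closed form of the partial sums contains \<open>1 - q^(n-R)\<close>, so the complete
  sum \<open>R = n\<close> vanishes for \<open>n > 0\<close>.\<close>

lemma f_unit_sum:
  "R \<le> n \<Longrightarrow> (1 - q ^ n) * (\<Sum>r\<le>R. f_unit n r) = (-1) ^ R * q ^ tri R * (1 - q ^ (n - R)) * ipoch (n - R) * ipoch (n + R)"
proof (induction R)
  case (Suc R)
  then have IH: "(1 - q ^ n) * (\<Sum>r\<le>R. f_unit n r) = (-1) ^ R * q ^ tri R * (1 - q ^ (n - R)) * ipoch (n - R) * ipoch (n + R)" by simp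
  have n1: "n - R = Suc (n - Suc R)" and n2: "n = (n - Suc R) + Suc R" and n3: "n + Suc R = (n - Suc R) + Suc R + Suc R"
    using Suc.prems by simp_all
  have i1: "(1 - q ^ (n - R)) * ipoch (n - R) = ipoch (n - Suc R)" unfolding n1 ipoch_Suc[of "n - Suc R"] ..
  have i2: "ipoch (n + R) = (1 - q ^ (n + Suc R)) * ipoch (n + Suc R)" using ipoch_Suc[of "n + R"] by simp
  have q1: "q ^ n = q ^ (n - Suc R) * q ^ Suc R" using n2 by (metis power_add)
  have q2: "q ^ (n + Suc R) = q ^ (n - Suc R) * q ^ Suc R * q ^ Suc R" using n3 by (metis power_add)
  have alg: "s * t * u * ((1 - a * b * b) * v) + (1 - a * b) * ((- 1 * s) * t * (1 + b) * u * v)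
     = (- 1 * s) * (t * b) * (1 - a) * u * v" for s t u v a b :: "real fps" by (simp add: algebra_simps)
  have fS: "f_unit n (Suc R) = (- 1 * (-1) ^ R) * q ^ tri R * (1 + q ^ Suc R) * ipoch (n - Suc R) * ipoch (n + Suc R)"
    unfolding f_unit_def by (simp only: nat.simps if_False diff_Suc_1 power_Suc[of "-1"])
  have "(1 - q ^ n) * (\<Sum>r\<le>Suc R. f_unit n r)
    = (-1) ^ R * q ^ tri R * ((1 - q ^ (n - R)) * ipoch (n - R)) * ipoch (n + R) + (1 - q ^ n) * f_unit n (Suc R)"
    unfolding sum.atMost_Suc distrib_left IH by (simp only: mult.assoc)
  also have "\<dots> = (-1) ^ R * q ^ tri R * ipoch (n - Suc R) * ((1 - q ^ (n - Suc R) * q ^ Suc R * q ^ Suc R) * ipoch (n + Suc R))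
     + (1 - q ^ (n - Suc R) * q ^ Suc R) * ((- 1 * (-1) ^ R) * q ^ tri R * (1 + q ^ Suc R) * ipoch (n - Suc R) * ipoch (n + Suc R))"
    by (simp only: i1 i2 q2 q1 fS)
  also have "\<dots> = (- 1 * (-1) ^ R) * (q ^ tri R * q ^ Suc R) * (1 - q ^ (n - Suc R)) * ipoch (n - Suc R) * ipoch (n + Suc R)"
    by (rule alg)
  finally show ?case by (simp only: tri.simps power_add power_Suc[of "-1"])
qed (simp add: f_unit_def)

text \<open>Induction after multiplication by \<open>(1 + q^(n+1))^2\<close>. With
  \<open>a = q^(n+1-r)\<close> and \<open>b = q^r\<close> one has
  \<open>(1 + ab)^2 = (1 - a)(1 - ab^2) + a(1 + b)^2\<close>. The first part lowers both
  q-factorials to those for \<open>n\<close>; in the second \<open>(1 + b)^2\<close> clears the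
  denominator of \<open>f_alpha\<close> and leaves the unit pair, whose sum is 0. At
  \<open>r = 0\<close> it equals 4, hence the 4 in the other \<open>f_alpha\<close>.\<close>

lemma f_pair: "f_beta n = (\<Sum>r\<le>n. f_alpha r * ipoch (n - r) * ipoch (n + r + 0))"
proof (induction n)
  case 0
  show ?case by (simp add: f_beta_def f_alpha_def)
next
  case (Suc n)
  let ?N = "Suc n"
  have "(1 - q ^ ?N) * (\<Sum>r\<le>?N. f_unit ?N r) = 0"
    unfolding f_unit_sum[OF order.refl] by simp
  then have unit: "(\<Sum>r\<le>?N. f_unit ?N r) = 0" using one_minus_q_nonzero[of ?N] by (metis mult_eq_0_iff zero_less_Suc)
  have w: "f_alpha r * q ^ (?N - r) * (1 + q ^ r)\<^sup>2 * ipoch (?N - r) * ipoch (?N + r) = 4 * q ^ ?N * f_unit ?N r" if r: "r \<le> ?N" for r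
  proof (cases r)
    case 0
    then show ?thesis by (simp add: f_alpha_def f_unit_def)
  next
    case (Suc l)
    then have pos: "r > 0" by simp
    have e: "q ^ tri r * q ^ (?N - r) = q ^ ?N * q ^ tri (r - 1)"
      unfolding power_add[symmetric] by (rule arg_cong[where f = "\<lambda>n. q ^ n"]) (use r in \<open>simp add: Suc\<close>)
    have "f_alpha r * q ^ (?N - r) * (1 + q ^ r)\<^sup>2 * ipoch (?N - r) * ipoch (?N + r)
      = 4 * (-1) ^ r * (q ^ tri r * q ^ (?N - r)) * ((1 + q ^ r) * inverse (1 + q ^ r)) * (1 + q ^ r) * ipoch (?N - r) * ipoch (?N + r)"
      using Suc unfolding f_alpha_def power2_eq_square by (simp only: mult_ac nat.simps if_False)
    also have "\<dots> = 4 * q ^ ?N * f_unit ?N r"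
      unfolding e one_plus_inverse[OF pos] f_unit_def using Suc by (simp only: mult_ac nat.simps if_False mult_1_left mult_1_right)
    finally show ?thesis .
  qed
  have split: "(1 + q ^ ?N)\<^sup>2 * (f_alpha r * ipoch (?N - r) * ipoch (?N + r + 0))
      = (if r \<le> n then f_alpha r * ipoch (n - r) * ipoch (n + r + 0) else 0)
        + f_alpha r * q ^ (?N - r) * (1 + q ^ r)\<^sup>2 * ipoch (?N - r) * ipoch (?N + r)" if r: "r \<le> ?N" for r
  proof (cases "r \<le> n")
    case True
    then have s: "?N - r = Suc (n - r)" by (simp add: Suc_diff_le)
    have i1: "ipoch (n - r) = (1 - q ^ (?N - r)) * ipoch (?N - r)" unfolding s by (rule ipoch_Suc)
    have i2: "ipoch (n + r) = (1 - q ^ (?N + r)) * ipoch (?N + r)" using ipoch_Suc[of "n + r"] by simp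
    have "?N = (?N - r) + r" "?N + r = (?N - r) + r + r" using r by simp_all
    then have q1: "q ^ ?N = q ^ (?N - r) * q ^ r" and q2: "q ^ (?N + r) = q ^ (?N - r) * q ^ r * q ^ r" by (metis power_add)+
    have alg: "(1 + a * b)\<^sup>2 * (x * u * v) = x * ((1 - a) * u) * ((1 - a * b * b) * v) + x * a * (1 + b)\<^sup>2 * u * v"
      for a b x u v :: "real fps" by (simp add: power2_eq_square algebra_simps)
    have "(1 + q ^ ?N)\<^sup>2 * (f_alpha r * ipoch (?N - r) * ipoch (?N + r)) = f_alpha r * ipoch (n - r) * ipoch (n + r)
        + f_alpha r * q ^ (?N - r) * (1 + q ^ r)\<^sup>2 * ipoch (?N - r) * ipoch (?N + r)"
      unfolding i1 i2 q2 q1 by (rule alg)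
    then show ?thesis using True by (simp only: add_0_right if_True)
  next
    case False
    then have "r = ?N" using r by simp
    then show ?thesis by (simp add: mult_ac)
  qed
  have "(1 + q ^ ?N)\<^sup>2 * (\<Sum>r\<le>?N. f_alpha r * ipoch (?N - r) * ipoch (?N + r + 0))
    = (\<Sum>r\<le>?N. (if r \<le> n then f_alpha r * ipoch (n - r) * ipoch (n + r + 0) else 0) + 4 * q ^ ?N * f_unit ?N r)"
    unfolding sum_distrib_left by (rule sum.cong) (simp_all only: split w atMost_iff)
  also have "\<dots> = (\<Sum>r\<le>?N. if r \<le> n then f_alpha r * ipoch (n - r) * ipoch (n + r + 0) else 0)"
    unfolding sum.distrib sum_distrib_left[symmetric] unit by (simp only: mult_zero_right add_0_right)
  also have "\<dots> = f_beta n"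
    unfolding Suc.IH by (rule sum.mono_neutral_cong_right) auto
  finally have eq: "(1 + q ^ ?N)\<^sup>2 * (\<Sum>r\<le>?N. f_alpha r * ipoch (?N - r) * ipoch (?N + r + 0)) = f_beta n" .
  have "f_beta ?N = inverse ((\<Prod>k = 1..n. (1 + q ^ k)\<^sup>2) * (1 + q ^ ?N)\<^sup>2)"
    unfolding f_beta_def by (subst prod.nat_ivl_Suc') (simp_all only: mult.commute le_add1 plus_1_eq_Suc Suc_le_mono le0 One_nat_def)
  then have b: "f_beta ?N = inverse ((1 + q ^ ?N)\<^sup>2) * f_beta n"
    unfolding f_beta_def by (simp only: fps_inverse_mult mult.commute)
  have "(1 + q ^ ?N)\<^sup>2 * inverse ((1 + q ^ ?N)\<^sup>2) = 1"
    by (rule inverse_mult_eq_1') (use q_power_nth_0[of 1] in \<open>simp add: fps_nth_power_0\<close>)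
  then have inv: "inverse ((1 + q ^ ?N)\<^sup>2) * ((1 + q ^ ?N)\<^sup>2 * y) = y" for y
    by (metis mult.assoc mult.commute mult_1)
  show ?case unfolding b eq[symmetric] by (rule inv)
qed

end

section \<open>The Bailey pair for \<omega>\<close>

locale euler_product_sqrt = euler_product +
  fixes x :: "real fps"
  assumes x_sq: "x * x = q" and x_nth_0: "fps_nth x 0 = 0"
begin

definition w_alpha :: "nat \<Rightarrow> real fps" where
  "w_alpha r = (-1) ^ r * q ^ tri r * (1 + x * q ^ r) * inverse (1 - x * q ^ r)"

definition w_beta :: "nat \<Rightarrow> real fps" where
  "w_beta n = inverse (\<Prod>k = 0..n. (1 - x * q ^ k)\<^sup>2)"

lemma one_minus_inverse: "(1 - x * q ^ r) * inverse (1 - x * q ^ r) = 1"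
  by (rule inverse_mult_eq_1') (simp add: x_nth_0)

text \<open>Summands of the unit Bailey pair relative to \<open>q\<close>, in the normalisation of
  \<open>bailey_lemma\<close>.\<close>

definition w_unit :: "nat \<Rightarrow> nat \<Rightarrow> real fps" where
  "w_unit n r = (-1) ^ r * q ^ tri (r - 1) * (1 - q * q ^ r * q ^ r) * ipoch (n - r) * ipoch (n + r + 1)"

lemma w_unit_sum:
  "R \<le> n \<Longrightarrow> (1 - q ^ n) * (\<Sum>r\<le>R. w_unit n r)
     = (-1) ^ R * q ^ tri R * (1 - q ^ Suc R) * (1 - q ^ (n - R)) * ipoch (n - R) * ipoch (n + R + 1)"
proof (induction R)
  case (Suc R)
  then have IH: "(1 - q ^ n) * (\<Sum>r\<le>R. w_unit n r)
     = (-1) ^ R * q ^ tri R * (1 - q ^ Suc R) * (1 - q ^ (n - R)) * ipoch (n - R) * ipoch (n + R + 1)" by simp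
  have n1: "n - R = Suc (n - Suc R)" and n2: "n = (n - Suc R) + Suc R" and n3: "n + Suc R + 1 = (n - Suc R) + Suc R + Suc R + 1"
    using Suc.prems by simp_all
  have i1: "(1 - q ^ (n - R)) * ipoch (n - R) = ipoch (n - Suc R)" unfolding n1 ipoch_Suc[of "n - Suc R"] ..
  have i2: "ipoch (n + R + 1) = (1 - q ^ (n + Suc R + 1)) * ipoch (n + Suc R + 1)" using ipoch_Suc[of "n + R + 1"] by simp
  have q1: "q ^ n = q ^ (n - Suc R) * q ^ Suc R" using n2 by (metis power_add)
  have q2: "q ^ (n + Suc R + 1) = q ^ (n - Suc R) * q ^ Suc R * q ^ Suc R * q" using n3 by (metis power_add power_one_right)
  have alg: "s * t * (1 - b) * u * ((1 - a * b * b * c) * v) + (1 - a * b) * ((- 1 * s) * t * (1 - c * b * b) * u * v)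
     = (- 1 * s) * (t * b) * (1 - c * b) * (1 - a) * u * v" for s t u v a b c :: "real fps" by (simp add: algebra_simps)
  have wS: "w_unit n (Suc R) = (- 1 * (-1) ^ R) * q ^ tri R * (1 - q * q ^ Suc R * q ^ Suc R) * ipoch (n - Suc R) * ipoch (n + Suc R + 1)"
    unfolding w_unit_def by (simp only: diff_Suc_1 power_Suc[of "-1"])
  have "(1 - q ^ n) * (\<Sum>r\<le>Suc R. w_unit n r)
    = (-1) ^ R * q ^ tri R * (1 - q ^ Suc R) * ((1 - q ^ (n - R)) * ipoch (n - R)) * ipoch (n + R + 1) + (1 - q ^ n) * w_unit n (Suc R)"
    unfolding sum.atMost_Suc distrib_left IH by (simp only: mult.assoc)
  also have "\<dots> = (-1) ^ R * q ^ tri R * (1 - q ^ Suc R) * ipoch (n - Suc R) * ((1 - q ^ (n - Suc R) * q ^ Suc R * q ^ Suc R * q) * ipoch (n + Suc R + 1))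
     + (1 - q ^ (n - Suc R) * q ^ Suc R) * ((- 1 * (-1) ^ R) * q ^ tri R * (1 - q * q ^ Suc R * q ^ Suc R) * ipoch (n - Suc R) * ipoch (n + Suc R + 1))"
    by (simp only: i1 i2 q2 q1 wS)
  also have "\<dots> = (- 1 * (-1) ^ R) * (q ^ tri R * q ^ Suc R) * (1 - q * q ^ Suc R) * (1 - q ^ (n - Suc R)) * ipoch (n - Suc R) * ipoch (n + Suc R + 1)"
    by (rule alg)
  finally show ?case by (simp only: tri.simps power_add power_Suc[of "-1"] power_Suc[of q "Suc R"])
qed (simp add: w_unit_def mult_ac)

text \<open>As for \<open>f_pair\<close>, now with
  \<open>(1 - xab)^2 = (1 - a)(1 - x^2 ab^2) + a(1 - xb)^2\<close>. In the second part one factor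
  \<open>1 - x q^r\<close> clears the denominator, and the other makes \<open>1 - q^(2r+1)\<close>
  out of the numerator \<open>1 + x q^r\<close>, since \<open>x^2 = q\<close>.\<close>

lemma w_pair: "w_beta n = (\<Sum>r\<le>n. w_alpha r * ipoch (n - r) * ipoch (n + r + 1))"
proof (induction n)
  case 0
  have i: "(1 - x * x) * ipoch 1 = 1" using ipoch_Suc[of 0] by (simp add: x_sq)
  have 1: "(1 - x) * inverse (1 - x) = 1" using one_minus_inverse[of 0] by simp
  have "(1 + x) * ipoch 1 = ((1 - x) * inverse (1 - x)) * ((1 + x) * ipoch 1)" unfolding 1 by simp
  also have "\<dots> = inverse (1 - x) * ((1 - x * x) * ipoch 1)" by (simp add: algebra_simps)
  finally have 2: "(1 + x) * ipoch 1 = inverse (1 - x)" unfolding i by simp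
  have "w_alpha 0 * ipoch 0 * ipoch 1 = inverse (1 - x) * ((1 + x) * ipoch 1)"
    unfolding w_alpha_def by (simp add: mult_ac)
  also have "\<dots> = w_beta 0" unfolding 2 w_beta_def by (simp add: power2_eq_square fps_inverse_mult)
  finally show ?case by simp
next
  case (Suc n)
  let ?N = "Suc n"
  have "(1 - q ^ ?N) * (\<Sum>r\<le>?N. w_unit ?N r) = 0"
    unfolding w_unit_sum[OF order.refl] by simp
  then have unit: "(\<Sum>r\<le>?N. w_unit ?N r) = 0" using one_minus_q_nonzero[of ?N] by (metis mult_eq_0_iff zero_less_Suc)
  have w: "w_alpha r * q ^ (?N - r) * (1 - x * q ^ r)\<^sup>2 * ipoch (?N - r) * ipoch (?N + r + 1) = q ^ ?N * w_unit ?N r" if r: "r \<le> ?N" for r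
  proof -
    have e: "q ^ tri r * q ^ (?N - r) = q ^ ?N * q ^ tri (r - 1)"
      unfolding power_add[symmetric] by (rule arg_cong[where f = "\<lambda>n. q ^ n"]) (use r in \<open>cases r; simp\<close>)
    have "w_alpha r * q ^ (?N - r) * (1 - x * q ^ r)\<^sup>2 * ipoch (?N - r) * ipoch (?N + r + 1)
      = (-1) ^ r * (q ^ tri r * q ^ (?N - r)) * ((1 - x * q ^ r) * inverse (1 - x * q ^ r)) * ((1 + x * q ^ r) * (1 - x * q ^ r)) * ipoch (?N - r) * ipoch (?N + r + 1)"
      unfolding w_alpha_def power2_eq_square by (simp only: mult_ac)
    also have "(1 + x * q ^ r) * (1 - x * q ^ r) = 1 - (x * x) * q ^ r * q ^ r" by (simp add: algebra_simps)
    also have "(-1) ^ r * (q ^ tri r * q ^ (?N - r)) * ((1 - x * q ^ r) * inverse (1 - x * q ^ r)) * (1 - (x * x) * q ^ r * q ^ r) * ipoch (?N - r) * ipoch (?N + r + 1)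
      = q ^ ?N * w_unit ?N r"
      unfolding e one_minus_inverse w_unit_def x_sq by (simp only: mult_ac mult_1_left mult_1_right)
    finally show ?thesis .
  qed
  have split: "(1 - x * q ^ ?N)\<^sup>2 * (w_alpha r * ipoch (?N - r) * ipoch (?N + r + 1))
      = (if r \<le> n then w_alpha r * ipoch (n - r) * ipoch (n + r + 1) else 0)
        + w_alpha r * q ^ (?N - r) * (1 - x * q ^ r)\<^sup>2 * ipoch (?N - r) * ipoch (?N + r + 1)" if r: "r \<le> ?N" for r
  proof (cases "r \<le> n")
    case True
    then have s: "?N - r = Suc (n - r)" by (simp add: Suc_diff_le)
    have i1: "ipoch (n - r) = (1 - q ^ (?N - r)) * ipoch (?N - r)" unfolding s by (rule ipoch_Suc)
    have i2: "ipoch (n + r + 1) = (1 - q ^ (?N + r + 1)) * ipoch (?N + r + 1)" using ipoch_Suc[of "n + r + 1"] by simp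
    have e1: "?N = (?N - r) + r" and e2: "?N + r + 1 = (?N - r) + r + r + 1" using r by simp_all
    have q1: "q ^ ?N = q ^ (?N - r) * q ^ r" using e1 by (metis power_add)
    have q2: "q ^ (?N + r + 1) = q ^ (?N - r) * q ^ r * q ^ r * (x * x)"
      unfolding x_sq using e2 by (metis power_add power_one_right)
    have alg: "(1 - x * (a * b))\<^sup>2 * (y * u * v) = y * ((1 - a) * u) * ((1 - a * b * b * (x * x)) * v) + y * a * (1 - x * b)\<^sup>2 * u * v"
      for a b y u v :: "real fps" by (simp add: power2_eq_square algebra_simps)
    have "(1 - x * q ^ ?N)\<^sup>2 * (w_alpha r * ipoch (?N - r) * ipoch (?N + r + 1)) = w_alpha r * ipoch (n - r) * ipoch (n + r + 1)
        + w_alpha r * q ^ (?N - r) * (1 - x * q ^ r)\<^sup>2 * ipoch (?N - r) * ipoch (?N + r + 1)"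
      unfolding i1 i2 q2 q1 by (rule alg)
    then show ?thesis using True by (simp only: if_True)
  next
    case False
    then have "r = ?N" using r by simp
    then show ?thesis by (simp add: mult_ac)
  qed
  have "(1 - x * q ^ ?N)\<^sup>2 * (\<Sum>r\<le>?N. w_alpha r * ipoch (?N - r) * ipoch (?N + r + 1))
    = (\<Sum>r\<le>?N. (if r \<le> n then w_alpha r * ipoch (n - r) * ipoch (n + r + 1) else 0) + q ^ ?N * w_unit ?N r)"
    unfolding sum_distrib_left by (rule sum.cong) (simp_all only: split w atMost_iff)
  also have "\<dots> = (\<Sum>r\<le>?N. if r \<le> n then w_alpha r * ipoch (n - r) * ipoch (n + r + 1) else 0)"
    unfolding sum.distrib sum_distrib_left[symmetric] unit by (simp only: mult_zero_right add_0_right)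
  also have "\<dots> = w_beta n"
    unfolding Suc.IH by (rule sum.mono_neutral_cong_right) auto
  finally have eq: "(1 - x * q ^ ?N)\<^sup>2 * (\<Sum>r\<le>?N. w_alpha r * ipoch (?N - r) * ipoch (?N + r + 1)) = w_beta n" .
  have "w_beta ?N = inverse ((\<Prod>k = 0..n. (1 - x * q ^ k)\<^sup>2) * (1 - x * q ^ ?N)\<^sup>2)"
    unfolding w_beta_def by (simp only: prod.atLeast0_atMost_Suc)
  then have b: "w_beta ?N = inverse ((1 - x * q ^ ?N)\<^sup>2) * w_beta n"
    unfolding w_beta_def by (simp only: fps_inverse_mult mult.commute)
  have "(1 - x * q ^ ?N)\<^sup>2 * inverse ((1 - x * q ^ ?N)\<^sup>2) = 1"
    by (rule inverse_mult_eq_1') (simp add: fps_nth_power_0 x_nth_0)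
  then have inv: "inverse ((1 - x * q ^ ?N)\<^sup>2) * ((1 - x * q ^ ?N)\<^sup>2 * y) = y" for y
    by (metis mult.assoc mult.commute mult_1)
  show ?case unfolding b eq[symmetric] by (rule inv)
qed

end

section \<open>Double sums for the mock theta functions\<close>

text \<open>Arbitrary index sets let double series and theta series be multiplied without ordering
  their terms. A coefficient with an infinite fiber would silently be 0, hence the condition
  \<open>fin_fibers\<close>.\<close>

definition gf :: "('a \<Rightarrow> nat) \<Rightarrow> ('a \<Rightarrow> real) \<Rightarrow> 'a set \<Rightarrow> real fps" where
  "gf e c I = Abs_fps (\<lambda>n. \<Sum>i\<in>{i \<in> I. e i = n}. c i)"

definition fin_fibers :: "('a \<Rightarrow> nat) \<Rightarrow> 'a set \<Rightarrow> bool" where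
  "fin_fibers e I \<longleftrightarrow> (\<forall>n. finite {i \<in> I. e i \<le> n})"

lemma gf_nth: "fps_nth (gf e c I) n = (\<Sum>i\<in>{i \<in> I. e i = n}. c i)"
  by (simp add: gf_def)

lemma gf_mult_nth:
  assumes "fin_fibers e I"
  shows "fps_nth (gf e c I * F) n = (\<Sum>i\<in>{i \<in> I. e i \<le> n}. c i * fps_nth F (n - e i))"
proof -
  let ?S = "{i \<in> I. e i \<le> n}"
  have "fps_nth (gf e c I * F) n = (\<Sum>k\<in>{0..n}. \<Sum>i\<in>{i \<in> ?S. e i = k}. c i * fps_nth F (n - e i))"
    unfolding fps_mult_nth gf_nth sum_distrib_right by (intro sum.cong) auto
  also have "\<dots> = (\<Sum>i\<in>?S. c i * fps_nth F (n - e i))"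
    using assms by (intro sum.group) (auto simp: fin_fibers_def)
  finally show ?thesis .
qed

lemma gf_mult_gf_nth:
  assumes "fin_fibers e I" "fin_fibers e' J"
  shows "fps_nth (gf e c I * gf e' c' J) n
    = (\<Sum>(i, j)\<in>{(i, j). i \<in> I \<and> j \<in> J \<and> e i + e' j = n}. c i * c' j)"
proof -
  have "fps_nth (gf e c I * gf e' c' J) n = (\<Sum>i\<in>{i \<in> I. e i \<le> n}. \<Sum>j\<in>{j \<in> J. e' j = n - e i}. c i * c' j)"
    unfolding gf_mult_nth[OF assms(1)] gf_nth sum_distrib_left ..
  also have "\<dots> = (\<Sum>(i, j)\<in>Sigma {i \<in> I. e i \<le> n} (\<lambda>i. {j \<in> J. e' j = n - e i}). c i * c' j)"
  proof (rule sum.Sigma)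
    show "finite {i \<in> I. e i \<le> n}" using assms(1) by (simp add: fin_fibers_def)
    show "\<forall>i\<in>{i \<in> I. e i \<le> n}. finite {j \<in> J. e' j = n - e i}"
      using assms(2) unfolding fin_fibers_def by (auto intro: finite_subset[rotated])
  qed
  also have "Sigma {i \<in> I. e i \<le> n} (\<lambda>i. {j \<in> J. e' j = n - e i}) = {(i, j). i \<in> I \<and> j \<in> J \<and> e i + e' j = n}"
    by auto
  finally show ?thesis .
qed

lemma gf_agree_sum:
  assumes "finite J" "J \<subseteq> I" "\<And>i. i \<in> I - J \<Longrightarrow> e i > N"
  shows "fps_agree N (gf e c I) (\<Sum>i\<in>J. fps_const (c i) * fps_X ^ e i)"
  unfolding fps_agree_def
proof (intro allI impI)
  fix n assume n: "n \<le> N"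
  have "fps_nth (\<Sum>i\<in>J. fps_const (c i) * fps_X ^ e i) n = (\<Sum>i\<in>J. if e i = n then c i else 0)"
    unfolding fps_sum_nth by (intro sum.cong) (auto simp: fps_X_power_nth)
  also have "\<dots> = (\<Sum>i\<in>{i \<in> I. e i = n}. c i)"
    using assms n by (intro sum.mono_neutral_cong_right) (auto, (meson DiffI linorder_not_less)?)
  finally show "fps_nth (gf e c I) n = fps_nth (\<Sum>i\<in>J. fps_const (c i) * fps_X ^ e i) n"
    by (simp add: gf_nth)
qed

lemma fps_eqI_agree: "(\<And>N. fps_agree N a b) \<Longrightarrow> a = b"
  by (auto simp: fps_agree_def fps_eq_iff)

lemma fps_nth_compose_X_square:
  fixes F :: "real fps"
  shows "fps_nth (F oo fps_X ^ 2) n = (if even n then fps_nth F (n div 2) else 0)"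
proof -
  have "fps_nth (F oo fps_X ^ 2) n = (\<Sum>i = 0..n. if n = 2 * i then fps_nth F i else 0)"
    unfolding fps_compose_nth power_mult[symmetric] by (intro sum.cong refl) (simp add: fps_X_power_nth)
  also have "\<dots> = (if even n then fps_nth F (n div 2) else 0)"
  proof (cases "even n")
    case True
    then obtain k where k: "n = 2 * k" by blast
    have "(\<Sum>i = 0..n. if n = 2 * i then fps_nth F i else 0) = (\<Sum>i = 0..n. if i = k then fps_nth F i else 0)"
      unfolding k by (intro sum.cong) auto
    then show ?thesis unfolding k by simp
  next
    case False
    have "(\<Sum>i = 0..n. if n = 2 * i then fps_nth F i else 0) = 0"
      by (rule sum.neutral) (use False in auto)
    then show ?thesis using False by simp
  qed
  finally show ?thesis .
qed

lemma gf_compose: "gf e c I oo fps_X ^ 2 = gf (\<lambda>i. 2 * e i) c I"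
proof (rule fps_ext)
  fix n
  show "fps_nth (gf e c I oo fps_X ^ 2) n = fps_nth (gf (\<lambda>i. 2 * e i) c I) n"
  proof (cases "even n")
    case True
    then obtain k where "n = 2 * k" by blast
    then show ?thesis by (simp add: fps_nth_compose_X_square gf_nth)
  next
    case False
    then have "{i \<in> I. 2 * e i = n} = {}" by auto
    then show ?thesis using False by (simp only: fps_nth_compose_X_square gf_nth if_False sum.empty)
  qed
qed

interpretation q1: euler_product 1 fps_X
  by unfold_locales simp_all

text \<open>The denominators of \<omega> contain the odd powers \<open>X (X^2)^k\<close>, so the
  base is \<open>q = X^2\<close> with square root \<open>X\<close>.\<close>

interpretation q2: euler_product_sqrt 2 "fps_X ^ 2" fps_X
  by unfold_locales (simp_all add: power2_eq_square)

text \<open>The pentagonal series serves as definition of the infinite product;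
  \<open>poch_agree\<close> shows that it is the limit of the finite products.\<close>

definition euler_fps :: "nat \<Rightarrow> real fps" where
  "euler_fps d = gf (\<lambda>j. d * pent j) pent_sign UNIV"

lemma (in euler_product) poch_agree: "fps_agree n (poch n) (euler_fps d)"
proof -
  have "fps_agree n (euler_fps d) (\<Sum>j\<in>{-int n..int n}. fps_const (pent_sign j) * fps_X ^ (d * pent j))"
    unfolding euler_fps_def
  proof (rule gf_agree_sum)
    fix j :: int assume "j \<in> UNIV - {-int n..int n}"
    then have "n < nat \<bar>j\<bar>" by auto
    also have "\<dots> \<le> 1 * pent j" using pent_ge by simp
    also have "\<dots> \<le> d * pent j" using d_pos by (intro mult_right_mono) auto
    finally show "n < d * pent j" .
  qed auto
  also have "\<dots> = shanks n"
  proof -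
    have "fps_X ^ (d * k) = q ^ k" for k unfolding q_def power_mult ..
    then show ?thesis by (simp only: shanks_pent)
  qed
  finally have "fps_agree n (euler_fps d) (shanks n)" .
  then show ?thesis using shanks_agree fps_agree_sym fps_agree_trans by blast
qed

lemma suminf_fps_agree:
  fixes g :: "nat \<Rightarrow> real fps"
  assumes low: "\<And>n i. i < n \<Longrightarrow> fps_nth (g n) i = 0"
  shows "fps_agree N (\<Sum>n. g n) (\<Sum>n\<le>N. g n)"
proof -
  define L where "L = Abs_fps (\<lambda>i. \<Sum>n\<le>i. fps_nth (g n) i)"
  have part: "fps_nth (\<Sum>n<M. g n) i = fps_nth L i" if "M > i" for M i
  proof -
    have "fps_nth (\<Sum>n<M. g n) i = (\<Sum>n<M. fps_nth (g n) i)"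
      by (simp add: fps_sum_nth)
    also have "\<dots> = (\<Sum>n\<le>i. fps_nth (g n) i)"
      by (rule sum.mono_neutral_right) (use that low in auto)
    finally show ?thesis
      by (simp add: L_def)
  qed
  have "(\<lambda>M. \<Sum>n<M. g n) \<longlonglongrightarrow> L"
    by (rule tendsto_fpsI) (rule eventually_mono[OF eventually_gt_at_top], erule part)
  then have "(\<Sum>n. g n) = L" by (intro sums_unique[symmetric]) (simp add: sums_def)
  then show ?thesis using part[of _ "Suc N"] by (simp add: fps_agree_def lessThan_Suc_atMost)
qed

lemma mock_f_agree: "fps_agree N mock_f (\<Sum>n\<le>N. fps_X ^ (n * (n + 0)) * q1.f_beta n)"
proof -
  have nz: "fps_nth (\<Prod>k = 1..n. (1 + fps_X ^ k) ^ 2 :: real fps) 0 \<noteq> 0" for n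
  proof -
    have "fps_nth (\<Prod>k = 1..n. (1 + fps_X ^ k) ^ 2 :: real fps) 0 = 1"
      by (auto simp: fps_prod_nth' fps_nth_power_0 power_0_left intro!: prod.neutral)
    then show ?thesis by simp
  qed
  have t: "mock_f_term n = fps_X ^ (n * (n + 0)) * q1.f_beta n" for n
    unfolding mock_f_term_def q1.f_beta_def using nz[of n] by (simp add: fps_divide_unit power2_eq_square)
  have low: "fps_nth (mock_f_term (Suc n)) i = 0" if "i \<le> n" for n i
  proof -
    have "i < Suc n * (Suc n + 0)" using that by simp
    then show ?thesis unfolding t by (simp only: fps_X_power_mult_nth if_True)
  qed
  have "fps_agree N mock_f (1 + (\<Sum>n\<le>N. mock_f_term (Suc n)))"
    unfolding mock_f_def by (intro fps_agree_add fps_agree_refl suminf_fps_agree low) simp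
  \<comment> \<open>The last summand has order \<open>(N+1)^2\<close> and may be dropped, which
    aligns the index with the sum from 0.\<close>
  also have "fps_agree N (1 + (\<Sum>n\<le>N. mock_f_term (Suc n))) (1 + (\<Sum>n<N. mock_f_term (Suc n)))"
    using low by (auto simp: fps_agree_def fps_sum_nth simp flip: lessThan_Suc_atMost)
  also have "1 + (\<Sum>n<N. mock_f_term (Suc n)) = (\<Sum>n\<le>N. mock_f_term n)"
    unfolding sum.atMost_shift by (simp add: t q1.f_beta_def)
  finally show ?thesis unfolding t .
qed

lemma mock_omega_agree: "fps_agree N mock_omega (\<Sum>n\<le>N. (fps_X ^ 2) ^ (n * (n + 1)) * q2.w_beta n)"
proof -
  have p: "(\<Prod>k = 0..n. (1 - fps_X ^ (2 * k + 1)) ^ 2 :: real fps) = (\<Prod>k = 0..n. (1 - fps_X * (fps_X ^ 2) ^ k) ^ 2)" for n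
    by (intro prod.cong) (simp_all add: power_mult)
  have nz: "fps_nth (\<Prod>k = 0..n. (1 - fps_X ^ (2 * k + 1)) ^ 2 :: real fps) 0 \<noteq> 0" for n
    by (simp add: fps_prod_nth' fps_nth_power_0)
  have t: "mock_omega_term n = (fps_X ^ 2) ^ (n * (n + 1)) * q2.w_beta n" for n
  proof -
    have e: "2 * n ^ 2 + 2 * n = 2 * (n * (n + 1))" by (simp add: power2_eq_square)
    show ?thesis
      unfolding mock_omega_term_def fps_divide_unit[OF nz] q2.w_beta_def unfolding p e power_mult ..
  qed
  show ?thesis unfolding t[symmetric] mock_omega_def
  proof (rule suminf_fps_agree)
    fix n i :: nat assume "i < n"
    then have "i < 2 * (n * (n + 1))" by simp
    then show "fps_nth (mock_omega_term n) i = 0"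
      unfolding t power_mult[symmetric] by (simp only: fps_X_power_mult_nth if_True)
  qed
qed

text \<open>Watson's series for \<open>f\<close>, with \<open>1 / (1 + q^r)\<close> expanded
  geometrically.\<close>

lemma euler_mock_f:
  "euler_fps 1 * mock_f = 1 + 4 * gf (\<lambda>(r, j). r * r + tri r + r * j) (\<lambda>(r, j). (-1) ^ (r + j)) ({1..} \<times> UNIV)"
proof (rule fps_eqI_agree)
  fix N
  let ?e = "\<lambda>(r, j). r * r + tri r + r * j" and ?c = "\<lambda>(r, j). (-1) ^ (r + j) :: real"
  have "fps_agree N (euler_fps 1 * mock_f) (\<Sum>r\<le>N. fps_X ^ (r * (r + 0)) * q1.f_alpha r)"
    by (rule q1.bailey_limit[OF q1.f_pair mock_f_agree q1.poch_agree])
  also have "fps_agree N (\<Sum>r\<le>N. fps_X ^ (r * (r + 0)) * q1.f_alpha r)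
      (\<Sum>r\<le>N. if r = 0 then 1 else 4 * (\<Sum>j\<le>N. fps_const (?c (r, j)) * fps_X ^ ?e (r, j)))"
  proof (rule fps_agree_sum)
    fix r
    show "fps_agree N (fps_X ^ (r * (r + 0)) * q1.f_alpha r)
      (if r = 0 then 1 else 4 * (\<Sum>j\<le>N. fps_const (?c (r, j)) * fps_X ^ ?e (r, j)))"
    proof (cases "r = 0")
      case False
      then have r: "r > 0" by simp
      have y: "- (fps_X ^ r) = fps_const (-1 :: real) * fps_X ^ r"
        by (simp add: fps_const_neg[symmetric] del: fps_const_neg)
      have "(1 - - (fps_X ^ r)) * inverse (1 + fps_X ^ r) = (1 :: real fps)"
        using q1.one_plus_inverse[OF r] by simp
      from fps_agree_geometric[OF y r this, of N]
      have "fps_agree N (4 * (-1) ^ r * fps_X ^ (r * r + tri r) * inverse (1 + fps_X ^ r))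
         (4 * (-1) ^ r * fps_X ^ (r * r + tri r) * (\<Sum>j\<le>N. (- (fps_X ^ r)) ^ j))"
        by (rule fps_agree_mult[OF fps_agree_refl])
      also have "4 * (-1) ^ r * fps_X ^ (r * r + tri r) * (\<Sum>j\<le>N. (- (fps_X ^ r)) ^ j)
        = 4 * (\<Sum>j\<le>N. fps_const (?c (r, j)) * fps_X ^ ?e (r, j))"
        unfolding sum_distrib_left
      proof (rule sum.cong)
        fix j
        have c: "fps_const ((-1 :: real) ^ (r + j)) = (-1) ^ r * (-1) ^ j"
        proof -
          have "fps_const (-1 :: real) = -1" by (simp add: fps_const_neg[symmetric] del: fps_const_neg)
          moreover have "fps_const ((-1 :: real) ^ (r + j)) = fps_const (-1) ^ (r + j)"
            by (rule fps_const_power[symmetric])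
          ultimately show ?thesis by (simp only: power_add)
        qed
        have m: "(- (fps_X ^ r :: real fps)) ^ j = (-1) ^ j * fps_X ^ (r * j)" for j :: nat
          unfolding power_mult by (rule power_minus)
        show "4 * (-1) ^ r * fps_X ^ (r * r + tri r) * (- (fps_X ^ r)) ^ j = 4 * (fps_const (?c (r, j)) * fps_X ^ ?e (r, j))"
          unfolding prod.case unfolding c m unfolding power_add by (simp only: mult_ac)
      qed simp
      finally show ?thesis using False unfolding q1.f_alpha_def power_add by (simp only: if_False add_0_right mult_ac)
    qed (simp add: q1.f_alpha_def)
  qed
  also have "(\<Sum>r\<le>N. if r = 0 then 1 else 4 * (\<Sum>j\<le>N. fps_const (?c (r, j)) * fps_X ^ ?e (r, j)))
    = 1 + (\<Sum>r = 1..N. 4 * (\<Sum>j\<le>N. fps_const (?c (r, j)) * fps_X ^ ?e (r, j)))"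
  proof -
    have "{..N} = insert 0 {1..N}" by auto
    then show ?thesis by simp
  qed
  also have "\<dots> = 1 + 4 * (\<Sum>i\<in>{1..N} \<times> {..N}. fps_const (?c i) * fps_X ^ ?e i)"
    unfolding sum_distrib_left[symmetric] sum.cartesian_product by (simp add: split_beta)
  also have "fps_agree N \<dots> (1 + 4 * gf ?e ?c ({1..} \<times> UNIV))"
  proof (intro fps_agree_add fps_agree_mult fps_agree_refl fps_agree_sym[OF gf_agree_sum], goal_cases)
    case (3 i)
    obtain r j where i: "i = (r, j)" by (cases i)
    have r: "r \<ge> 1" and rj: "r > N \<or> j > N" using 3 unfolding i by auto
    have "1 * j \<le> r * j" "1 * r \<le> r * r" using r by (intro mult_right_mono; simp)+
    then have "N < r * r + tri r + r * j" using rj by linarith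
    then show ?case unfolding i by simp
  qed auto
  finally show "fps_agree N (euler_fps 1 * mock_f) (1 + 4 * gf ?e ?c ({1..} \<times> UNIV))" .
qed

text \<open>The quotient in \<open>w_alpha\<close> is
  \<open>(1 + y) / (1 - y) = 1 + 2 (y + y^2 + ...)\<close> with \<open>y = q^(2r+1)\<close>, which
  explains the different coefficient at \<open>j = 0\<close>.\<close>

lemma euler_mock_omega:
  "euler_fps 2 * mock_omega = gf (\<lambda>(r, j). 3 * (r * (r + 1)) + (2 * r + 1) * j)
     (\<lambda>(r, j). (-1) ^ r * (if j = 0 then 1 else 2)) UNIV"
proof (rule fps_eqI_agree)
  fix N
  let ?e = "\<lambda>(r, j). 3 * (r * (r + 1)) + (2 * r + 1) * j" and ?c = "\<lambda>(r, j :: nat). (-1) ^ r * (if j = 0 then 1 else 2) :: real"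
  have "fps_agree N (euler_fps 2 * mock_omega) (\<Sum>r\<le>N. (fps_X ^ 2) ^ (r * (r + 1)) * q2.w_alpha r)"
    by (rule q2.bailey_limit[OF q2.w_pair mock_omega_agree q2.poch_agree])
  also have "fps_agree N \<dots> (\<Sum>r\<le>N. \<Sum>j\<le>N. fps_const (?c (r, j)) * fps_X ^ ?e (r, j))"
  proof (rule fps_agree_sum)
    fix r
    let ?y = "fps_X ^ (2 * r + 1) :: real fps" and ?z = "inverse (1 - fps_X * (fps_X ^ 2) ^ r) :: real fps"
    have y1: "fps_X * (fps_X ^ 2) ^ r = ?y" by (simp add: power_mult)
    have y: "?y = fps_const 1 * fps_X ^ (2 * r + 1)" by simp
    have z: "(1 - ?y) * ?z = 1" using q2.one_minus_inverse[of r] unfolding y1 .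
    have "fps_agree N ?z (\<Sum>j\<le>N. ?y ^ j)" by (rule fps_agree_geometric[OF y _ z]) simp
    then have "fps_agree N (2 * ?z + -1) (2 * (\<Sum>j\<le>N. ?y ^ j) + -1)"
      by (intro fps_agree_add fps_agree_mult) simp_all
    moreover have "(1 + ?y) * ?z = 2 * ?z + -1" using z by (simp add: algebra_simps)
    moreover have "2 * (\<Sum>j\<le>N. ?y ^ j) + -1 = (\<Sum>j\<le>N. fps_const (if j = 0 then 1 else 2) * ?y ^ j)"
    proof -
      have "{..N} = insert 0 {1..N}" by auto
      then show ?thesis by (simp add: sum_distrib_left distrib_left numeral_fps_const)
    qed
    ultimately have "fps_agree N ((1 + ?y) * ?z) (\<Sum>j\<le>N. fps_const (if j = 0 then 1 else 2) * ?y ^ j)" by (simp only:)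
    then have "fps_agree N ((-1) ^ r * fps_X ^ (3 * (r * (r + 1))) * ((1 + ?y) * ?z))
        ((-1) ^ r * fps_X ^ (3 * (r * (r + 1))) * (\<Sum>j\<le>N. fps_const (if j = 0 then 1 else 2) * ?y ^ j))"
      by (rule fps_agree_mult[OF fps_agree_refl])
    also have "(-1) ^ r * fps_X ^ (3 * (r * (r + 1))) * (\<Sum>j\<le>N. fps_const (if j = 0 then 1 else 2) * ?y ^ j)
       = (\<Sum>j\<le>N. fps_const (?c (r, j)) * fps_X ^ ?e (r, j))"
      unfolding sum_distrib_left
    proof (rule sum.cong)
      fix j
      have c: "fps_const (?c (r, j)) = (-1) ^ r * fps_const (if j = 0 then 1 else 2)"
        by (simp add: fps_const_mult[symmetric] fps_const_power[symmetric] fps_const_neg[symmetric] del: fps_const_neg fps_const_power fps_const_mult)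
      show "(-1) ^ r * fps_X ^ (3 * (r * (r + 1))) * (fps_const (if j = 0 then 1 else 2) * ?y ^ j)
        = fps_const (?c (r, j)) * fps_X ^ ?e (r, j)"
        unfolding c unfolding prod.case power_add[of _ "3 * (r * (r + 1))"] power_mult[of _ "2 * r + 1" j] by (simp only: mult_ac)
    qed simp
    finally have "fps_agree N ((-1) ^ r * fps_X ^ (3 * (r * (r + 1))) * ((1 + ?y) * ?z)) (\<Sum>j\<le>N. fps_const (?c (r, j)) * fps_X ^ ?e (r, j))" .
    moreover have "(fps_X ^ 2) ^ (r * (r + 1)) * q2.w_alpha r = (-1) ^ r * fps_X ^ (3 * (r * (r + 1))) * ((1 + ?y) * ?z)"
    proof -
      have "3 * (r * (r + 1)) = 2 * (r * (r + 1)) + 2 * tri r" using two_tri[of r] by simp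
      then have "fps_X ^ (3 * (r * (r + 1))) = (fps_X ^ 2) ^ (r * (r + 1)) * (fps_X ^ 2 :: real fps) ^ tri r"
        by (simp only: power_add power_mult)
      then show ?thesis unfolding q2.w_alpha_def y1 by (simp only: mult_ac)
    qed
    ultimately show "fps_agree N ((fps_X ^ 2) ^ (r * (r + 1)) * q2.w_alpha r) (\<Sum>j\<le>N. fps_const (?c (r, j)) * fps_X ^ ?e (r, j))"
      by (simp only:)
  qed
  also have "(\<Sum>r\<le>N. \<Sum>j\<le>N. fps_const (?c (r, j)) * fps_X ^ ?e (r, j)) = (\<Sum>i\<in>{..N} \<times> {..N}. fps_const (?c i) * fps_X ^ ?e i)"
    unfolding sum.cartesian_product by (simp add: split_beta)
  also have "fps_agree N \<dots> (gf ?e ?c UNIV)"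
  proof (rule fps_agree_sym[OF gf_agree_sum], goal_cases)
    case (3 i)
    obtain r j where i: "i = (r, j)" by (cases i)
    have rj: "r > N \<or> j > N" using 3 unfolding i by auto
    have "r \<le> 3 * (r * (r + 1))" by simp
    then show ?case using rj unfolding i by (auto simp: add_mult_distrib)
  qed auto
  finally show "fps_agree N (euler_fps 2 * mock_omega) (gf ?e ?c UNIV)" .
qed

section \<open>Products with theta series\<close>

text \<open>Completing the square: with \<open>s = 6 * j + 1\<close> the pentagonal series in
  \<open>q^2\<close> becomes a theta series in \<open>s\<close>, with sign \<open>chi4 s\<close> by
  \<open>chi4_pent\<close>.\<close>

lemma pent_square: "12 * int (2 * pent j) = (6 * j + 1)\<^sup>2 - 1"
proof -
  have "int (2 * pent j) = j * (3 * j + 1)"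
  proof (cases "j \<ge> 0")
    case True
    then obtain k where j: "j = int k" by (metis nonneg_int_cases)
    show ?thesis unfolding j pent_of_nat using arg_cong[OF two_tri[of k], of int] by (simp add: algebra_simps)
  next
    case False
    then obtain k where j: "j = - int (Suc k)" by (cases j rule: int_cases) (simp, blast)
    show ?thesis unfolding j pent_minus using arg_cong[OF two_tri[of k], of int] by (simp add: algebra_simps)
  qed
  then show ?thesis by (simp add: power2_eq_square algebra_simps)
qed

lemma fin_fibers_euler: "fin_fibers (\<lambda>j. 2 * pent j) UNIV"
  unfolding fin_fibers_def
proof
  fix n
  have "{j \<in> UNIV. 2 * pent j \<le> n} \<subseteq> {- int n..int n}"
  proof
    fix j assume "j \<in> {j \<in> UNIV. 2 * pent j \<le> n}"
    then have "nat \<bar>j\<bar> \<le> n" using pent_ge[of j] by simp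
    then show "j \<in> {- int n..int n}" by auto
  qed
  then show "finite {j \<in> UNIV. 2 * pent j \<le> n}" by (rule finite_subset) simp
qed

lemma chi4_pent: "chi4 (6 * j + 1) = pent_sign j"
proof -
  have "even j \<Longrightarrow> (6 * j + 1) mod 4 = 1" "odd j \<Longrightarrow> (6 * j + 1) mod 4 = 3" by presburger+
  then show ?thesis by (auto simp: chi4_def pent_sign_def)
qed

text \<open>This brings coefficients of a product with the Euler product into the shape of the
  right-hand sides of the three representation identities.\<close>

lemma euler_gf_nth:
  assumes "fin_fibers e J"
  shows "fps_nth (euler_fps 2 * gf e c J) n
    = (\<Sum>(s, y)\<in>{(s, y). s mod 6 = 1 \<and> y \<in> J \<and> s\<^sup>2 + 12 * int (e y) = 12 * int n + 1}. chi4 s * c y)"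
proof -
  have "fps_nth (euler_fps 2 * gf e c J) n
    = (\<Sum>(j, y)\<in>{(j, y). j \<in> UNIV \<and> y \<in> J \<and> 2 * pent j + e y = n}. pent_sign j * c y)"
    unfolding euler_fps_def by (rule gf_mult_gf_nth[OF fin_fibers_euler assms])
  also have "\<dots> = (\<Sum>(s, y)\<in>{(s, y). s mod 6 = 1 \<and> y \<in> J \<and> s\<^sup>2 + 12 * int (e y) = 12 * int n + 1}. chi4 s * c y)"
  proof (rule sum.reindex_bij_witness[of _ "\<lambda>(s, y). (s div 6, y)" "\<lambda>(j, y). (6 * j + 1, y)"], goal_cases)
    case (1 z)
    then show ?case by auto
  next
    case (2 z)
    obtain j y where z: "z = (j, y)" by (cases z)
    have "y \<in> J" "2 * pent j + e y = n" using 2 unfolding z by auto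
    moreover from this(2) have "int (2 * pent j) + int (e y) = int n" by (simp only: of_nat_add[symmetric])
    ultimately show ?case unfolding z using pent_square[of j] by simp
  next
    case (3 z)
    obtain s y where z: "z = (s, y)" by (cases z)
    have "s mod 6 = 1" using 3 unfolding z by auto
    then have "6 * (s div 6) + 1 = s" using mult_div_mod_eq[of 6 s] by simp
    then show ?case unfolding z by simp
  next
    case (4 z)
    obtain s y where z: "z = (s, y)" by (cases z)
    have *: "s mod 6 = 1" "y \<in> J" "s\<^sup>2 + 12 * int (e y) = 12 * int n + 1" using 4 unfolding z by auto
    then have s: "6 * (s div 6) + 1 = s" using mult_div_mod_eq[of 6 s] by simp
    have "int (2 * pent (s div 6)) + int (e y) = int n" using pent_square[of "s div 6"] *(3) unfolding s by linarith
    then have "2 * pent (s div 6) + e y = n" by (simp only: of_nat_add[symmetric] of_nat_eq_iff)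
    then show ?case using *(2) unfolding z by simp
  next
    case (5 z)
    then show ?case by (cases z) (simp add: chi4_pent)
  qed
  finally show ?thesis .
qed

lemma euler_fps_nonzero: "euler_fps 2 \<noteq> 0"
proof
  assume "euler_fps 2 = 0"
  then have "fps_agree 0 (q2.poch 0) 0" using q2.poch_agree[of 0] by simp
  then have "\<forall>i\<le>0. fps_nth (q2.poch 0) i = fps_nth 0 i" by (simp only: fps_agree_def)
  from spec[OF this, of 0] show False by simp
qed

lemma square_bound: "\<bar>t\<bar> \<le> (t :: int)\<^sup>2"
proof -
  have "\<bar>t\<bar> * 1 \<le> \<bar>t\<bar> * \<bar>t\<bar>" by (cases "t = 0", simp, rule mult_left_mono) linarith+
  then show ?thesis by (simp add: power2_eq_square flip: abs_mult)
qed

lemma product_bound: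
  assumes "a > 0" "b > 0" "a * b \<le> (K :: int)"
  shows "a \<le> K" "b \<le> K"
proof -
  have "a * 1 \<le> a * b" "1 * b \<le> a * b" using assms by (intro mult_mono; simp)+
  then show "a \<le> K" "b \<le> K" using assms(3) by simp_all
qed

text \<open>With \<open>t = 3 * m + 1\<close> the exponent is \<open>3 * m^2 + 2 * m\<close> and the
  weight is \<open>3 * (m + 1/3)\<close>, as in the first and third families.\<close>

definition theta3 :: "real fps" where
  "theta3 = gf (\<lambda>t. nat ((t\<^sup>2 - 1) div 3)) real_of_int {t. t mod 3 = 1}"

lemma theta3_exponent: "t mod 3 = 1 \<Longrightarrow> 3 * int (nat ((t\<^sup>2 - 1) div 3)) = t\<^sup>2 - 1"
proof -
  assume "t mod 3 = 1"
  then obtain k where t: "t = 3 * k + 1" using mult_div_mod_eq[of 3 t] by metis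
  have sq: "t\<^sup>2 - 1 = 3 * (3 * k\<^sup>2 + 2 * k)"
    unfolding t by (simp add: power2_eq_square algebra_simps)
  then have "(t\<^sup>2 - 1) div 3 = 3 * k\<^sup>2 + 2 * k" by simp
  moreover have "3 * k\<^sup>2 + 2 * k \<ge> 0" using square_bound[of k] by linarith
  ultimately show ?thesis using sq by simp
qed

lemma fin_fibers_theta3: "fin_fibers (\<lambda>t. nat ((t\<^sup>2 - 1) div 3)) {t. t mod 3 = 1}"
  unfolding fin_fibers_def
proof
  fix n
  have "{t \<in> {t. t mod 3 = 1}. nat ((t\<^sup>2 - 1) div 3) \<le> n} \<subseteq> {- (3 * int n + 1)..3 * int n + 1}"
  proof
    fix t assume "t \<in> {t \<in> {t. t mod 3 = 1}. nat ((t\<^sup>2 - 1) div 3) \<le> n}"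
    then have "t mod 3 = 1" "int (nat ((t\<^sup>2 - 1) div 3)) \<le> int n" by (auto simp only: of_nat_le_iff)
    then have "\<bar>t\<bar> \<le> 3 * int n + 1" using theta3_exponent[of t] square_bound[of t] by linarith
    then show "t \<in> {- (3 * int n + 1)..3 * int n + 1}" by auto
  qed
  then show "finite {t \<in> {t. t mod 3 = 1}. nat ((t\<^sup>2 - 1) div 3) \<le> n}" by (rule finite_subset) simp
qed

text \<open>With \<open>s = 6 * m + 1\<close> the exponent is \<open>3 * m^2 + m\<close> and the
  weight is \<open>6 * (m + 1/6)\<close>, as in the second family.\<close>

definition theta6 :: "real fps" where
  "theta6 = gf (\<lambda>s. nat ((s\<^sup>2 - 1) div 12)) real_of_int {s. s mod 6 = 1}"

lemma theta6_exponent: "s mod 6 = 1 \<Longrightarrow> 12 * int (nat ((s\<^sup>2 - 1) div 12)) = s\<^sup>2 - 1"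
proof -
  assume "s mod 6 = 1"
  then have "6 * (s div 6) + 1 = s" using mult_div_mod_eq[of 6 s] by simp
  then have "s\<^sup>2 - 1 = 12 * int (2 * pent (s div 6))" using pent_square[of "s div 6"] by simp
  then have "(s\<^sup>2 - 1) div 12 = int (2 * pent (s div 6))" "s\<^sup>2 - 1 = 12 * int (2 * pent (s div 6))" by simp_all
  then show ?thesis by simp
qed

lemma fin_fibers_theta6: "fin_fibers (\<lambda>s. nat ((s\<^sup>2 - 1) div 12)) {s. s mod 6 = 1}"
  unfolding fin_fibers_def
proof
  fix n
  have "{t \<in> {t. t mod 6 = 1}. nat ((t\<^sup>2 - 1) div 12) \<le> n} \<subseteq> {- (12 * int n + 1)..12 * int n + 1}"
  proof
    fix t assume "t \<in> {t \<in> {t. t mod 6 = 1}. nat ((t\<^sup>2 - 1) div 12) \<le> n}"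
    then have "t mod 6 = 1" "int (nat ((t\<^sup>2 - 1) div 12)) \<le> int n" by (auto simp only: of_nat_le_iff)
    then have "\<bar>t\<bar> \<le> 12 * int n + 1" using theta6_exponent[of t] square_bound[of t] by linarith
    then show "t \<in> {- (12 * int n + 1)..12 * int n + 1}" by auto
  qed
  then show "finite {t \<in> {t. t mod 6 = 1}. nat ((t\<^sup>2 - 1) div 12) \<le> n}" by (rule finite_subset) simp
qed

lemma fin_fibers_product:
  assumes "k > 0" and "\<And>a b. (a, b) \<in> J \<Longrightarrow> a > 0 \<and> b > 0 \<and> a * b \<le> int k * int (e (a, b)) + int k"
  shows "fin_fibers e J"
  unfolding fin_fibers_def
proof
  fix n
  let ?K = "int k * int n + int k"
  have "{y \<in> J. e y \<le> n} \<subseteq> {0..?K} \<times> {0..?K}"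
  proof
    fix y assume y: "y \<in> {y \<in> J. e y \<le> n}"
    obtain a b where ab: "y = (a, b)" by (cases y)
    have *: "a > 0" "b > 0" "a * b \<le> int k * int (e (a, b)) + int k" and "e (a, b) \<le> n" using assms(2)[of a b] y unfolding ab by auto
    then have "int k * int (e (a, b)) \<le> int k * int n" by (intro mult_left_mono) auto
    then have "a * b \<le> ?K" using *(3) by linarith
    from product_bound[OF *(1,2) this] show "y \<in> {0..?K} \<times> {0..?K}" using * unfolding ab by auto
  qed
  then show "finite {y \<in> J. e y \<le> n}" by (rule finite_subset) simp
qed

lemma fin_fibers_pairs:
  assumes "\<And>r j :: nat. (r, j) \<in> J \<Longrightarrow> r \<le> e (r, j) \<and> j \<le> e (r, j)"
  shows "fin_fibers e J"
  unfolding fin_fibers_def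
proof
  fix n
  have "{y \<in> J. e y \<le> n} \<subseteq> {..n} \<times> {..n}"
  proof
    fix y assume y: "y \<in> {y \<in> J. e y \<le> n}"
    obtain r j where rj: "y = (r, j)" by (cases y)
    have "r \<le> e (r, j)" "j \<le> e (r, j)" "e (r, j) \<le> n" using assms[of r j] y unfolding rj by auto
    then show "y \<in> {..n} \<times> {..n}" unfolding rj by simp
  qed
  then show "finite {y \<in> J. e y \<le> n}" by (rule finite_subset) simp
qed

text \<open>The coefficient of index \<open>k\<close> runs over the factorisations of
  \<open>4 * k + 1\<close>; the recurrence takes it at \<open>k = 2 * n\<close>, so that the product
  is \<open>8 * n + 1\<close>.\<close>

definition f_divisor :: "real fps" where
  "f_divisor = gf (\<lambda>(a, b). nat ((a * b - 1) div 4)) (\<lambda>(a, b). mn b (3 * a)) {(a, b). a > 0 \<and> b > 0 \<and> a * b mod 4 = 1}"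

lemma int_nat_div:
  assumes "x > 0" "x mod 4 = c" "c \<ge> 0"
  shows "4 * int (nat ((x - c) div 4)) = x - c"
proof -
  have "x = 4 * (x div 4) + c" using assms(2) mult_div_mod_eq[of 4 x] by simp
  then obtain q where "x - c = 4 * q" "q = x div 4" by simp
  moreover have "x div 4 \<ge> 0" using assms(1) by simp
  ultimately show ?thesis by simp
qed

text \<open>The series is taken at \<open>q^2\<close> since the arguments \<open>n\<close> are half
  integers. After multiplication by the Euler product, comparing coefficients of index
  \<open>n\<close> is \<open>f_reps_identity\<close> with \<mu> = 3 * n + 1.\<close>

theorem mock_f_theta3: "(mock_f oo fps_X ^ 2) * theta3 = f_divisor"
proof -
  let ?e = "\<lambda>(r, j). r * r + tri r + r * j" and ?c = "\<lambda>(r, j). (-1) ^ (r + j) :: real"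
  let ?A = "gf (\<lambda>i. 2 * ?e i) ?c ({1..} \<times> UNIV)"
  have X0: "fps_nth (fps_X ^ 2 :: real fps) 0 = 0" by simp
  have "euler_fps 2 * (mock_f oo fps_X ^ 2) = (euler_fps 1 * mock_f) oo fps_X ^ 2"
    unfolding fps_compose_mult_distrib[OF X0] euler_fps_def gf_compose by simp
  also have "\<dots> = 1 + 4 * ?A"
  proof (rule fps_ext)
    fix n
    have "fps_nth ((1 + 4 * gf ?e ?c ({1..} \<times> UNIV)) oo fps_X ^ 2) n
      = (if even n then fps_nth 1 (n div 2) + 4 * fps_nth (gf ?e ?c ({1..} \<times> UNIV)) (n div 2) else 0)"
      by (simp add: fps_nth_compose_X_square numeral_fps_const)
    also have "\<dots> = fps_nth 1 n + 4 * fps_nth (gf ?e ?c ({1..} \<times> UNIV) oo fps_X ^ 2) n"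
      by (auto simp: fps_nth_compose_X_square elim!: evenE)
    also have "\<dots> = fps_nth (1 + 4 * ?A) n"
      unfolding gf_compose by (simp add: numeral_fps_const)
    finally show "fps_nth ((euler_fps 1 * mock_f) oo fps_X ^ 2) n = fps_nth (1 + 4 * ?A) n"
      unfolding euler_mock_f .
  qed
  finally have A: "euler_fps 2 * (mock_f oo fps_X ^ 2) = 1 + 4 * ?A" .
  have finA: "fin_fibers (\<lambda>i. 2 * ?e i) ({1..} \<times> UNIV)"
  proof (rule fin_fibers_pairs)
    fix r j :: nat assume "(r, j) \<in> {1..} \<times> UNIV"
    then have "1 * j \<le> r * j" "1 * r \<le> r * r" by (intro mult_right_mono; simp)+
    then have "r \<le> ?e (r, j)" "j \<le> ?e (r, j)"
      unfolding prod.case mult_1 by (simp_all only: trans_le_add1 trans_le_add2)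
    then show "r \<le> 2 * ?e (r, j) \<and> j \<le> 2 * ?e (r, j)" by linarith
  qed
  have finG: "fin_fibers (\<lambda>(a, b). nat ((a * b - 1) div 4)) {(a, b). a > 0 \<and> b > 0 \<and> a * b mod 4 = (1 :: int)}"
  proof (rule fin_fibers_product[of 4])
    fix a b :: int assume "(a, b) \<in> {(a, b). a > 0 \<and> b > 0 \<and> a * b mod 4 = 1}"
    then have *: "a > 0" "b > 0" "a * b mod 4 = 1" by auto
    then show "a > 0 \<and> b > 0 \<and> a * b \<le> int 4 * int (case (a, b) of (a, b) \<Rightarrow> nat ((a * b - 1) div 4)) + int 4"
      using int_nat_div[of "a * b" 1] by simp
  qed simp
  have "euler_fps 2 * ((mock_f oo fps_X ^ 2) * theta3) = euler_fps 2 * f_divisor"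
  proof (rule fps_ext)
    fix n
    let ?\<mu> = "3 * int n + 1"
    have mu: "?\<mu> mod 3 = 1" "?\<mu> > 0" by simp_all
    have th: "fps_nth theta3 n = (\<Sum>t\<in>{t. t\<^sup>2 = ?\<mu> \<and> t mod 3 = 1}. real_of_int t)"
      unfolding theta3_def gf_nth using theta3_exponent by (intro sum.cong) force+
    have "fps_nth (?A * theta3) n = (\<Sum>(i, t)\<in>{(i, t). i \<in> {1..} \<times> UNIV \<and> t \<in> {t. t mod 3 = 1} \<and> 2 * ?e i + nat ((t\<^sup>2 - 1) div 3) = n}. ?c i * real_of_int t)"
      unfolding theta3_def by (rule gf_mult_gf_nth[OF finA fin_fibers_theta3])
    \<comment> \<open>The form is \<open>(3 * r, t, - m)\<close> with
      \<open>m = 3 * r + 1 + 2 * j\<close>, since twice the exponent is \<open>r * m\<close>. Then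
      \<open>A + C < 0\<close>, so \<open>cr\<close> is 1.\<close>
    also have "\<dots> = (\<Sum>(t, n, m)\<in>{(t, n, m)\<in>reps ?\<mu>. t mod 3 = 1 \<and> m > 3 * n \<and> odd (m - n)}. chi4 (3 * n + m) * real_of_int t * cr (3 * n) (3 * n - m))"
    proof (rule sum.reindex_bij_witness[of _ "\<lambda>(t, n, m). ((nat n, nat ((m - 3 * n - 1) div 2)), t)"
        "\<lambda>((r, j), t). (t, int r, 3 * int r + 1 + 2 * int j)"], goal_cases)
      case (1 z)
      then show ?case by auto
    next
      case (2 z)
      obtain r j t where z: "z = ((r, j), t)" by (metis surj_pair)
      have *: "r \<ge> 1" "t mod 3 = 1" "2 * (r * r + tri r + r * j) + nat ((t\<^sup>2 - 1) div 3) = n" using 2 unfolding z by auto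
      have "int (2 * (r * r + tri r + r * j)) = int r * (3 * int r + 1 + 2 * int j)"
        using arg_cong[OF two_tri[of r], of int] by (simp add: algebra_simps)
      moreover have "int (2 * (r * r + tri r + r * j)) + int (nat ((t\<^sup>2 - 1) div 3)) = int n"
        using *(3) by (metis of_nat_add)
      ultimately have "t\<^sup>2 + 3 * int r * (3 * int r + 1 + 2 * int j) = ?\<mu>"
        using theta3_exponent[OF *(2)] by (simp add: algebra_simps)
      then show ?case using *(1,2) unfolding z by (simp add: reps_def)
    next
      case (3 z)
      obtain t n' m where z: "z = (t, n', m)" by (cases z)
      have *: "n' > 0" "m > 3 * n'" "odd (m - n')" using 3 unfolding z by (auto simp: reps_def)
      then have "even (m - 3 * n' - 1)" by simp
      then obtain k where k: "m - 3 * n' - 1 = 2 * k" by blast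
      then have "k \<ge> 0" "m = 3 * n' + 1 + 2 * k" using *(2) by simp_all
      then show ?case using *(1) unfolding z by simp
    next
      case (4 z)
      obtain t n' m where z: "z = (t, n', m)" by (cases z)
      have *: "n' > 0" "m > 3 * n'" "odd (m - n')" "t mod 3 = 1" "t\<^sup>2 + 3 * n' * m = ?\<mu>" using 4 unfolding z by (auto simp: reps_def)
      then have "even (m - 3 * n' - 1)" by simp
      then obtain k where k: "m - 3 * n' - 1 = 2 * k" by blast
      then have "k \<ge> 0" and m: "m = 3 * n' + 1 + 2 * k" using *(2) by simp_all
      then obtain j r where j: "k = int j" and r: "n' = int r" by (metis *(1) nonneg_int_cases less_imp_le)
      have "int (2 * (r * r + tri r + r * j)) = int r * m"
        unfolding m r j using arg_cong[OF two_tri[of r], of int] by (simp add: algebra_simps)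
      then have "int (2 * (r * r + tri r + r * j)) + int (nat ((t\<^sup>2 - 1) div 3)) = int n"
        using theta3_exponent[OF *(4)] *(5) unfolding r by (simp add: mult.assoc)
      then have "2 * (r * r + tri r + r * j) + nat ((t\<^sup>2 - 1) div 3) = n" by (simp only: of_nat_add[symmetric] of_nat_eq_iff)
      then show ?case using *(1,4) unfolding z m r j by simp
    next
      case (5 z)
      obtain r j t where z: "z = ((r, j), t)" by (metis surj_pair)
      have eq: "3 * int r + (3 * int r + 1 + 2 * int j) = 2 * (int (3 * r + j)) + 1" by simp
      have c1: "chi4 1 = 1" by (simp add: chi4_def)
      have c: "chi4 (3 * int r + (3 * int r + 1 + 2 * int j)) = (-1) ^ (r + j)"
        unfolding eq chi4_shift[OF odd_one] c1 by (simp add: uminus_power_if)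
      have "cr (3 * int r) (3 * int r - (3 * int r + 1 + 2 * int j)) = 1" if "r \<ge> 1" using that by (simp add: cr_def)
      moreover have "r \<ge> 1" using 5 unfolding z by auto
      ultimately show ?case unfolding z prod.case c by simp
    qed
    \<comment> \<open>The additional forms contribute nothing: \<open>cr\<close> vanishes for
      \<open>m < 3 * n\<close> and \<open>chi4\<close> for \<open>n + m\<close> even, in particular
      for \<open>m = 3 * n\<close>.\<close>
    also have "\<dots> = (\<Sum>(t, n, m)\<in>{(t, n, m)\<in>reps ?\<mu>. t mod 3 = 1}. chi4 (3 * n + m) * real_of_int t * cr (3 * n) (3 * n - m))"
    proof (rule sum.mono_neutral_left, goal_cases)
      case 1
      show ?case by (rule finite_subset[OF _ finite_reps]) auto
    next
      case 2
      show ?case by auto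
    next
      case 3
      show ?case
      proof
        fix z assume "z \<in> {(t, n, m)\<in>reps ?\<mu>. t mod 3 = 1} - {(t, n, m)\<in>reps ?\<mu>. t mod 3 = 1 \<and> m > 3 * n \<and> odd (m - n)}"
        moreover obtain t n' m where z: "z = (t, n', m)" by (cases z)
        ultimately have n0: "n' > 0" and cs: "m < 3 * n' \<or> even (m - n') \<or> m = 3 * n'" by (auto simp: reps_def)
        then consider "m < 3 * n'" | "even (3 * n' + m)" by fastforce
        then have "chi4 (3 * n' + m) * cr (3 * n') (3 * n' - m) = 0"
        proof cases
          case 2
          then have "(3 * n' + m) mod 4 \<noteq> 1" "(3 * n' + m) mod 4 \<noteq> 3" by presburger+
          then show ?thesis by (simp add: chi4_def)
        qed (use n0 in \<open>simp add: cr_def\<close>)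
        then show "(case z of (t, n, m) \<Rightarrow> chi4 (3 * n + m) * real_of_int t * cr (3 * n) (3 * n - m)) = 0" unfolding z by auto
      qed
    qed
    finally have At: "fps_nth (?A * theta3) n = (\<Sum>(t, n, m)\<in>{(t, n, m)\<in>reps ?\<mu>. t mod 3 = 1}. chi4 (3 * n + m) * real_of_int t * cr (3 * n) (3 * n - m))" .
    let ?J = "{(a, b). a > 0 \<and> b > 0 \<and> a * b mod 4 = (1 :: int)}"
      and ?d = "\<lambda>(a, b). nat ((a * b - 1) div (4 :: int))" and ?w = "\<lambda>(a, b). mn b (3 * a)"
    have "fps_nth (euler_fps 2 * f_divisor) n
      = (\<Sum>(s, y)\<in>{(s, y). s mod 6 = 1 \<and> y \<in> ?J \<and> s\<^sup>2 + 12 * int (?d y) = 12 * int n + 1}.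
            chi4 s * ?w y)"
      unfolding f_divisor_def by (rule euler_gf_nth[OF finG])
    also have "\<dots> = (\<Sum>(s, a, b)\<in>{(s, a, b)\<in>reps (4 * ?\<mu>). s mod 6 = 1}. chi4 s * mn b (3 * a))"
    proof (rule sum.cong)
      show "{(s, y). s mod 6 = 1 \<and> y \<in> ?J \<and> s\<^sup>2 + 12 * int (?d y) = 12 * int n + 1}
        = {(s, a, b)\<in>reps (4 * ?\<mu>). s mod 6 = 1}" (is "?L = ?R")
      proof (rule set_eqI)
        fix z :: "int \<times> int \<times> int"
        obtain s a b where z: "z = (s, a, b)" by (cases z)
        have ab: "a * b mod 4 = 1" if "s mod 6 = 1" "s\<^sup>2 + 3 * (a * b) = 4 * ?\<mu>"
          by (rule cofactor_mod_4(1)[OF that(2)], rule odd_square_mod_4) (use that(1) in \<open>simp add: mod_6_eq_1_iff\<close>)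
        have e: "4 * int (nat ((a * b - 1) div 4)) = a * b - 1" if "a > 0" "b > 0" "a * b mod 4 = 1"
          using int_nat_div[of "a * b" 1] that by simp
        show "z \<in> ?L \<longleftrightarrow> z \<in> ?R"
        proof
          assume "z \<in> ?L"
          then have "s mod 6 = 1" "a > 0" "b > 0" "a * b mod 4 = 1" "s\<^sup>2 + 12 * int (nat ((a * b - 1) div 4)) = 12 * int n + 1" unfolding z by auto
          then show "z \<in> ?R" using e unfolding z by (simp add: reps_def mult.assoc)
        next
          assume "z \<in> ?R"
          then have *: "s mod 6 = 1" "a > 0" "b > 0" "s\<^sup>2 + 3 * (a * b) = 4 * ?\<mu>" unfolding z by (auto simp: reps_def mult.assoc)
          then show "z \<in> ?L" using e[OF *(2,3) ab[OF *(1,4)]] ab[OF *(1,4)] unfolding z by simp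
        qed
      qed
    qed auto
    finally have R: "fps_nth (euler_fps 2 * f_divisor) n = (\<Sum>(s, a, b)\<in>{(s, a, b)\<in>reps (4 * ?\<mu>). s mod 6 = 1}. chi4 s * mn b (3 * a))" .
    have "fps_nth (euler_fps 2 * ((mock_f oo fps_X ^ 2) * theta3)) n = fps_nth theta3 n + 4 * fps_nth (?A * theta3) n"
      unfolding mult.assoc[symmetric] A by (simp add: distrib_right numeral_fps_const mult.assoc)
    then show "fps_nth (euler_fps 2 * ((mock_f oo fps_X ^ 2) * theta3)) n = fps_nth (euler_fps 2 * f_divisor) n"
      unfolding th At R f_reps_identity[OF mu, symmetric] .
  qed
  then show ?thesis using mult_left_cancel[OF euler_fps_nonzero] by blast
qed

lemma fin_fibers_omega: "fin_fibers (\<lambda>(r, j). 3 * (r * (r + 1)) + (2 * r + 1) * j) UNIV"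
proof (rule fin_fibers_pairs)
  fix r j :: nat
  have "1 * j \<le> (2 * r + 1) * j" "r * 1 \<le> r * (r + 1)" by (intro mult_right_mono mult_left_mono; simp)+
  then show "r \<le> (case (r, j) of (r, j) \<Rightarrow> 3 * (r * (r + 1)) + (2 * r + 1) * j)
      \<and> j \<le> (case (r, j) of (r, j) \<Rightarrow> 3 * (r * (r + 1)) + (2 * r + 1) * j)"
    unfolding prod.case by linarith
qed

text \<open>Stated for both theta series: \<open>P\<close> is the residue class, \<open>Q\<close> is
  12 times the exponent, and \<open>g\<close> carries the twist. With \<open>n = 2 * r + 1\<close>
  and \<open>m = 3 * n + 4 * j\<close>, \<open>3 * n * m\<close> is 12 times the exponent of the
  double series plus 9. For \<open>j = 0\<close> the geodesic passes through \<open>i\<close>, and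
  the value one half of \<open>cr\<close> accounts for the coefficient 1 instead of 2.\<close>

lemma omega_gf_mult_nth:
  fixes P :: "int \<Rightarrow> bool" and Q :: "int \<Rightarrow> int" and g :: "int \<Rightarrow> real"
  assumes "fin_fibers e {t. P t}" "\<And>t. P t \<Longrightarrow> 12 * int (e t) = Q t" "\<And>x. g (- x) = g x"
    and finite: "finite {(t, n, m). n > 0 \<and> m > 0 \<and> P t \<and> odd n \<and> 4 dvd 3 * n - m \<and> Q t + 3 * n * m = 12 * int N + 9}"
  shows "fps_nth (gf (\<lambda>(r, j). 3 * (r * (r + 1)) + (2 * r + 1) * j)
            (\<lambda>(r, j). (-1) ^ r * (if j = 0 then 1 else 2) * g (int j)) UNIV * gf e real_of_int {t. P t}) N
    = 2 * (\<Sum>(t, n, m)\<in>{(t, n, m). n > 0 \<and> m > 0 \<and> P t \<and> odd n \<and> 4 dvd 3 * n - m \<and> Q t + 3 * n * m = 12 * int N + 9}.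
        chi4 n * g ((3 * n - m) div 4) * real_of_int t * cr (3 * n) (3 * n - m))"
proof -
  let ?e = "\<lambda>(r, j). 3 * (r * (r + 1)) + (2 * r + 1) * j"
  let ?c = "\<lambda>(r, j). (-1) ^ r * (if j = 0 then 1 else 2) * g (int j)"
  let ?S = "{(t, n, m). n > 0 \<and> m > 0 \<and> P t \<and> odd n \<and> 4 dvd 3 * n - m \<and> Q t + 3 * n * m = 12 * int N + 9}"
  let ?h = "\<lambda>(t, n, m). 2 * (chi4 n * g ((3 * n - m) div 4) * real_of_int t * cr (3 * n) (3 * n - m))"
  have index: "3 * (2 * int r + 1) * (3 * (2 * int r + 1) + 4 * int j) = 12 * int (?e (r, j)) + 9" for r j
    by (simp add: algebra_simps)
  have "fps_nth (gf ?e ?c UNIV * gf e real_of_int {t. P t}) N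
    = (\<Sum>(i, t)\<in>{(i, t). i \<in> UNIV \<and> t \<in> {t. P t} \<and> ?e i + e t = N}. ?c i * real_of_int t)"
    by (rule gf_mult_gf_nth[OF fin_fibers_omega assms(1)])
  also have "\<dots> = (\<Sum>z\<in>{(t, n, m). (t, n, m) \<in> ?S \<and> m \<ge> 3 * n}. ?h z)"
  proof (rule sum.reindex_bij_witness[of _ "\<lambda>(t, n, m). ((nat ((n - 1) div 2), nat ((m - 3 * n) div 4)), t)"
        "\<lambda>((r, j), t). (t, 2 * int r + 1, 3 * (2 * int r + 1) + 4 * int j)"], goal_cases)
    case (1 z)
    then show ?case by auto
  next
    case (2 z)
    obtain r j t where z: "z = ((r, j), t)" by (metis surj_pair)
    have *: "P t" "?e (r, j) + e t = N" using 2 unfolding z by auto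
    have "int (?e (r, j)) + int (e t) = int N" using arg_cong[OF *(2), of int] by (simp only: of_nat_add)
    then have "Q t + 3 * (2 * int r + 1) * (3 * (2 * int r + 1) + 4 * int j) = 12 * int N + 9"
      using assms(2)[OF *(1)] unfolding index by linarith
    then show ?case using *(1) unfolding z by simp
  next
    case (3 z)
    obtain t n m where z: "z = (t, n, m)" by (cases z)
    have *: "n > 0" "odd n" "4 dvd m - 3 * n" "m \<ge> 3 * n" using 3 unfolding z by (auto simp: dvd_diff_commute)
    then obtain l k where "n = 2 * l + 1" "m - 3 * n = 4 * k" by (elim oddE dvdE) blast
    then have "l \<ge> 0" "k \<ge> 0" "n = 2 * l + 1" "m = 3 * (2 * l + 1) + 4 * k" using * by auto
    then show ?case unfolding z by simp
  next
    case (4 z)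
    obtain t n m where z: "z = (t, n, m)" by (cases z)
    have *: "n > 0" "odd n" "4 dvd m - 3 * n" "m \<ge> 3 * n" "P t" "Q t + 3 * n * m = 12 * int N + 9"
      using 4 unfolding z by (auto simp: dvd_diff_commute)
    then obtain l k where "n = 2 * l + 1" "m - 3 * n = 4 * k" by (elim oddE dvdE) blast
    then have lk: "l \<ge> 0" "k \<ge> 0" "n = 2 * l + 1" "m = 3 * (2 * l + 1) + 4 * k" using * by auto
    then obtain r j where rj: "l = int r" "k = int j" by (metis nonneg_int_cases)
    have "int (?e (r, j)) + int (e t) = int N"
      using *(6) assms(2)[OF *(5)] index[of r j] unfolding lk(3,4) rj by linarith
    then have "?e (r, j) + e t = N" by (simp only: of_nat_add[symmetric] of_nat_eq_iff)
    then show ?case using *(5) unfolding z lk(3,4) rj by simp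
  next
    case (5 z)
    obtain r j t where z: "z = ((r, j), t)" by (metis surj_pair)
    have c: "chi4 (2 * int r + 1) = (-1) ^ r"
      using chi4_shift[of 1 "int r"] by (simp add: chi4_def uminus_power_if)
    have cr: "cr x (x - (x + 4 * int j)) = (if j = 0 then 1 / 2 else 1)" if "x > 0" for x
      using that by (cases "j = 0") (auto simp: cr_def sgn_if)
    have k: "cr (3 * (2 * int r + 1)) (3 * (2 * int r + 1) - (3 * (2 * int r + 1) + 4 * int j)) = (if j = 0 then 1 / 2 else 1)"
      by (rule cr) simp
    have d: "(3 * (2 * int r + 1) - (3 * (2 * int r + 1) + 4 * int j)) div 4 = - int j" by simp
    show ?case unfolding z prod.case c k d assms(3) by simp
  qed
  also have "\<dots> = (\<Sum>z\<in>?S. ?h z)"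
  proof (rule sum.mono_neutral_left[OF finite], goal_cases)
    case 1
    show ?case by auto
  next
    case 2
    have "3 * n \<le> m" if "n > 0" "cr (3 * n) (3 * n - m) \<noteq> 0" for n m
      by (rule ccontr) (use that in \<open>simp add: cr_def\<close>)
    then show ?case by auto
  qed
  also have "\<dots> = 2 * (\<Sum>(t, n, m)\<in>?S. chi4 n * g ((3 * n - m) div 4) * real_of_int t * cr (3 * n) (3 * n - m))"
    unfolding sum_distrib_left by (rule sum.cong) auto
  finally show ?thesis .
qed

text \<open>For \<open>a * b = 4 * k + 3\<close> the sign is \<open>(-1) ^ k\<close>; it becomes the
  sign depending on \<open>h\<close> in the recurrence.\<close>

definition omega_divisor :: "real fps" where
  "omega_divisor = gf (\<lambda>(a, b). nat ((a * b - 3) div 4))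
     (\<lambda>(a, b). (if a * b mod 8 = 3 then 1 else -1) * mn b (3 * a)) {(a, b). a > 0 \<and> b > 0 \<and> a * b mod 4 = 3}"

theorem mock_omega_theta6: "mock_omega * theta6 = omega_divisor"
proof -
  have finG: "fin_fibers (\<lambda>(a, b). nat ((a * b - 3) div 4)) {(a, b). a > 0 \<and> b > 0 \<and> a * b mod 4 = (3 :: int)}"
  proof (rule fin_fibers_product[of 4])
    fix a b :: int assume "(a, b) \<in> {(a, b). a > 0 \<and> b > 0 \<and> a * b mod 4 = 3}"
    then have *: "a > 0" "b > 0" "a * b mod 4 = 3" by auto
    then show "a > 0 \<and> b > 0 \<and> a * b \<le> int 4 * int (case (a, b) of (a, b) \<Rightarrow> nat ((a * b - 3) div 4)) + int 4"
      using int_nat_div[of "a * b" 3] by simp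
  qed simp
  have "euler_fps 2 * (mock_omega * theta6) = euler_fps 2 * omega_divisor"
  proof (rule fps_ext)
    fix n
    let ?\<mu> = "12 * int n + 10"
    let ?J = "{(a, b). a > 0 \<and> b > 0 \<and> a * b mod 4 = (3 :: int)}"
      and ?d = "\<lambda>(a, b). nat ((a * b - 3) div (4 :: int))"
      and ?w = "\<lambda>(a, b). (if a * b mod 8 = 3 then 1 else -1) * mn b (3 * a)"
    let ?S = "{(t, n', m). n' > 0 \<and> m > 0 \<and> t mod 6 = 1 \<and> odd n' \<and> 4 dvd 3 * n' - m \<and> (t\<^sup>2 - 1) + 3 * n' * m = 12 * int n + 9}"
    have S: "?S = {(t, n, m)\<in>reps ?\<mu>. t mod 6 = 1 \<and> odd n \<and> 4 dvd 3 * n - m}" by (auto simp: reps_def)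
    have finS: "finite ?S" unfolding S by (rule finite_subset[OF _ finite_reps[of ?\<mu>]]) auto
    have "fps_nth (euler_fps 2 * (mock_omega * theta6)) n
      = 2 * (\<Sum>(t, n, m)\<in>?S. chi4 n * 1 * real_of_int t * cr (3 * n) (3 * n - m))"
      unfolding mult.assoc[of "euler_fps 2", symmetric] euler_mock_omega theta6_def
      using omega_gf_mult_nth[where g = "\<lambda>_. 1", OF fin_fibers_theta6 theta6_exponent refl finS]
      by simp
    also have "\<dots> = (\<Sum>(s, a, b)\<in>{(s, a, b)\<in>reps ?\<mu>. s mod 6 = 1}. chi4 s * (if a * b mod 8 = 3 then 1 else -1) * mn b (3 * a))"
      unfolding S mult_1_right by (rule omega_reps_identity) simp
    also have "\<dots> = (\<Sum>(s, y)\<in>{(s, y). s mod 6 = 1 \<and> y \<in> ?J \<and> s\<^sup>2 + 12 * int (?d y) = 12 * int n + 1}.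
            chi4 s * ?w y)" (is "sum _ ?R = sum _ ?L")
    proof (rule sum.cong)
      show "?R = ?L"
      proof (rule set_eqI)
        fix z :: "int \<times> int \<times> int"
        obtain s a b where z: "z = (s, a, b)" by (cases z)
        have ab: "a * b mod 4 = 3" if "s mod 6 = 1" "s\<^sup>2 + 3 * (a * b) = ?\<mu>"
        proof (rule cofactor_mod_4(2)[OF that(2)])
          show "s\<^sup>2 mod 4 = 1" by (rule odd_square_mod_4) (use that(1) in \<open>simp add: mod_6_eq_1_iff\<close>)
          show "?\<mu> mod 4 = 2" by presburger
        qed
        have e: "4 * int (nat ((a * b - 3) div 4)) = a * b - 3" if "a > 0" "b > 0" "a * b mod 4 = 3"
          using int_nat_div[of "a * b" 3] that by simp
        show "z \<in> ?R \<longleftrightarrow> z \<in> ?L"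
        proof
          assume "z \<in> ?L"
          then have "s mod 6 = 1" "a > 0" "b > 0" "a * b mod 4 = 3" "s\<^sup>2 + 12 * int (nat ((a * b - 3) div 4)) = 12 * int n + 1" unfolding z by auto
          then show "z \<in> ?R" using e unfolding z by (simp add: reps_def mult.assoc)
        next
          assume "z \<in> ?R"
          then have *: "s mod 6 = 1" "a > 0" "b > 0" "s\<^sup>2 + 3 * (a * b) = ?\<mu>" unfolding z by (auto simp: reps_def mult.assoc)
          then show "z \<in> ?L" using e[OF *(2,3) ab[OF *(1,4)]] ab[OF *(1,4)] unfolding z by simp
        qed
      qed
    qed (auto simp: mult.assoc)
    also have "\<dots> = fps_nth (euler_fps 2 * omega_divisor) n"
      unfolding omega_divisor_def by (rule euler_gf_nth[OF finG, symmetric])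
    finally show "fps_nth (euler_fps 2 * (mock_omega * theta6)) n = fps_nth (euler_fps 2 * omega_divisor) n" .
  qed
  then show ?thesis using mult_left_cancel[OF euler_fps_nonzero] by blast
qed

text \<open>For \<delta> = 1 or -1 this is the substitution of \<delta>q for \<open>q\<close>, hence
  multiplicative.\<close>

definition twist :: "real \<Rightarrow> real fps \<Rightarrow> real fps" where
  "twist \<delta> F = Abs_fps (\<lambda>n. (if even n then 1 else \<delta>) * fps_nth F n)"

lemma twist_mult:
  assumes "\<delta> * \<delta> = 1"
  shows "twist \<delta> (F * G) = twist \<delta> F * twist \<delta> G"
proof (rule fps_ext)
  fix n
  have "(if even n then 1 else \<delta>) * (fps_nth F i * fps_nth G (n - i))
    = ((if even i then 1 else \<delta>) * fps_nth F i) * ((if even (n - i) then 1 else \<delta>) * fps_nth G (n - i))" if "i \<le> n" for i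
  proof -
    have "(if even n then 1 else \<delta>) = (if even i then 1 else \<delta>) * (if even (n - i) then 1 else \<delta>)"
      using that assms by auto
    then show ?thesis by (simp only: mult_ac)
  qed
  then have "(\<Sum>i = 0..n. (if even n then 1 else \<delta>) * (fps_nth F i * fps_nth G (n - i)))
    = (\<Sum>i = 0..n. ((if even i then 1 else \<delta>) * fps_nth F i) * ((if even (n - i) then 1 else \<delta>) * fps_nth G (n - i)))"
    by (intro sum.cong) simp_all
  then show "fps_nth (twist \<delta> (F * G)) n = fps_nth (twist \<delta> F * twist \<delta> G) n"
    by (simp only: twist_def fps_nth_Abs_fps fps_mult_nth sum_distrib_left)
qed

lemma twist_gf: "twist \<delta> (gf e c I) = gf e (\<lambda>i. c i * (if even (e i) then 1 else \<delta>)) I"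
  by (rule fps_ext) (simp add: twist_def gf_nth sum_distrib_left sum_distrib_right mult.commute)

definition parity_divisor :: "real \<Rightarrow> real fps" where
  "parity_divisor \<delta> = gf (\<lambda>(a, b). nat (a * b - 1))
     (\<lambda>(a, b). (if even (a + b) then (if 4 dvd 3 * b - a then 1 else - \<delta>) * mn (3 * b) a else 0)
        - (1 - \<delta>) * (if odd a then (if even b then 1 else -1) * real_of_int b else 0))
     {(a, b). a > 0 \<and> b > 0}"

theorem twist_mock_omega_theta3:
  assumes \<delta>: "\<delta> = 1 \<or> \<delta> = -1"
  shows "twist \<delta> mock_omega * theta3 = parity_divisor \<delta>"
proof -
  have finG: "fin_fibers (\<lambda>(a, b). nat (a * b - 1)) {(a, b). a > 0 \<and> b > (0 :: int)}"
    by (rule fin_fibers_product[of 1]) auto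
  \<comment> \<open>All exponents of this Euler product are even.\<close>
  have "twist \<delta> (euler_fps 2) = euler_fps 2"
    unfolding euler_fps_def twist_gf by simp
  then have "euler_fps 2 * twist \<delta> mock_omega = twist \<delta> (euler_fps 2 * mock_omega)"
    using \<delta> by (subst twist_mult) auto
  also have "\<dots> = gf (\<lambda>(r, j). 3 * (r * (r + 1)) + (2 * r + 1) * j)
            (\<lambda>(r, j). (-1) ^ r * (if j = 0 then 1 else 2) * (if even (int j) then 1 else \<delta>)) UNIV"
    unfolding euler_mock_omega twist_gf by (rule arg_cong2[where f = "\<lambda>c I. gf _ c I"]) (auto simp: fun_eq_iff)
  finally have A: "euler_fps 2 * twist \<delta> mock_omega = \<dots>" .
  have "euler_fps 2 * (twist \<delta> mock_omega * theta3) = euler_fps 2 * parity_divisor \<delta>"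
  proof (rule fps_ext)
    fix n
    let ?\<mu> = "12 * int n + 13"
    let ?J = "{(a, b). a > 0 \<and> b > (0 :: int)}"
      and ?d = "\<lambda>(a, b). nat (a * b - (1 :: int))"
      and ?w = "\<lambda>(a, b). (if even (a + b) then (if 4 dvd 3 * b - a then 1 else - \<delta>) * mn (3 * b) a else 0)
        - (1 - \<delta>) * (if odd a then (if even b then 1 else -1) * real_of_int b else 0)"
    let ?S = "{(t, n', m). n' > 0 \<and> m > 0 \<and> t mod 3 = 1 \<and> odd n' \<and> 4 dvd 3 * n' - m \<and> 4 * (t\<^sup>2 - 1) + 3 * n' * m = 12 * int n + 9}"
    have S: "?S = reps4 ?\<mu>" by (auto simp: reps4_def)
    have finS: "finite ?S"
    proof (rule finite_subset)
      show "?S \<subseteq> (\<lambda>(u, n, m). (u div 2, n, m)) ` reps ?\<mu>"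
      proof
        fix z assume "z \<in> ?S"
        moreover obtain t n' m where z: "z = (t, n', m)" by (cases z)
        ultimately have "(2 * t, n', m) \<in> reps ?\<mu>" by (auto simp: reps_def power2_eq_square)
        then have "(\<lambda>(u, n, m). (u div 2, n, m)) (2 * t, n', m) \<in> (\<lambda>(u, n, m). (u div 2, n, m)) ` reps ?\<mu>" by (rule imageI)
        then show "z \<in> (\<lambda>(u, n, m). (u div 2, n, m)) ` reps ?\<mu>" unfolding z by simp
      qed
    qed simp
    have e: "12 * int (nat ((t\<^sup>2 - 1) div 3)) = 4 * (t\<^sup>2 - 1)" if "t mod 3 = 1" for t
      using theta3_exponent[OF that] by simp
    have "fps_nth (euler_fps 2 * (twist \<delta> mock_omega * theta3)) n
      = 2 * (\<Sum>(t, n, m)\<in>?S. chi4 n * (if even ((3 * n - m) div 4) then 1 else \<delta>) * real_of_int t * cr (3 * n) (3 * n - m))"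
      unfolding mult.assoc[of "euler_fps 2", symmetric] A theta3_def
      by (rule omega_gf_mult_nth[where g = "\<lambda>x. if even x then 1 else \<delta>", OF fin_fibers_theta3 e _ finS]) auto
    also have "\<dots> = (\<Sum>(s, a, b)\<in>{(s, a, b)\<in>reps12 ?\<mu>. even (a + b)}. chi4 s * (if 4 dvd 3 * b - a then 1 else - \<delta>) * mn (3 * b) a)
     - (1 - \<delta>) * (\<Sum>(s, a, b)\<in>{(s, a, b)\<in>reps12 ?\<mu>. odd a}. chi4 s * (if even b then 1 else -1) * real_of_int b)"
      unfolding S by (rule parity_reps_identity[OF _ \<delta>]) presburger
    also have "(\<Sum>(s, a, b)\<in>{(s, a, b)\<in>reps12 ?\<mu>. even (a + b)}. chi4 s * (if 4 dvd 3 * b - a then 1 else - \<delta>) * mn (3 * b) a)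
      = (\<Sum>(s, a, b)\<in>reps12 ?\<mu>. chi4 s * (if even (a + b) then (if 4 dvd 3 * b - a then 1 else - \<delta>) * mn (3 * b) a else 0))"
      by (rule sum.mono_neutral_cong_left) (auto split: if_splits)
    also have "(\<Sum>(s, a, b)\<in>{(s, a, b)\<in>reps12 ?\<mu>. odd a}. chi4 s * (if even b then 1 else -1) * real_of_int b)
      = (\<Sum>(s, a, b)\<in>reps12 ?\<mu>. chi4 s * (if odd a then (if even b then 1 else -1) * real_of_int b else 0))"
      by (rule sum.mono_neutral_cong_left) auto
    also have "(\<Sum>(s, a, b)\<in>reps12 ?\<mu>. chi4 s * (if even (a + b) then (if 4 dvd 3 * b - a then 1 else - \<delta>) * mn (3 * b) a else 0))
       - (1 - \<delta>) * (\<Sum>(s, a, b)\<in>reps12 ?\<mu>. chi4 s * (if odd a then (if even b then 1 else -1) * real_of_int b else 0))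
      = (\<Sum>(s, y)\<in>reps12 ?\<mu>. chi4 s * ?w y)"
      unfolding sum_distrib_left sum_subtractf[symmetric]
      by (rule sum.cong) (simp_all only: case_prod_beta right_diff_distrib mult_ac)
    also have "reps12 ?\<mu> = {(s, y). s mod 6 = 1 \<and> y \<in> ?J \<and> s\<^sup>2 + 12 * int (?d y) = 12 * int n + 1}" (is "_ = ?L")
    proof (rule set_eqI)
      fix z :: "int \<times> int \<times> int"
      obtain s a b where z: "z = (s, a, b)" by (cases z)
      have "int (nat (a * b - 1)) = a * b - 1" if "a > 0" "b > 0"
        using mult_pos_pos[OF that] by simp
      then show "z \<in> reps12 ?\<mu> \<longleftrightarrow> z \<in> ?L" unfolding z by (auto simp: reps12_def)
    qed
    also have "(\<Sum>(s, y)\<in>?L. chi4 s * ?w y) = fps_nth (euler_fps 2 * parity_divisor \<delta>) n"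
      unfolding parity_divisor_def by (rule euler_gf_nth[OF finG, symmetric])
    finally show "fps_nth (euler_fps 2 * (twist \<delta> mock_omega * theta3)) n = fps_nth (euler_fps 2 * parity_divisor \<delta>) n" .
  qed
  then show ?thesis using mult_left_cancel[OF euler_fps_nonzero] by blast
qed

section \<open>The recurrences\<close>

lemma theta3_mult_nth:
  "fps_nth (F * theta3) k = (\<Sum>m\<in>{m. 3 * m\<^sup>2 + 2 * m \<le> int k}. real_of_int (3 * m + 1) * fps_nth F (nat (int k - (3 * m\<^sup>2 + 2 * m))))"
proof -
  have e: "nat (((3 * m + 1)\<^sup>2 - 1) div 3) = nat (3 * m\<^sup>2 + 2 * m)" "3 * m\<^sup>2 + 2 * m \<ge> 0" for m :: int
  proof -
    have "(3 * m + 1)\<^sup>2 - 1 = 3 * (3 * m\<^sup>2 + 2 * m)" by (simp add: power2_eq_square algebra_simps)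
    then show "nat (((3 * m + 1)\<^sup>2 - 1) div 3) = nat (3 * m\<^sup>2 + 2 * m)" by simp
    show "3 * m\<^sup>2 + 2 * m \<ge> 0" using square_bound[of m] by linarith
  qed
  have t: "3 * (t div 3) + 1 = t" if "t mod 3 = 1" for t :: int using mult_div_mod_eq[of 3 t] that by simp
  have "fps_nth (F * theta3) k = (\<Sum>t\<in>{t \<in> {t. t mod 3 = 1}. nat ((t\<^sup>2 - 1) div 3) \<le> k}. real_of_int t * fps_nth F (k - nat ((t\<^sup>2 - 1) div 3)))"
    unfolding theta3_def mult.commute[of F] by (rule gf_mult_nth[OF fin_fibers_theta3])
  also have "\<dots> = (\<Sum>m\<in>{m. 3 * m\<^sup>2 + 2 * m \<le> int k}. real_of_int (3 * m + 1) * fps_nth F (nat (int k - (3 * m\<^sup>2 + 2 * m))))"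
  proof (rule sum.reindex_bij_witness[of _ "\<lambda>m. 3 * m + 1" "\<lambda>t. t div 3"], goal_cases)
    case (1 t)
    then show ?case using t by simp
  next
    case (2 t)
    then have "t mod 3 = 1" "nat ((t\<^sup>2 - 1) div 3) \<le> k" by auto
    then show ?case using e[of "t div 3"] unfolding t[OF \<open>t mod 3 = 1\<close>] by (simp add: nat_le_iff)
  next
    case (4 m)
    have "(3 * m + 1) mod 3 = 1" by presburger
    then show ?case using 4 unfolding mem_Collect_eq e by simp
  next
    case (5 t)
    then have "t mod 3 = 1" by simp
    have "k - nat ((t\<^sup>2 - 1) div 3) = nat (int k - (3 * (t div 3)\<^sup>2 + 2 * (t div 3)))"
      using e[of "t div 3"] unfolding t[OF \<open>t mod 3 = 1\<close>] by (simp add: nat_diff_distrib')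
    then show ?case unfolding t[OF \<open>t mod 3 = 1\<close>] by simp
  qed simp
  finally show ?thesis .
qed

lemma theta6_mult_nth:
  "fps_nth (F * theta6) k = (\<Sum>m\<in>{m. 3 * m\<^sup>2 + m \<le> int k}. real_of_int (6 * m + 1) * fps_nth F (nat (int k - (3 * m\<^sup>2 + m))))"
proof -
  have e: "nat (((6 * m + 1)\<^sup>2 - 1) div 12) = nat (3 * m\<^sup>2 + m)" "3 * m\<^sup>2 + m \<ge> 0" for m :: int
  proof -
    have "(6 * m + 1)\<^sup>2 - 1 = 12 * (3 * m\<^sup>2 + m)" by (simp add: power2_eq_square algebra_simps)
    then show "nat (((6 * m + 1)\<^sup>2 - 1) div 12) = nat (3 * m\<^sup>2 + m)" by simp
    show "3 * m\<^sup>2 + m \<ge> 0" using square_bound[of m] by linarith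
  qed
  have t: "6 * (t div 6) + 1 = t" if "t mod 6 = 1" for t :: int using mult_div_mod_eq[of 6 t] that by simp
  have "fps_nth (F * theta6) k = (\<Sum>t\<in>{t \<in> {t. t mod 6 = 1}. nat ((t\<^sup>2 - 1) div 12) \<le> k}. real_of_int t * fps_nth F (k - nat ((t\<^sup>2 - 1) div 12)))"
    unfolding theta6_def mult.commute[of F] by (rule gf_mult_nth[OF fin_fibers_theta6])
  also have "\<dots> = (\<Sum>m\<in>{m. 3 * m\<^sup>2 + m \<le> int k}. real_of_int (6 * m + 1) * fps_nth F (nat (int k - (3 * m\<^sup>2 + m))))"
  proof (rule sum.reindex_bij_witness[of _ "\<lambda>m. 6 * m + 1" "\<lambda>t. t div 6"], goal_cases)
    case (1 t)
    then show ?case using t by simp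
  next
    case (2 t)
    then have "t mod 6 = 1" "nat ((t\<^sup>2 - 1) div 12) \<le> k" by auto
    then show ?case using e[of "t div 6"] unfolding t[OF \<open>t mod 6 = 1\<close>] by (simp add: nat_le_iff)
  next
    case (4 m)
    have "(6 * m + 1) mod 6 = 1" by presburger
    then show ?case using 4 unfolding mem_Collect_eq e by simp
  next
    case (5 t)
    then have "t mod 6 = 1" by simp
    have "k - nat ((t\<^sup>2 - 1) div 12) = nat (int k - (3 * (t div 6)\<^sup>2 + t div 6))"
      using e[of "t div 6"] unfolding t[OF \<open>t mod 6 = 1\<close>] by (simp add: nat_diff_distrib')
    then show ?case unfolding t[OF \<open>t mod 6 = 1\<close>] by simp
  qed simp
  finally show ?thesis .
qed

text \<open>The point of setting the sign of 0 to 1: a shift by \<open>c\<close> strictly between 0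
  and 1 moves an integer off 0 without changing this sign.\<close>

lemma sgn_plus_shift:
  assumes "x \<in> \<int>" "0 < c" "c < 1"
  shows "sgn_plus x = sgn (x + c)"
proof -
  obtain z where z: "x = real_of_int z" using assms(1) by (elim Ints_cases)
  consider "z = 0" | "z \<ge> 1" | "z \<le> -1" by linarith
  then show ?thesis
  proof cases
    case 3
    then have "x \<le> -1" unfolding z by linarith
    then show ?thesis using assms(2,3) by (simp add: sgn_plus_def)
  qed (use assms(2,3) z in \<open>auto simp: sgn_plus_def\<close>)
qed

text \<open>For \<open>x * y > 0\<close> the difference of \<open>|x - y|\<close> and
  \<open>|x + y|\<close> is -2 times the smaller absolute value, and the product of the two signs
  tells which of them is the smaller.\<close>

lemma sgn_plus_term:
  fixes x y :: int
  assumes "N \<in> \<int>" "0 < c" "c < 1" "N' \<in> \<int>" "0 < c'" "c' < 1"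
    and "N + c = real_of_int (x - y) / d" "N' + c' = real_of_int (x + y) / d" "d > 0" "x * y > 0"
  shows "sgn_plus N * sgn_plus N' * (\<bar>N + c\<bar> - \<bar>N' + c'\<bar>) = - 2 / d * mn \<bar>y\<bar> \<bar>x\<bar>"
proof -
  have d: "sgn (u / d) = sgn u" "\<bar>u / d\<bar> = \<bar>u\<bar> / d" for u :: real
    using assms(9) by (simp_all add: sgn_divide)
  consider "x > 0" "y > 0" | "x < 0" "y < 0" using assms(10) by (auto simp: zero_less_mult_iff)
  then have *: "sgn (real_of_int (x - y)) * sgn (real_of_int (x + y)) * (\<bar>real_of_int (x - y)\<bar> - \<bar>real_of_int (x + y)\<bar>) = - 2 * mn \<bar>y\<bar> \<bar>x\<bar>"
    by cases (auto simp: mn_def sgn_if abs_if)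
  have "sgn_plus N * sgn_plus N' * (\<bar>N + c\<bar> - \<bar>N' + c'\<bar>)
    = sgn (real_of_int (x - y)) * sgn (real_of_int (x + y)) * (\<bar>real_of_int (x - y)\<bar> - \<bar>real_of_int (x + y)\<bar>) / d"
    unfolding sgn_plus_shift[OF assms(1-3)] sgn_plus_shift[OF assms(4-6)] assms(7,8) d
    by (simp only: diff_divide_distrib[symmetric] times_divide_eq_right)
  then show ?thesis unfolding * by simp
qed

lemma finite_divisor_pairs: "finite {(a, b). a > 0 \<and> b > 0 \<and> a * b = (K :: int)}"
proof (rule finite_subset)
  show "{(a, b). a > 0 \<and> b > 0 \<and> a * b = K} \<subseteq> {0..K} \<times> {0..K}"
  proof
    fix z assume z: "z \<in> {(a, b). a > 0 \<and> b > 0 \<and> a * b = K}"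
    obtain a b where ab: "z = (a, b)" by (cases z)
    show "z \<in> {0..K} \<times> {0..K}" using z product_bound[of a b K] unfolding ab by simp
  qed
qed simp

text \<open>Each positive pair with \<open>b\<close> prime to 3 has exactly one of its two signs in
  the class \<open>b mod 3 = r\<close>. The positive pairs with \<open>3 dvd b\<close> are missing
  on the left, but they cancel on the right.\<close>

lemma divisor_sum_signs:
  fixes K r :: int
  assumes K: "K > 0" and r: "r = 1 \<or> r = 2"
    and Q: "\<And>a c. Q a (3 * c) \<longleftrightarrow> Q c (3 * a)"
  shows "(\<Sum>(a, b)\<in>{(a, b). a * b = K \<and> b mod 3 = r \<and> Q \<bar>a\<bar> \<bar>b\<bar>}. mn \<bar>b\<bar> (3 * \<bar>a\<bar>))
    = (\<Sum>(a, b)\<in>{(a, b). a > 0 \<and> b > 0 \<and> a * b = K \<and> Q a b}. mn b (3 * a))"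
proof -
  let ?P = "{(a, b). a > 0 \<and> b > 0 \<and> a * b = K \<and> Q a b}"
  let ?g = "\<lambda>(a, b). mn b (3 * a)"
  have fin: "finite ?P" by (rule finite_subset[OF _ finite_divisor_pairs[of K]]) auto
  have "(\<Sum>(a, b)\<in>{(a, b). a * b = K \<and> b mod 3 = r \<and> Q \<bar>a\<bar> \<bar>b\<bar>}. mn \<bar>b\<bar> (3 * \<bar>a\<bar>))
    = sum ?g {(a, b) \<in> ?P. \<not> 3 dvd b}"
  proof (rule sum.reindex_bij_witness[of _ "\<lambda>(a, b). if b mod 3 = r then (a, b) else (- a, - b)" "\<lambda>(a, b). (\<bar>a\<bar>, \<bar>b\<bar>)"], goal_cases)
    case (1 z)
    obtain a b where z: "z = (a, b)" by (cases z)
    have *: "a * b = K" "b mod 3 = r" using 1 unfolding z by auto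
    then consider "a > 0" "b > 0" | "a < 0" "b < 0" using K by (metis zero_less_mult_iff)
    then show ?case
    proof cases
      case 2
      have "- b mod 3 \<noteq> r" using *(2) r by presburger
      then show ?thesis using 2 unfolding z by simp
    qed (use * z in simp)
  next
    case (2 z)
    obtain a b where z: "z = (a, b)" by (cases z)
    have *: "a * b = K" "b mod 3 = r" "Q \<bar>a\<bar> \<bar>b\<bar>" using 2 unfolding z by auto
    then have "a \<noteq> 0" "b \<noteq> 0" "\<bar>a\<bar> * \<bar>b\<bar> = K" using K by (auto simp flip: abs_mult)
    moreover have "\<not> 3 dvd b" using *(2) r by presburger
    ultimately show ?case using * unfolding z by simp
  next
    case (3 z)
    then show ?case by (cases z) auto
  next
    case (4 z)
    obtain a b where z: "z = (a, b)" by (cases z)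
    have *: "a > 0" "b > 0" "a * b = K" "Q a b" "\<not> 3 dvd b" using 4 unfolding z by auto
    have "- b mod 3 = r" if "b mod 3 \<noteq> r" using that *(5) r by presburger
    then show ?case using * unfolding z by auto
  next
    case (5 z)
    then show ?case by (cases z) simp
  qed
  also have "\<dots> = sum ?g {(a, b) \<in> ?P. \<not> 3 dvd b} + sum ?g {(a, b) \<in> ?P. 3 dvd b}"
  proof -
    let ?T = "{(a, b) \<in> ?P. 3 dvd b}"
    \<comment> \<open>The involution \<open>(a, 3 * c) -> (c, 3 * a)\<close> keeps the product and
      exchanges the arguments of \<open>mn\<close>.\<close>
    have "sum ?g ?T = sum (\<lambda>z. - ?g z) ?T"
    proof (rule sum.reindex_bij_witness[of _ "\<lambda>(a, b). (b div 3, 3 * a)" "\<lambda>(a, b). (b div 3, 3 * a)"])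
      fix z assume z: "z \<in> ?T"
      obtain a b where "z = (a, b)" by (cases z)
      moreover from this z obtain c where "b = 3 * c" by auto
      ultimately have zc: "z = (a, 3 * c)" by simp
      then have *: "a > 0" "c > 0" "a * (3 * c) = K" "Q c (3 * a)" using z Q[of a c] by auto
      show "(\<lambda>(a, b). (b div 3, 3 * a)) ((\<lambda>(a, b). (b div 3, 3 * a)) z) = z"
        "(\<lambda>(a, b). (b div 3, 3 * a)) ((\<lambda>(a, b). (b div 3, 3 * a)) z) = z"
        "(\<lambda>(a, b). (b div 3, 3 * a)) z \<in> ?T" "(\<lambda>(a, b). (b div 3, 3 * a)) z \<in> ?T"
        using * unfolding zc by (simp_all add: mult_ac)
      show "- ?g ((\<lambda>(a, b). (b div 3, 3 * a)) z) = ?g z" unfolding zc by (simp add: mn_def)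
    qed
    then show ?thesis unfolding sum_negf by simp
  qed
  also have "\<dots> = sum ?g ({(a, b) \<in> ?P. \<not> 3 dvd b} \<union> {(a, b) \<in> ?P. 3 dvd b})"
  proof (rule sum.union_disjoint[symmetric])
    show "finite {(a, b) \<in> ?P. \<not> 3 dvd b}" "finite {(a, b) \<in> ?P. 3 dvd b}"
      by (rule finite_subset[OF _ fin], auto)+
  qed auto
  also have "{(a, b) \<in> ?P. \<not> 3 dvd b} \<union> {(a, b) \<in> ?P. 3 dvd b} = ?P" by auto
  finally show ?thesis .
qed

lemma of_int_divide_in_Ints_iff:
  assumes "d > 0"
  shows "real_of_int z / real_of_int d \<in> \<int> \<longleftrightarrow> d dvd z"
proof
  assume "real_of_int z / real_of_int d \<in> \<int>"
  then obtain y where "real_of_int z / real_of_int d = real_of_int y" by (elim Ints_cases)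
  then have "real_of_int z = real_of_int (d * y)" using assms by (simp add: field_simps)
  then show "d dvd z" by (simp only: of_int_eq_iff) simp
next
  assume "d dvd z"
  then show "real_of_int z / real_of_int d \<in> \<int>" using assms by (auto elim!: dvdE)
qed

text \<open>Vanishing of the odd coefficients of \<open>f(q^2)\<close> encodes the convention that
  \<open>c(f; n)\<close> is 0 for non-integral \<open>n\<close>.\<close>

lemma coeff_f_half:
  assumes "z \<ge> 0"
  shows "coeff_f (real_of_int z / 2) = fps_nth (mock_f oo fps_X ^ 2) (nat z)"
proof (cases "even z")
  case True
  then obtain w where w: "z = 2 * w" by blast
  then have "nat z = 2 * nat w" using assms by (simp add: nat_mult_distrib)
  then show ?thesis using assms unfolding coeff_f_def w by (simp add: fps_nth_compose_X_square)
next
  case False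
  then have "real_of_int z / 2 \<notin> \<int>" using of_int_divide_in_Ints_iff[of 2 z] by simp
  moreover have "odd (nat z)" using False assms by (simp add: even_nat_iff)
  ultimately show ?thesis by (simp add: coeff_f_def fps_nth_compose_X_square)
qed

lemma coeff_omega_h_of_int:
  assumes "z \<ge> 0"
  shows "coeff_omega_h h (real_of_int z) = (if z mod 2 = int h mod 2 then fps_nth mock_omega (nat z) else 0)"
  using assms by (simp add: coeff_omega_h_def coeff_omega_def)

lemma mock_f_recurrence:
  fixes n :: real
  assumes "2 * n \<in> \<int>" "n \<ge> 0"
  shows "(\<Sum>m | 3 * real_of_int m ^ 2 + 2 * real_of_int m \<le> 2 * n.
             (real_of_int m + 1 / 3) * coeff_f (n - 3 / 2 * real_of_int m ^ 2 - real_of_int m))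
    = - 2 * (\<Sum>(a, b) \<in> {(a, b). 8 * n + 1 = real_of_int a * real_of_int b
          \<and> (3 * real_of_int a - real_of_int b - 2) / 12 \<in> \<int> \<and> (3 * real_of_int a + real_of_int b - 4) / 12 \<in> \<int>}.
        sgn_plus ((3 * real_of_int a - real_of_int b - 2) / 12) * sgn_plus ((3 * real_of_int a + real_of_int b - 4) / 12) *
          (\<bar>(3 * real_of_int a - real_of_int b - 2) / 12 + 1 / 6\<bar> - \<bar>(3 * real_of_int a + real_of_int b - 4) / 12 + 1 / 3\<bar>))"
    (is "?L = - 2 * (\<Sum>(a, b) \<in> ?S. ?t a b)")
proof -
  obtain z where z: "2 * n = real_of_int z" using assms(1) by (elim Ints_cases)
  then have "z \<ge> 0" using assms(2) by linarith
  then obtain k where k: "2 * n = real k" using z by (metis nonneg_int_cases of_int_of_nat_eq)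
  let ?K = "4 * int k + 1"
  have "?L = (\<Sum>m\<in>{m. 3 * m\<^sup>2 + 2 * m \<le> int k}. 1 / 3 * (real_of_int (3 * m + 1) * fps_nth (mock_f oo fps_X ^ 2) (nat (int k - (3 * m\<^sup>2 + 2 * m)))))"
  proof (rule sum.cong, goal_cases)
    case 1
    have "3 * real_of_int m ^ 2 + 2 * real_of_int m \<le> 2 * n \<longleftrightarrow> real_of_int (3 * m\<^sup>2 + 2 * m) \<le> real_of_int (int k)" for m
      unfolding k by simp
    then show ?case by (simp only: of_int_le_iff)
  next
    case (2 m)
    have "n - 3 / 2 * real_of_int m ^ 2 - real_of_int m = real_of_int (int k - (3 * m\<^sup>2 + 2 * m)) / 2"
      using k by (simp add: field_simps)
    then show ?case using 2 coeff_f_half[of "int k - (3 * m\<^sup>2 + 2 * m)"] by (simp add: field_simps)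
  qed
  also have "\<dots> = 1 / 3 * fps_nth f_divisor k"
    unfolding sum_distrib_left[symmetric] theta3_mult_nth[symmetric] mock_f_theta3 ..
  also have "fps_nth f_divisor k = (\<Sum>(a, b)\<in>{(a, b). a > 0 \<and> b > 0 \<and> a * b = ?K \<and> True}. mn b (3 * a))"
    unfolding f_divisor_def gf_nth
  proof (rule sum.cong, goal_cases)
    case 1
    have "(a > 0 \<and> b > 0 \<and> a * b mod 4 = 1) \<and> nat ((a * b - 1) div 4) = k \<longleftrightarrow> a > 0 \<and> b > 0 \<and> a * b = ?K" for a b :: int
    proof
      assume *: "(a > 0 \<and> b > 0 \<and> a * b mod 4 = 1) \<and> nat ((a * b - 1) div 4) = k"
      then show "a > 0 \<and> b > 0 \<and> a * b = ?K" using int_nat_div[of "a * b" 1] by simp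
    next
      assume *: "a > 0 \<and> b > 0 \<and> a * b = ?K"
      then show "(a > 0 \<and> b > 0 \<and> a * b mod 4 = 1) \<and> nat ((a * b - 1) div 4) = k" by simp
    qed
    then show ?case by auto
  qed auto
  also have "\<dots> = (\<Sum>(a, b)\<in>{(a, b). a * b = ?K \<and> b mod 3 = 1 \<and> True}. mn \<bar>b\<bar> (3 * \<bar>a\<bar>))"
    by (rule divisor_sum_signs[symmetric]) simp_all
  also have "\<dots> = (\<Sum>(a, b)\<in>?S. - 6 * ?t a b)"
  proof (rule sum.cong)
    have iff: "8 * n + 1 = real_of_int a * real_of_int b \<and> (3 * real_of_int a - real_of_int b - 2) / 12 \<in> \<int> \<and> (3 * real_of_int a + real_of_int b - 4) / 12 \<in> \<int>
      \<longleftrightarrow> a * b = ?K \<and> b mod 3 = 1" for a b :: int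
    proof -
      have 1: "8 * n + 1 = real_of_int a * real_of_int b \<longleftrightarrow> a * b = ?K"
      proof -
        have K: "8 * n + 1 = real_of_int ?K" using k by simp
        have "8 * n + 1 = real_of_int a * real_of_int b \<longleftrightarrow> real_of_int (a * b) = real_of_int ?K" unfolding K by auto
        then show ?thesis unfolding of_int_eq_iff .
      qed
      have 2: "(3 * real_of_int a - real_of_int b - 2) / 12 \<in> \<int> \<longleftrightarrow> 12 dvd 3 * a - b - 2"
        using of_int_divide_in_Ints_iff[of 12 "3 * a - b - 2"] by simp
      have 3: "(3 * real_of_int a + real_of_int b - 4) / 12 \<in> \<int> \<longleftrightarrow> 12 dvd 3 * a + b - 4"
        using of_int_divide_in_Ints_iff[of 12 "3 * a + b - 4"] by simp
      \<comment> \<open>From \<open>a * b mod 4 = 1\<close> one gets that \<open>a\<close> and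
        \<open>b\<close> are both 1 or both 3 modulo 4, so the conditions modulo 4 hold by
        themselves; modulo 3 each says \<open>b mod 3 = 1\<close>.\<close>
      have "12 dvd 3 * a - b - 2 \<and> 12 dvd 3 * a + b - 4 \<longleftrightarrow> b mod 3 = 1" if "a * b = ?K"
      proof -
        have "a * b mod 4 = 1" using that by presburger
        from product_mod_4(1)[OF this] show ?thesis by presburger
      qed
      then show ?thesis unfolding 1 2 3 by blast
    qed
    show "{(a, b). a * b = ?K \<and> b mod 3 = 1 \<and> True} = ?S" unfolding iff by simp
    show "(case z of (a, b) \<Rightarrow> mn \<bar>b\<bar> (3 * \<bar>a\<bar>)) = (case z of (a, b) \<Rightarrow> - 6 * ?t a b)" if "z \<in> ?S" for z
    proof -
      obtain a b where z: "z = (a, b)" by (cases z)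
      have *: "(3 * real_of_int a - real_of_int b - 2) / 12 \<in> \<int>" "(3 * real_of_int a + real_of_int b - 4) / 12 \<in> \<int>" and "a * b = ?K"
        using that iff[of a b] unfolding z by auto
      then have pos: "3 * a * b > 0" by simp
      have "?t a b = - 2 / 12 * mn \<bar>b\<bar> \<bar>3 * a\<bar>"
        by (rule sgn_plus_term[OF *(1) _ _ *(2) _ _ _ _ _ pos]) (simp_all add: field_simps)
      then show ?thesis unfolding z by (simp add: abs_mult)
    qed
  qed
  also have "\<dots> = - 6 * (\<Sum>(a, b)\<in>?S. ?t a b)" unfolding sum_distrib_left by (rule sum.cong) auto
  finally show ?thesis by simp
qed

lemma mock_omega_recurrence_even:
  fixes n :: real
  assumes h: "h \<in> {0, 1}" and "n - real h / 2 \<in> \<int>" "n \<ge> 0"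
  shows "(\<Sum>m | 3 * real_of_int m ^ 2 + real_of_int m \<le> 2 * n.
             (real_of_int m + 1 / 6) * coeff_omega_h h (2 * n - 3 * real_of_int m ^ 2 - real_of_int m))
    = (- 1) ^ (1 + h) * (\<Sum>(a, b) \<in> {(a, b). 8 * n + 3 = real_of_int a * real_of_int b
          \<and> (3 * real_of_int a - real_of_int b - 4) / 12 \<in> \<int> \<and> (3 * real_of_int a + real_of_int b - 2) / 12 \<in> \<int>}.
        sgn_plus ((3 * real_of_int a - real_of_int b - 4) / 12) * sgn_plus ((3 * real_of_int a + real_of_int b - 2) / 12) *
          (\<bar>(3 * real_of_int a - real_of_int b - 4) / 12 + 1 / 3\<bar> - \<bar>(3 * real_of_int a + real_of_int b - 2) / 12 + 1 / 6\<bar>))"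
    (is "?L = _ * (\<Sum>(a, b) \<in> ?S. ?t a b)")
proof -
  obtain z where z: "n - real h / 2 = real_of_int z" using assms(2) by (elim Ints_cases)
  then have zh: "2 * n = real_of_int (2 * z + int h)" by (simp add: field_simps)
  then have "2 * z + int h \<ge> 0" using assms(3) by linarith
  then obtain k where kz: "2 * z + int h = int k" by (metis nonneg_int_cases)
  then have k: "2 * n = real k" using zh by simp
  have kh: "int k mod 2 = int h mod 2" using kz by presburger
  let ?K = "4 * int k + 3"
  have "?L = (\<Sum>m\<in>{m. 3 * m\<^sup>2 + m \<le> int k}. 1 / 6 * (real_of_int (6 * m + 1) * fps_nth mock_omega (nat (int k - (3 * m\<^sup>2 + m)))))"
  proof (rule sum.cong, goal_cases)
    case 1
    have "3 * real_of_int m ^ 2 + real_of_int m \<le> 2 * n \<longleftrightarrow> real_of_int (3 * m\<^sup>2 + m) \<le> real_of_int (int k)" for m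
      unfolding k by simp
    then show ?case by (simp only: of_int_le_iff)
  next
    case (2 m)
    have e: "2 * n - 3 * real_of_int m ^ 2 - real_of_int m = real_of_int (int k - (3 * m\<^sup>2 + m))"
      using k by simp
    \<comment> \<open>Hence every argument on the left has the parity of \<open>h\<close>, and
      \<open>c_h\<close> is the full coefficient.\<close>
    have "even (3 * m\<^sup>2 + m)" by simp
    then obtain w where w: "3 * m\<^sup>2 + m = 2 * w" by blast
    then have "(int k - (3 * m\<^sup>2 + m)) mod 2 = int h mod 2" using kh unfolding w by presburger
    then show ?case using 2 coeff_omega_h_of_int[of "int k - (3 * m\<^sup>2 + m)" h] unfolding e by (simp add: field_simps)
  qed
  also have "\<dots> = 1 / 6 * fps_nth omega_divisor k"
    unfolding sum_distrib_left[symmetric] theta6_mult_nth[symmetric] mock_omega_theta6 ..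
  also have "fps_nth omega_divisor k = (\<Sum>(a, b)\<in>{(a, b). a > 0 \<and> b > 0 \<and> a * b = ?K \<and> True}. (-1) ^ h * mn b (3 * a))"
    unfolding omega_divisor_def gf_nth
  proof (rule sum.cong, goal_cases)
    case 1
    have "(a > 0 \<and> b > 0 \<and> a * b mod 4 = 3) \<and> nat ((a * b - 3) div 4) = k \<longleftrightarrow> a > 0 \<and> b > 0 \<and> a * b = ?K" for a b :: int
    proof
      assume *: "(a > 0 \<and> b > 0 \<and> a * b mod 4 = 3) \<and> nat ((a * b - 3) div 4) = k"
      then show "a > 0 \<and> b > 0 \<and> a * b = ?K" using int_nat_div[of "a * b" 3] by simp
    next
      assume *: "a > 0 \<and> b > 0 \<and> a * b = ?K"
      have "?K mod 4 = 3" by presburger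
      then show "(a > 0 \<and> b > 0 \<and> a * b mod 4 = 3) \<and> nat ((a * b - 3) div 4) = k" using * by simp
    qed
    then show ?case by auto
  next
    case (2 z)
    \<comment> \<open>Here \<open>?K = 4 * k + 3\<close>, and \<open>k\<close> has the parity of
      \<open>h\<close>.\<close>
    have "(if ?K mod 8 = 3 then 1 else -1) = (-1 :: real) ^ h"
    proof -
      have "?K mod 8 = 3 \<longleftrightarrow> int h mod 2 = 0" using kh by presburger
      then show ?thesis using h by auto
    qed
    then show ?case using 2 by (cases z) auto
  qed
  also have "\<dots> = (-1) ^ h * (\<Sum>(a, b)\<in>{(a, b). a > 0 \<and> b > 0 \<and> a * b = ?K \<and> True}. mn b (3 * a))"
    unfolding sum_distrib_left by (rule sum.cong) auto
  also have "(\<Sum>(a, b)\<in>{(a, b). a > 0 \<and> b > 0 \<and> a * b = ?K \<and> True}. mn b (3 * a))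
    = (\<Sum>(a, b)\<in>{(a, b). a * b = ?K \<and> b mod 3 = 2 \<and> True}. mn \<bar>b\<bar> (3 * \<bar>a\<bar>))"
    by (rule divisor_sum_signs[symmetric]) simp_all
  also have "\<dots> = (\<Sum>(a, b)\<in>?S. - 6 * ?t a b)"
  proof (rule sum.cong)
    have iff: "8 * n + 3 = real_of_int a * real_of_int b \<and> (3 * real_of_int a - real_of_int b - 4) / 12 \<in> \<int> \<and> (3 * real_of_int a + real_of_int b - 2) / 12 \<in> \<int>
      \<longleftrightarrow> a * b = ?K \<and> b mod 3 = 2" for a b :: int
    proof -
      have 1: "8 * n + 3 = real_of_int a * real_of_int b \<longleftrightarrow> a * b = ?K"
      proof -
        have K: "8 * n + 3 = real_of_int ?K" using k by simp
        have "8 * n + 3 = real_of_int a * real_of_int b \<longleftrightarrow> real_of_int (a * b) = real_of_int ?K" unfolding K by auto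
        then show ?thesis unfolding of_int_eq_iff .
      qed
      have 2: "(3 * real_of_int a - real_of_int b - 4) / 12 \<in> \<int> \<longleftrightarrow> 12 dvd 3 * a - b - 4"
        using of_int_divide_in_Ints_iff[of 12 "3 * a - b - 4"] by simp
      have 3: "(3 * real_of_int a + real_of_int b - 2) / 12 \<in> \<int> \<longleftrightarrow> 12 dvd 3 * a + b - 2"
        using of_int_divide_in_Ints_iff[of 12 "3 * a + b - 2"] by simp
      have "12 dvd 3 * a - b - 4 \<and> 12 dvd 3 * a + b - 2 \<longleftrightarrow> b mod 3 = 2" if "a * b = ?K"
      proof -
        have "a * b mod 4 = 3" using that by presburger
        from product_mod_4(2)[OF this] show ?thesis by presburger
      qed
      then show ?thesis unfolding 1 2 3 by blast
    qed
    show "{(a, b). a * b = ?K \<and> b mod 3 = 2 \<and> True} = ?S" unfolding iff by simp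
    show "(case z of (a, b) \<Rightarrow> mn \<bar>b\<bar> (3 * \<bar>a\<bar>)) = (case z of (a, b) \<Rightarrow> - 6 * ?t a b)" if "z \<in> ?S" for z
    proof -
      obtain a b where z: "z = (a, b)" by (cases z)
      have *: "(3 * real_of_int a - real_of_int b - 4) / 12 \<in> \<int>" "(3 * real_of_int a + real_of_int b - 2) / 12 \<in> \<int>" and "a * b = ?K"
        using that iff[of a b] unfolding z by auto
      then have pos: "3 * a * b > 0" by simp
      have "?t a b = - 2 / 12 * mn \<bar>b\<bar> \<bar>3 * a\<bar>"
        by (rule sgn_plus_term[OF *(1) _ _ *(2) _ _ _ _ _ pos]) (simp_all add: field_simps)
      then show ?thesis unfolding z by (simp add: abs_mult)
    qed
  qed
  also have "\<dots> = - 6 * (\<Sum>(a, b)\<in>?S. ?t a b)" unfolding sum_distrib_left by (rule sum.cong) auto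
  finally show ?thesis by simp
qed

lemma sigma_half:
  assumes "l > 0"
  shows "sigma (real l / 2) = (if even l then real (\<Sum>d | d dvd l div 2. d) else 0)"
proof (cases "even l")
  case True
  then obtain w where "l = 2 * w" by blast
  then show ?thesis using assms by (simp add: sigma_def)
next
  case False
  then have "real l / 2 \<notin> \<int>" using of_int_divide_in_Ints_iff[of 2 "int l"] by simp
  then show ?thesis using False by (simp add: sigma_def)
qed

text \<open>The divisors of \<open>l\<close> with even cofactor are the divisors of
  \<open>l / 2\<close>.\<close>

lemma sum_divisors_split:
  assumes "l > (0 :: nat)"
  shows "(\<Sum>d | d dvd l. d) = (\<Sum>d | d dvd l \<and> odd (l div d). d) + (if even l then \<Sum>d | d dvd l div 2. d else 0)"
proof -
  have fin: "finite {d. d dvd l}" using assms by simp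
  have even: "{d. d dvd l \<and> even (l div d)} = (if even l then {d. d dvd l div 2} else {})"
  proof (rule set_eqI)
    fix d
    have "d dvd l \<and> even (l div d) \<longleftrightarrow> 2 * d dvd l"
    proof
      assume d: "d dvd l \<and> even (l div d)"
      then obtain e where "l div d = 2 * e" by blast
      then have "l = 2 * d * e" using d by (metis dvd_mult_div_cancel mult.assoc mult.commute)
      then show "2 * d dvd l" by simp
    next
      assume "2 * d dvd l"
      then obtain e where e: "l = 2 * d * e" by blast
      then have "d > 0" using assms by (cases d) auto
      then show "d dvd l \<and> even (l div d)" unfolding e by simp
    qed
    also have "\<dots> \<longleftrightarrow> even l \<and> d dvd l div 2" by (metis dvd_mult_left dvd_times_left_cancel_iff dvd_mult_div_cancel zero_neq_numeral)
    finally show "d \<in> {d. d dvd l \<and> even (l div d)} \<longleftrightarrow> d \<in> (if even l then {d. d dvd l div 2} else {})" by simp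
  qed
  have "{d. d dvd l} = {d. d dvd l \<and> odd (l div d)} \<union> {d. d dvd l \<and> even (l div d)}" by auto
  then have "(\<Sum>d | d dvd l. d) = sum (\<lambda>d. d) ({d. d dvd l \<and> odd (l div d)} \<union> {d. d dvd l \<and> even (l div d)})"
    by (rule arg_cong)
  also have "\<dots> = (\<Sum>d | d dvd l \<and> odd (l div d). d) + (\<Sum>d | d dvd l \<and> even (l div d). d)"
  proof (rule sum.union_disjoint)
    show "finite {d. d dvd l \<and> odd (l div d)}" "finite {d. d dvd l \<and> even (l div d)}"
      by (rule finite_subset[OF _ fin], blast)+
  qed blast
  finally show ?thesis unfolding even by simp
qed

text \<open>For odd \<open>k\<close> all divisors are odd and the sum is minus the divisor sum of
  \<open>k\<close>. For \<open>k = 2 * l\<close> an odd cofactor forces \<open>b = 2 * c\<close>,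
  and the sum is twice \<open>sigma l - sigma (l / 2)\<close>. These are the two branches of
  \<open>R_term\<close>.\<close>

lemma R_term_half:
  assumes "k > 0"
  shows "(\<Sum>(a, b)\<in>{(a, b). a > 0 \<and> b > 0 \<and> a * b = int k \<and> odd a}. (if even b then 1 else -1) * real_of_int b)
    = - 3 * R_term (real k / 2)"
proof -
  have "(\<Sum>(a, b)\<in>{(a, b). a > 0 \<and> b > 0 \<and> a * b = int k \<and> odd a}. (if even b then 1 else -1) * real_of_int b)
    = (\<Sum>d | d dvd k \<and> odd (k div d). (if even d then 1 else -1) * real d)"
  proof (rule sum.reindex_bij_witness[of _ "\<lambda>d. (int (k div d), int d)" "\<lambda>(a, b). nat b"])
    fix z assume z: "z \<in> {(a, b). a > 0 \<and> b > 0 \<and> a * b = int k \<and> odd a}"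
    obtain a' b' where z': "z = (a', b')" by (cases z)
    with z have "a' > 0" "b' > 0" by auto
    then obtain a b where "a' = int a" "b' = int b" by (metis nonneg_int_cases less_imp_le)
    then have ab: "z = (int a, int b)" using z' by simp
    have *: "b > 0" "odd a" using z unfolding ab by auto
    have "int (a * b) = int k" using z unfolding ab by simp
    then have k: "k = a * b" by (simp only: of_nat_eq_iff)
    show "(\<lambda>d. (int (k div d), int d)) ((\<lambda>(a, b). nat b) z) = z"
      and "(\<lambda>(a, b). nat b) z \<in> {d. d dvd k \<and> odd (k div d)}"
      and "(if even ((\<lambda>(a, b). nat b) z) then 1 else -1) * real ((\<lambda>(a, b). nat b) z) = (case z of (a, b) \<Rightarrow> (if even b then 1 else -1) * real_of_int b)"
      unfolding ab k using * by simp_all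
  next
    fix d assume d: "d \<in> {d. d dvd k \<and> odd (k div d)}"
    then obtain a where k: "k = d * a" by auto
    then have "a > 0" "d > 0" using assms by auto
    then show "(\<lambda>d. (int (k div d), int d)) d \<in> {(a, b). a > 0 \<and> b > 0 \<and> a * b = int k \<and> odd a}" using d unfolding k by simp
  qed simp
  also have "\<dots> = - 3 * R_term (real k / 2)"
  proof (cases "even k")
    case False
    have "{d. d dvd k \<and> odd (k div d)} = {d. d dvd k}" using False by (metis dvd_mult_div_cancel even_mult_iff)
    moreover have "odd d" if "d dvd k" for d using that False by (metis dvd_trans)
    ultimately have "(\<Sum>d | d dvd k \<and> odd (k div d). (if even d then 1 else -1) * real d) = (\<Sum>d | d dvd k. - real d)"
      by (intro sum.cong) auto
    also have "\<dots> = - sigma (real k)" using assms by (simp add: sigma_def sum_negf)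
    finally show ?thesis
      using False sigma_half[OF assms] of_int_divide_in_Ints_iff[of 2 "int k"] by (simp add: R_term_def)
  next
    case True
    then obtain l where k: "k = 2 * l" by blast
    have l: "l > 0" using assms k by simp
    have "(\<Sum>d | d dvd k \<and> odd (k div d). (if even d then 1 else -1) * real d) = (\<Sum>c | c dvd l \<and> odd (l div c). 2 * real c)"
    proof (rule sum.reindex_bij_witness[of _ "\<lambda>c. 2 * c" "\<lambda>d. d div 2"])
      fix d assume d: "d \<in> {d. d dvd k \<and> odd (k div d)}"
      then obtain a where a: "k = d * a" by auto
      then have "d > 0" using assms by auto
      then have "odd a" using d a by simp
      then have "even d" using a True by auto
      then obtain c where c: "d = 2 * c" by blast
      then have "l = c * a" "c > 0" using a k \<open>d > 0\<close> by simp_all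
      then show "2 * (d div 2) = d" "d div 2 \<in> {c. c dvd l \<and> odd (l div c)}" "2 * real (d div 2) = (if even d then 1 else -1) * real d"
        using \<open>odd a\<close> unfolding c by simp_all
    next
      fix c assume "c \<in> {c. c dvd l \<and> odd (l div c)}"
      then show "2 * c \<in> {d. d dvd k \<and> odd (k div d)}" unfolding k by simp
    qed simp
    also have "\<dots> = 2 * real (\<Sum>c | c dvd l \<and> odd (l div c). c)" by (simp add: sum_distrib_left)
    also have "real (\<Sum>c | c dvd l \<and> odd (l div c). c) = sigma (real l) - sigma (real l / 2)"
    proof -
      have "sigma (real l) = real (\<Sum>d | d dvd l. d)" using l by (simp add: sigma_def)
      then show ?thesis unfolding sum_divisors_split[OF l] sigma_half[OF l] by (simp split: if_splits)
    qed
    finally show ?thesis unfolding k by (simp add: R_term_def)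
  qed
  finally show ?thesis .
qed

text \<open>The signed mean of the two twists isolates one residue class modulo 2. In it the term
  with \<open>1 - \<delta>\<close> occurs only for \<delta> = -1, with factor 2, which the mean
  cancels.\<close>

lemma parity_divisor_combination:
  assumes h: "h = 0 \<or> h = (1 :: nat)" and k: "k = Suc e"
  shows "(fps_nth (parity_divisor 1) e + (-1) ^ h * fps_nth (parity_divisor (-1)) e) / 2
    = (-1) ^ h * ((\<Sum>(a, b)\<in>{(a, b). a > 0 \<and> b > 0 \<and> a * b = int k \<and> (a + b) mod 4 = 2 * int h}. mn (3 * b) a) + 3 * R_term (real k / 2))"
proof -
  let ?D = "{(a, b). a > 0 \<and> b > 0 \<and> a * b = int k}"
  let ?c = "\<lambda>\<delta> a b. (if even (a + b) then (if 4 dvd 3 * b - a then 1 else - \<delta>) * mn (3 * b) a else 0)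
        - (1 - \<delta>) * (if odd a then (if even b then 1 else -1) * real_of_int b else 0)"
  let ?q = "\<lambda>a b. if (a + b) mod 4 = 2 * int h then mn (3 * b) a else 0"
  let ?r = "\<lambda>a b. if odd a then (if even b then 1 else -1) * real_of_int b else 0"
  have nth: "fps_nth (parity_divisor \<delta>) e = (\<Sum>(a, b)\<in>?D. ?c \<delta> a b)" for \<delta>
    unfolding parity_divisor_def gf_nth
  proof (rule sum.cong)
    have "nat (a * b - 1) = e \<longleftrightarrow> a * b = int k" if "a > 0" "b > 0" for a b :: int
      using mult_pos_pos[OF that] unfolding k by auto
    then show "{i \<in> {(a, b). 0 < a \<and> 0 < b}. (case i of (a, b) \<Rightarrow> nat (a * b - 1)) = e} = ?D" by auto
  qed simp
  have "(?c 1 a b + (-1) ^ h * ?c (-1) a b) / 2 = (-1) ^ h * (?q a b - ?r a b)" for a b :: int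
  proof -
    have 4: "4 dvd 3 * b - a \<longleftrightarrow> (a + b) mod 4 = 0" by presburger
    have "((a + b) mod 4 = 0 \<and> even (a + b)) \<or> ((a + b) mod 4 = 2 \<and> even (a + b)) \<or> ((a + b) mod 4 \<noteq> 0 \<and> (a + b) mod 4 \<noteq> 2 \<and> odd (a + b))"
      by presburger
    then show ?thesis using h unfolding 4 by (elim disjE conjE; simp add: field_simps)
  qed
  then have "(fps_nth (parity_divisor 1) e + (-1) ^ h * fps_nth (parity_divisor (-1)) e) / 2
    = (\<Sum>(a, b)\<in>?D. (-1) ^ h * (?q a b - ?r a b))"
    unfolding nth sum_distrib_left sum.distrib[symmetric] sum_divide_distrib by (intro sum.cong) auto
  also have "\<dots> = (-1) ^ h * ((\<Sum>(a, b)\<in>?D. ?q a b) - (\<Sum>(a, b)\<in>?D. ?r a b))"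
    unfolding sum_distrib_left sum_subtractf[symmetric] by (intro sum.cong) auto
  also have "(\<Sum>(a, b)\<in>?D. ?q a b) = (\<Sum>(a, b)\<in>{(a, b). a > 0 \<and> b > 0 \<and> a * b = int k \<and> (a + b) mod 4 = 2 * int h}. mn (3 * b) a)"
    by (rule sum.mono_neutral_cong_right[OF finite_divisor_pairs]) (auto split: if_splits)
  also have "(\<Sum>(a, b)\<in>?D. ?r a b) = (\<Sum>(a, b)\<in>{(a, b). a > 0 \<and> b > 0 \<and> a * b = int k \<and> odd a}. (if even b then 1 else -1) * real_of_int b)"
    by (rule sum.mono_neutral_cong_right[OF finite_divisor_pairs]) (auto split: if_splits)
  also have "\<dots> = - 3 * R_term (real k / 2)"
    by (rule R_term_half) (simp add: k)
  finally show ?thesis by simp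
qed

text \<open>Split the conditions modulo 12 into their parts modulo 3 and 4. Modulo 3 both say
  \<open>a mod 3 = 2\<close>; modulo 4 the parity of \<open>N\<close> fixes \<open>a + b\<close>,
  and this already contains the parity needed for the other quotient.\<close>

lemma odd_index_iff:
  fixes a b :: int
  assumes h: "h = 0 \<or> h = (1 :: nat)"
  shows "(real_of_int a + 3 * real_of_int b - 2) / 6 \<in> \<int>
     \<and> (if h = 0 then (real_of_int a - 3 * real_of_int b - 2) / 6 \<in> real_of_int ` {k. odd k}
        else (real_of_int a - 3 * real_of_int b - 2) / 6 \<in> real_of_int ` {k. even k})
    \<longleftrightarrow> a mod 3 = 2 \<and> (a + b) mod 4 = 2 * int h"
proof -
  have 1: "(real_of_int a + 3 * real_of_int b - 2) / 6 \<in> \<int> \<longleftrightarrow> 6 dvd a + 3 * b - 2"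
    using of_int_divide_in_Ints_iff[of 6 "a + 3 * b - 2"] by simp
  have 2: "(real_of_int a - 3 * real_of_int b - 2) / 6 \<in> real_of_int ` {k. P k} \<longleftrightarrow> (\<exists>k. P k \<and> a - 3 * b - 2 = 6 * k)" for P
  proof -
    have "(real_of_int a - 3 * real_of_int b - 2) / 6 = real_of_int k \<longleftrightarrow> a - 3 * b - 2 = 6 * k" for k
    proof -
      have "(real_of_int a - 3 * real_of_int b - 2) / 6 = real_of_int k \<longleftrightarrow> real_of_int (a - 3 * b - 2) = real_of_int (6 * k)"
        by (simp add: field_simps)
      then show ?thesis by (simp only: of_int_eq_iff)
    qed
    then show ?thesis by auto
  qed
  have odd: "(\<exists>k. odd k \<and> z = 6 * k) \<longleftrightarrow> z mod 12 = 6" and even: "(\<exists>k. even k \<and> z = 6 * k) \<longleftrightarrow> z mod 12 = 0" for z :: int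
    by presburger+
  have mod12: "z mod 12 = 6 \<longleftrightarrow> z mod 3 = 0 \<and> z mod 4 = 2" "z mod 12 = 0 \<longleftrightarrow> z mod 3 = 0 \<and> z mod 4 = 0"
    and dvd6: "6 dvd z \<longleftrightarrow> z mod 3 = 0 \<and> even z" for z :: int
    by presburger+
  have mod3: "(a - 3 * b - 2) mod 3 = 0 \<longleftrightarrow> a mod 3 = 2" "(a + 3 * b - 2) mod 3 = 0 \<longleftrightarrow> a mod 3 = 2"
    by presburger+
  have mod4: "(a - 3 * b - 2) mod 4 = 2 \<longleftrightarrow> (a + b) mod 4 = 0" "(a - 3 * b - 2) mod 4 = 0 \<longleftrightarrow> (a + b) mod 4 = 2"
    by presburger+
  have parity: "even (a + 3 * b - 2) \<longleftrightarrow> even (a + b)" by simp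
  have ev: "(a + b) mod 4 = 0 \<Longrightarrow> even (a + b)" "(a + b) mod 4 = 2 \<Longrightarrow> even (a + b)" by presburger+
  have "6 dvd a + 3 * b - 2 \<and> (a - 3 * b - 2) mod 12 = 6 \<longleftrightarrow> a mod 3 = 2 \<and> (a + b) mod 4 = 0"
    unfolding mod12 dvd6 mod3 mod4 parity by (intro iffI conjI; elim conjE; (assumption | (rule ev, assumption)))
  moreover have "6 dvd a + 3 * b - 2 \<and> (a - 3 * b - 2) mod 12 = 0 \<longleftrightarrow> a mod 3 = 2 \<and> (a + b) mod 4 = 2"
    unfolding mod12 dvd6 mod3 mod4 parity by (intro iffI conjI; elim conjE; (assumption | (rule ev, assumption)))
  ultimately show ?thesis using h unfolding 1 2 odd even by auto
qed

lemma mock_omega_recurrence_odd: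
  fixes n :: real
  assumes h: "h \<in> {0, 1}" and "2 * n \<in> \<int>" "n > 0"
  shows "(\<Sum>m | 3 * real_of_int m ^ 2 + 2 * real_of_int m + 1 \<le> 2 * n.
             (real_of_int m + 1 / 3) * coeff_omega_h h (2 * n - 3 * real_of_int m ^ 2 - 2 * real_of_int m - 1))
    = (- 1) ^ h * R_term n + (- 1) ^ (1 + h) * (\<Sum>(a, b) \<in> {(a, b). 2 * n = real_of_int a * real_of_int b
          \<and> (real_of_int a + 3 * real_of_int b - 2) / 6 \<in> \<int>
          \<and> (if h = 0 then (real_of_int a - 3 * real_of_int b - 2) / 6 \<in> real_of_int ` {k. odd k}
             else (real_of_int a - 3 * real_of_int b - 2) / 6 \<in> real_of_int ` {k. even k})}.
        sgn_plus ((real_of_int a - 3 * real_of_int b - 2) / 6) * sgn_plus ((real_of_int a + 3 * real_of_int b - 2) / 6) *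
          (\<bar>(real_of_int a - 3 * real_of_int b - 2) / 6 + 1 / 3\<bar> - \<bar>(real_of_int a + 3 * real_of_int b - 2) / 6 + 1 / 3\<bar>))"
    (is "?L = _ + _ * (\<Sum>(a, b) \<in> ?S. ?t a b)")
proof -
  have h': "h = 0 \<or> h = 1" using h by auto
  obtain z where z: "2 * n = real_of_int z" using assms(2) by (elim Ints_cases)
  then have "z > 0" using assms(3) by linarith
  then obtain k' where "z = int k'" "k' > 0" using zero_less_imp_eq_int by blast
  \<comment> \<open>The exponent on the left is \<open>2 * n - 1 - (3 * m^2 + 2 * m)\<close>, so the
    relevant coefficient has index \<open>e = 2 * n - 1\<close>.\<close>
  then obtain e where "z = int (Suc e)" by (cases k') auto
  then obtain k where k: "2 * n = real k" "k = Suc e" using z by simp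
  have n: "n = real k / 2" using k(1) by simp
  let ?F = "Abs_fps (\<lambda>i. if int i mod 2 = int h mod 2 then fps_nth mock_omega i else 0)"
  let ?Q = "\<lambda>a b :: int. (a + b) mod 4 = 2 * int h"
  have F: "?F = fps_const (1 / 2) * (twist 1 mock_omega + fps_const ((-1) ^ h) * twist (-1) mock_omega)"
  proof (rule fps_ext)
    fix i
    have "int i mod 2 = int h mod 2 \<longleftrightarrow> even (i + h)" by presburger
    then show "fps_nth ?F i = fps_nth (fps_const (1 / 2) * (twist 1 mock_omega + fps_const ((-1) ^ h) * twist (-1) mock_omega)) i"
      using h' by (auto simp: twist_def)
  qed
  have "?L = (\<Sum>m\<in>{m. 3 * m\<^sup>2 + 2 * m \<le> int e}. 1 / 3 * (real_of_int (3 * m + 1) * fps_nth ?F (nat (int e - (3 * m\<^sup>2 + 2 * m)))))"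
  proof (rule sum.cong, goal_cases)
    case 1
    have "3 * real_of_int m ^ 2 + 2 * real_of_int m + 1 \<le> 2 * n \<longleftrightarrow> real_of_int (3 * m\<^sup>2 + 2 * m) \<le> real_of_int (int e)" for m
      unfolding k by simp
    then show ?case by (simp only: of_int_le_iff)
  next
    case (2 m)
    have e: "2 * n - 3 * real_of_int m ^ 2 - 2 * real_of_int m - 1 = real_of_int (int e - (3 * m\<^sup>2 + 2 * m))"
      using k by simp
    have pos: "int e - (3 * m\<^sup>2 + 2 * m) \<ge> 0" using 2 by simp
    have "coeff_omega_h h (real_of_int (int e - (3 * m\<^sup>2 + 2 * m))) = fps_nth ?F (nat (int e - (3 * m\<^sup>2 + 2 * m)))"
      unfolding coeff_omega_h_of_int[OF pos] fps_nth_Abs_fps int_nat_eq using pos by (simp only: if_True)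
    moreover have "real_of_int m + 1 / 3 = 1 / 3 * real_of_int (3 * m + 1)" by simp
    ultimately show ?case unfolding e by (simp only: mult.assoc)
  qed
  also have "\<dots> = 1 / 3 * fps_nth (?F * theta3) e"
    unfolding sum_distrib_left[symmetric] theta3_mult_nth[symmetric] ..
  also have "?F * theta3 = fps_const (1 / 2) * (parity_divisor 1 + fps_const ((-1) ^ h) * parity_divisor (-1))"
    unfolding F by (simp only: distrib_right mult.assoc twist_mock_omega_theta3[of 1, simplified] twist_mock_omega_theta3[of "-1", simplified])
  also have "1 / 3 * fps_nth \<dots> e = 1 / 3 * ((fps_nth (parity_divisor 1) e + (-1) ^ h * fps_nth (parity_divisor (-1)) e) / 2)"
    by simp
  also have "\<dots> = 1 / 3 * ((-1) ^ h * ((\<Sum>(a, b)\<in>{(a, b). a > 0 \<and> b > 0 \<and> a * b = int k \<and> ?Q a b}. mn (3 * b) a) + 3 * R_term n))"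
    unfolding parity_divisor_combination[OF h' k(2)] by (simp only: n)
  also have "(\<Sum>(a, b)\<in>{(a, b). a > 0 \<and> b > 0 \<and> a * b = int k \<and> ?Q a b}. mn (3 * b) a) = - 3 * (\<Sum>(a, b)\<in>?S. ?t a b)"
  proof -
    \<comment> \<open>The factors are exchanged, because here the multiple of 3 is attached to
      \<open>b\<close>, whereas \<open>divisor_sum_signs\<close> attaches it to
      \<open>a\<close>.\<close>
    have "(\<Sum>(a, b)\<in>{(a, b). a > 0 \<and> b > 0 \<and> a * b = int k \<and> ?Q a b}. mn (3 * b) a)
      = (\<Sum>(a, b)\<in>{(a, b). a > 0 \<and> b > 0 \<and> a * b = int k \<and> ?Q a b}. - mn b (3 * a))"
      by (rule sum.reindex_bij_witness[of _ "\<lambda>(a, b). (b, a)" "\<lambda>(a, b). (b, a)"]) (auto simp: mult.commute add.commute intro: mn_swap[symmetric])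
    also have "\<dots> = - (\<Sum>(a, b)\<in>{(a, b). a > 0 \<and> b > 0 \<and> a * b = int k \<and> ?Q a b}. mn b (3 * a))"
      unfolding sum_negf[symmetric] by (rule sum.cong) auto
    also have "(\<Sum>(a, b)\<in>{(a, b). a > 0 \<and> b > 0 \<and> a * b = int k \<and> ?Q a b}. mn b (3 * a))
      = (\<Sum>(a, b)\<in>{(a, b). a * b = int k \<and> b mod 3 = 2 \<and> ?Q \<bar>a\<bar> \<bar>b\<bar>}. mn \<bar>b\<bar> (3 * \<bar>a\<bar>))"
    proof (rule divisor_sum_signs[symmetric])
      \<comment> \<open>Modulo 4, \<open>c + 3 * a\<close> is 3 times \<open>a + 3 * c\<close>, and
        multiplication by 3 fixes the residues 0 and 2.\<close>
      show "?Q a (3 * c) \<longleftrightarrow> ?Q c (3 * a)" for a c using h' by (elim disjE; simp only:; presburger)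
    qed (simp_all add: k)
    also have "\<dots> = (\<Sum>(a, b)\<in>?S. 3 * ?t a b)"
    proof (rule sum.reindex_bij_witness[of _ "\<lambda>(a, b). (b, a)" "\<lambda>(a, b). (b, a)"])
      have S: "(a, b) \<in> ?S \<longleftrightarrow> a * b = int k \<and> a mod 3 = 2 \<and> ?Q \<bar>b\<bar> \<bar>a\<bar>" for a b
      proof -
        have 1: "2 * n = real_of_int a * real_of_int b \<longleftrightarrow> a * b = int k"
        proof -
          have "2 * n = real_of_int a * real_of_int b \<longleftrightarrow> real_of_int (a * b) = real_of_int (int k)" unfolding k(1) by auto
          then show ?thesis unfolding of_int_eq_iff .
        qed
        \<comment> \<open>The factors have equal signs, and the residues 0 and 2 modulo 4 are their
          own negatives.\<close>
        have "?Q a b \<longleftrightarrow> ?Q \<bar>b\<bar> \<bar>a\<bar>" if "a * b = int k"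
        proof -
          have "a * b > 0" using that k by simp
          then consider "a > 0" "b > 0" | "a < 0" "b < 0" by (auto simp: zero_less_mult_iff)
          then show ?thesis
          proof cases
            case 1
            then show ?thesis by (simp add: add.commute)
          next
            case 2
            then have flip: "\<bar>b\<bar> + \<bar>a\<bar> = - (a + b)" by simp
            have "x mod 4 = 2 * int h \<longleftrightarrow> - x mod 4 = 2 * int h" for x :: int
              using h' by (elim disjE; simp only:; presburger)
            then show ?thesis unfolding flip .
          qed
        qed
        then show ?thesis unfolding mem_Collect_eq prod.case 1 odd_index_iff[OF h'] by blast
      qed
      fix z :: "int \<times> int"
      obtain a b where z: "z = (a, b)" by (cases z)
      show "(\<lambda>(a, b). (b, a)) ((\<lambda>(a, b). (b, a)) z) = z" unfolding z by simp
      then show "(\<lambda>(a, b). (b, a)) ((\<lambda>(a, b). (b, a)) z) = z" .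
      show "(\<lambda>(a, b). (b, a)) z \<in> ?S" if "z \<in> {(a, b). a * b = int k \<and> b mod 3 = 2 \<and> ?Q \<bar>a\<bar> \<bar>b\<bar>}"
        using that unfolding z prod.case S by (simp add: mult.commute)
      show "(\<lambda>(a, b). (b, a)) z \<in> {(a, b). a * b = int k \<and> b mod 3 = 2 \<and> ?Q \<bar>a\<bar> \<bar>b\<bar>}" if "z \<in> ?S"
        using that unfolding z S by (simp add: mult.commute)
      show "(case (\<lambda>(a, b). (b, a)) z of (a, b) \<Rightarrow> 3 * ?t a b) = (case z of (a, b) \<Rightarrow> mn \<bar>b\<bar> (3 * \<bar>a\<bar>))"
        if z': "z \<in> {(a, b). a * b = int k \<and> b mod 3 = 2 \<and> ?Q \<bar>a\<bar> \<bar>b\<bar>}"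
      proof -
        have "(b, a) \<in> ?S" using z' unfolding z S by (simp add: mult.commute)
        then have *: "(real_of_int b + 3 * real_of_int a - 2) / 6 \<in> \<int>" "(real_of_int b - 3 * real_of_int a - 2) / 6 \<in> \<int>"
          by (auto split: if_splits)
        have ba: "b * a = int k" using z' unfolding z by (simp add: mult.commute)
        have pos: "b * (3 * a) > 0" unfolding mult.left_commute[of b 3 a] ba k(2) by simp
        have t: "?t b a = - 2 / 6 * mn \<bar>3 * a\<bar> \<bar>b\<bar>"
          by (rule sgn_plus_term[OF *(2) _ _ *(1) _ _ _ _ _ pos]) (simp_all add: field_simps)
        have swap: "mn \<bar>3 * a\<bar> \<bar>b\<bar> = - mn \<bar>b\<bar> (3 * \<bar>a\<bar>)"
          using mn_swap[of "\<bar>3 * a\<bar>" "\<bar>b\<bar>"] by (simp add: abs_mult)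
        show ?thesis unfolding z prod.case t swap by simp
      qed
    qed
    also have "\<dots> = 3 * (\<Sum>(a, b)\<in>?S. ?t a b)" unfolding sum_distrib_left by (rule sum.cong) auto
    finally show ?thesis by simp
  qed
  also have "1 / 3 * ((-1) ^ h * (- 3 * T + 3 * R)) = (-1) ^ h * R + (-1) ^ (1 + h) * T" for T R :: real
    by (simp add: algebra_simps)
  finally show ?thesis .
qed

theorem theorem4p6:
  shows
   "(\<forall>n::real. 2 * n \<in> \<int> \<and> n \<ge> 0 \<longrightarrow>
      (let N = (\<lambda>a b :: int. (3 * real_of_int a - real_of_int b - 2) / 12);
           N' = (\<lambda>a b :: int. (3 * real_of_int a + real_of_int b - 4) / 12)
       in (\<Sum>m | 3 * real_of_int m ^ 2 + 2 * real_of_int m \<le> 2 * n.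
             (real_of_int m + 1 / 3) *
               coeff_f (n - 3 / 2 * real_of_int m ^ 2 - real_of_int m))
          = - 2 * (\<Sum>(a, b) \<in> {(a, b). 8 * n + 1 = real_of_int a * real_of_int b
                                   \<and> N a b \<in> \<int> \<and> N' a b \<in> \<int>}.
               sgn_plus (N a b) * sgn_plus (N' a b) *
                 (\<bar>N a b + 1 / 6\<bar> - \<bar>N' a b + 1 / 3\<bar>))))
    \<and>
    (\<forall>(h::nat) (n::real). h \<in> {0, 1} \<and> n - real h / 2 \<in> \<int> \<and> n \<ge> 0 \<longrightarrow>
      (let N = (\<lambda>a b :: int. (3 * real_of_int a - real_of_int b - 4) / 12);
           N' = (\<lambda>a b :: int. (3 * real_of_int a + real_of_int b - 2) / 12)
       in (\<Sum>m | 3 * real_of_int m ^ 2 + real_of_int m \<le> 2 * n.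
             (real_of_int m + 1 / 6) *
               coeff_omega_h h (2 * n - 3 * real_of_int m ^ 2 - real_of_int m))
          = (- 1) ^ (1 + h) *
            (\<Sum>(a, b) \<in> {(a, b). 8 * n + 3 = real_of_int a * real_of_int b
                                   \<and> N a b \<in> \<int> \<and> N' a b \<in> \<int>}.
               sgn_plus (N a b) * sgn_plus (N' a b) *
                 (\<bar>N a b + 1 / 3\<bar> - \<bar>N' a b + 1 / 6\<bar>))))
    \<and>
    (\<forall>(h::nat) (n::real). h \<in> {0, 1} \<and> 2 * n \<in> \<int> \<and> n > 0 \<longrightarrow>
      (let N = (\<lambda>a b :: int. (real_of_int a - 3 * real_of_int b - 2) / 6);
           N' = (\<lambda>a b :: int. (real_of_int a + 3 * real_of_int b - 2) / 6)
       in (\<Sum>m | 3 * real_of_int m ^ 2 + 2 * real_of_int m + 1 \<le> 2 * n.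
             (real_of_int m + 1 / 3) *
               coeff_omega_h h (2 * n - 3 * real_of_int m ^ 2 - 2 * real_of_int m - 1))
          = (- 1) ^ h * R_term n + (- 1) ^ (1 + h) *
            (\<Sum>(a, b) \<in> {(a, b). 2 * n = real_of_int a * real_of_int b
                                   \<and> N' a b \<in> \<int>
                                   \<and> (if h = 0 then N a b \<in> real_of_int ` {k. odd k}
                                      else N a b \<in> real_of_int ` {k. even k})}.
               sgn_plus (N a b) * sgn_plus (N' a b) *
                 (\<bar>N a b + 1 / 3\<bar> - \<bar>N' a b + 1 / 3\<bar>))))"
  unfolding Let_def
  by (intro conjI allI impI; elim conjE; rule mock_f_recurrence mock_omega_recurrence_even mock_omega_recurrence_odd)

end
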